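(* 1) Let $\mathfrak{g}$ be a semisimple Lie algebra over $\mathbb{C}$ and let $V$ be any integrable $\mathfrak{g}$-module (not necessarily highest weight, nor with finite-dimensional weight spaces). If $\mu_0,\mu\in\mathrm{wt}\,V$ with $\mu_0\prec\mu$ and $\mu_0\ne\mu$, then there exist $\mu_i\in\mathrm{wt}\,V$, $1\le i\le n=\mathrm{ht}(\mu-\mu_0)$, with $\mu_n=\mu$ and $\mu_i-\mu_{i-1}\in\Pi$ for all $1\le i\le n$. 2) Let $\mathfrak{g}$ be a Kac--Moody algebra over $\mathbb{C}$ and $J\subset\mathcal{I}$. Suppose $\mathfrak{g}_J$ is semisimple and $M$ is a finite-dimensional $\mathfrak{g}_J$ (or $\mathfrak{p}_J$)-module. Then: (a) The $\mathfrak{g}$-module $N:=U(\mathfrak{g})\otimes_{U(\mathfrak{p}_J)}M$ (defined analogously to a parabolic Verma module) is $\mathfrak{g}_J$-integrable. (b) If $\mu_0,\mu\in\mathrm{wt}\,N$ with $\mu_0\prec\mu$ and $\mu_0\neq\mu$, then there exist $\mu_i\in\mathrm{wt}\,N$, $1\le i\le n=\mathrm{ht}(\mu-\mu_0)$, with $\mu_n=\mu$ and $\mu_i-\mu_{i-1}\in\Pi$ for all $1\le i\le n$.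
   Context: $\mathfrak{g}=\mathfrak{g}(A)$ has Cartan subalgebra $\mathfrak{h}$, simple roots $\Pi=\{\alpha_i\}_{i\in\mathcal{I}}$ ($\mathcal{I}$ finite), positive roots $\Delta^+$, Chevalley generators $e_i,f_i$, and positive nilpotent part $\mathfrak{n}^+$. For $J\subset\mathcal{I}$, $\mathfrak{g}_J$ is the Kac--Moody subalgebra corresponding to $A_{J\times J}$ (generated by $e_j,f_j$, $j\in J$, and its Cartan subalgebra $\mathfrak{h}_J\subset\mathfrak{h}$), $\Delta_J^+=\Delta^+\cap\mathbb{Z}\{\alpha_j\mid j\in J\}$, and $\mathfrak{p}_J=\mathfrak{g}_J+\mathfrak{h}+\mathfrak{n}^+$. The parabolic Verma module of highest weight $\lambda$ is $U(\mathfrak{g})\otimes_{U(\mathfrak{p}_J)}L$, where $L$ is the largest integrable highest weight $\mathfrak{g}_J$-module of highest weight $\lambda$, regarded as a $\mathfrak{p}_J$-module via the natural action of $\mathfrak{h}$ and the trivial action of the root spaces for $\Delta^+\setminus\Delta_J^+$. For an $\mathfrak{h}$-module $V$, $\mathrm{wt}\,V\subset\mathfrak{h}^*$ is its set of weights (those $\mu$ for which the weight space $\{v\in V\mid hv=\mu(h)v\ \forall h\in\mathfrak{h}\}$ is nonzero); a weight module is one that is the direct sum of its weight spaces. A weight module is $\mathfrak{g}_J$-integrable if $e_j,f_j$ act locally nilpotently for all $j\in J$, and integrable if this holds with $J=\mathcal{I}$. $x\prec y$ means $y-x\in\mathbb{Z}_{\ge0}\Pi$; $\mathrm{ht}(\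sum_ic_i\alpha_i)=\sum_ic_i$.
   Formalization: In 2(a), N is shown to be a weight module (hence g_J-integrable) only when M is an h-weight module, since otherwise N is not a weight module; for every finite-dimensional M the e_j, f_j with j in J are shown to act locally nilpotently on N. *)

theory Defs
  imports "HOL-Analysis.Analysis" "HOL-Library.Poly_Mapping"
begin

section \<open>Complex vector spaces\<close>

class complex_vector = ab_group_add +
  fixes scaleC :: "complex \<Rightarrow> 'a \<Rightarrow> 'a"  (infixr \<open>*\<^sub>C\<close> 75)
  assumes scaleC_add_right: "c *\<^sub>C (x + y) = c *\<^sub>C x + c *\<^sub>C y"
    and scaleC_add_left: "(c + d) *\<^sub>C x = c *\<^sub>C x + d *\<^sub>C x"
    and scaleC_scaleC: "c *\<^sub>C d *\<^sub>C x = (c * d) *\<^sub>C x"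
    and scaleC_one: "1 *\<^sub>C x = x"

global_interpretation cvec: vector_space "scaleC :: complex \<Rightarrow> 'a \<Rightarrow> 'a::complex_vector"
  by unfold_locales
    (simp_all add: scaleC_add_right scaleC_add_left scaleC_scaleC scaleC_one)

instantiation complex :: complex_vector
begin
definition scaleC_complex :: "complex \<Rightarrow> complex \<Rightarrow> complex"
  where "scaleC_complex c x = c * x"
instance
  by standard (simp_all add: scaleC_complex_def algebra_simps)
end

instantiation poly_mapping :: (type, complex_vector) complex_vector
begin
lift_definition scaleC_poly_mapping :: "complex \<Rightarrow> ('a \<Rightarrow>\<^sub>0 'b) \<Rightarrow> 'a \<Rightarrow>\<^sub>0 'b"
  is "\<lambda>c f x. c *\<^sub>C f x"
proof -
  fix c and f :: "'a \<Rightarrow> 'b"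
  assume "finite {x. f x \<noteq> 0}"
  then show "finite {x. c *\<^sub>C f x \<noteq> 0}"
    by (rule rev_finite_subset) auto
qed
instance
  by standard
    (transfer, simp add: scaleC_add_right scaleC_add_left scaleC_scaleC scaleC_one)+
end

abbreviation clinear :: "('a::complex_vector \<Rightarrow> 'b::complex_vector) \<Rightarrow> bool"
  where "clinear \<equiv> Vector_Spaces.linear scaleC scaleC"

definition fin_dim :: "'a::complex_vector set \<Rightarrow> bool"
  where "fin_dim S \<longleftrightarrow> (\<exists>B. finite B \<and> S = cvec.span B)"


section \<open>Complex Lie algebras\<close>

class complex_lie_algebra = complex_vector +
  fixes lie :: "'a \<Rightarrow> 'a \<Rightarrow> 'a"
  assumes lie_add_left: "lie (x + y) z = lie x z + lie y z"
    and lie_add_right: "lie z (x + y) = lie z x + lie z y"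
    and lie_scaleC_left: "lie (c *\<^sub>C x) y = c *\<^sub>C lie x y"
    and lie_scaleC_right: "lie x (c *\<^sub>C y) = c *\<^sub>C lie x y"
    and lie_self: "lie x x = 0"
    and jacobi: "lie x (lie y z) + lie y (lie z x) + lie z (lie x y) = 0"

definition lie_subalgebra :: "'g::complex_lie_algebra set \<Rightarrow> bool"
  where "lie_subalgebra S \<longleftrightarrow> cvec.subspace S \<and> (\<forall>x\<in>S. \<forall>y\<in>S. lie x y \<in> S)"

definition lie_ideal :: "'g::complex_lie_algebra set \<Rightarrow> 'g set \<Rightarrow> bool"
  where "lie_ideal S I \<longleftrightarrow>
    cvec.subspace I \<and> I \<subseteq> S \<and> (\<forall>x\<in>S. \<forall>y\<in>I. lie x y \<in> I)"

definition derived_algebra :: "'g::complex_lie_algebra set \<Rightarrow> 'g set"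
  where "derived_algebra S = cvec.span {lie x y |x y. x \<in> S \<and> y \<in> S}"

definition solvable_lie :: "'g::complex_lie_algebra set \<Rightarrow> bool"
  where "solvable_lie S \<longleftrightarrow> (\<exists>n. (derived_algebra ^^ n) S = {0})"

text \<open>Finite-dimensional with zero radical; the zero algebra is counted as semisimple.\<close>

definition semisimple_lie :: "'g::complex_lie_algebra set \<Rightarrow> bool"
  where "semisimple_lie S \<longleftrightarrow> lie_subalgebra S \<and> fin_dim S \<and>
    (\<forall>I. lie_ideal S I \<and> solvable_lie I \<longrightarrow> I = {0})"


section \<open>Representations\<close>

definition linear_action ::
    "'g::complex_lie_algebra set \<Rightarrow> ('g \<Rightarrow> 'v::complex_vector \<Rightarrow> 'v) \<Rightarrow> bool"
  where "linear_action S act \<longleftrightarrow>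
    (\<forall>x\<in>S. clinear (act x)) \<and>
    (\<forall>x\<in>S. \<forall>y\<in>S. \<forall>v. act (x + y) v = act x v + act y v) \<and>
    (\<forall>x\<in>S. \<forall>c v. act (c *\<^sub>C x) v = c *\<^sub>C act x v)"

definition lie_module ::
    "'g::complex_lie_algebra set \<Rightarrow> ('g \<Rightarrow> 'v::complex_vector \<Rightarrow> 'v) \<Rightarrow> bool"
  where "lie_module S act \<longleftrightarrow> linear_action S act \<and>
    (\<forall>x\<in>S. \<forall>y\<in>S. \<forall>v. act (lie x y) v = act x (act y v) - act y (act x v))"

definition locally_nilpotent :: "('v::zero \<Rightarrow> 'v) \<Rightarrow> bool"
  where "locally_nilpotent T \<longleftrightarrow> (\<forall>v. \<exists>n. (T ^^ n) v = 0)"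


section \<open>The universal enveloping algebra\<close>

text \<open>
  The enveloping algebra of \<open>'g\<close> is the free associative algebra on the set \<open>'g\<close>
  (finitely supported functions on the free monoid, with convolution) modulo the
  two-sided ideal that makes the generators linear and turns commutators into brackets.
\<close>

datatype 'a free_monoid = Mon "'a list"

instantiation free_monoid :: (type) monoid_add
begin
definition zero_free_monoid :: "'a free_monoid" where "0 = Mon []"
primrec plus_free_monoid :: "'a free_monoid \<Rightarrow> 'a free_monoid \<Rightarrow> 'a free_monoid" where
  "plus_free_monoid (Mon xs) q = (case q of Mon ys \<Rightarrow> Mon (xs @ ys))"
instance
proof
  fix a b c :: "'a free_monoid"
  show "a + b + c = a + (b + c)" by (cases a; cases b; cases c) simp
  show "0 + a = a" by (cases a) (simp add: zero_free_monoid_def)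
  show "a + 0 = a" by (cases a) (simp add: zero_free_monoid_def)
qed
end

type_synonym 'a free_algebra = "'a free_monoid \<Rightarrow>\<^sub>0 complex"

definition free_gen :: "'a \<Rightarrow> 'a free_algebra"
  where "free_gen x = Poly_Mapping.single (Mon [x]) 1"

inductive_set uea_ideal :: "'g::complex_lie_algebra free_algebra set" where
  zero: "0 \<in> uea_ideal"
| add: "a \<in> uea_ideal \<Longrightarrow> b \<in> uea_ideal \<Longrightarrow> a + b \<in> uea_ideal"
| scale: "a \<in> uea_ideal \<Longrightarrow> c *\<^sub>C a \<in> uea_ideal"
| mult_left: "a \<in> uea_ideal \<Longrightarrow> r * a \<in> uea_ideal"
| mult_right: "a \<in> uea_ideal \<Longrightarrow> a * r \<in> uea_ideal"
| gen_add: "free_gen (x + y) - free_gen x - free_gen y \<in> uea_ideal"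
| gen_scale: "free_gen (c *\<^sub>C x) - c *\<^sub>C free_gen x \<in> uea_ideal"
| gen_lie: "free_gen x * free_gen y - free_gen y * free_gen x - free_gen (lie x y) \<in> uea_ideal"

lemma uea_ideal_uminus: "a \<in> uea_ideal \<Longrightarrow> - a \<in> uea_ideal"
  using uea_ideal.scale[of a "-1"] by (simp add: cvec.scale_minus_left scaleC_one)

definition uea_rel :: "'g::complex_lie_algebra free_algebra \<Rightarrow> 'g free_algebra \<Rightarrow> bool"
  where "uea_rel a b \<longleftrightarrow> a - b \<in> uea_ideal"

quotient_type (overloaded) 'g uea = "'g::complex_lie_algebra free_algebra" / uea_rel
proof (rule equivpI)
  show "reflp uea_rel" by (simp add: reflp_def uea_rel_def uea_ideal.zero)
  show "symp uea_rel"
    unfolding symp_def uea_rel_def by (metis minus_diff_eq uea_ideal_uminus)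
  show "transp uea_rel"
    unfolding transp_def uea_rel_def using uea_ideal.add by fastforce
qed

instantiation uea :: (complex_lie_algebra) "{ring, monoid_mult, complex_vector}"
begin
lift_definition zero_uea :: "'a uea" is 0 .
lift_definition one_uea :: "'a uea" is 1 .
lift_definition plus_uea :: "'a uea \<Rightarrow> 'a uea \<Rightarrow> 'a uea" is "(+)"
proof (unfold uea_rel_def)
  fix a b c d :: "'a free_algebra"
  assume "a - b \<in> uea_ideal" "c - d \<in> uea_ideal"
  from uea_ideal.add[OF this] show "a + c - (b + d) \<in> uea_ideal"
    by (simp add: algebra_simps)
qed
lift_definition uminus_uea :: "'a uea \<Rightarrow> 'a uea" is uminus
proof (unfold uea_rel_def)
  fix a b :: "'a free_algebra"
  assume "a - b \<in> uea_ideal"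
  from uea_ideal_uminus[OF this] show "- a - - b \<in> uea_ideal" by simp
qed
lift_definition minus_uea :: "'a uea \<Rightarrow> 'a uea \<Rightarrow> 'a uea" is "(-)"
proof (unfold uea_rel_def)
  fix a b c d :: "'a free_algebra"
  assume "a - b \<in> uea_ideal" "c - d \<in> uea_ideal"
  from uea_ideal.add[OF this(1) uea_ideal_uminus[OF this(2)]]
  show "a - c - (b - d) \<in> uea_ideal" by (simp add: algebra_simps)
qed
lift_definition times_uea :: "'a uea \<Rightarrow> 'a uea \<Rightarrow> 'a uea" is "(*)"
proof (unfold uea_rel_def)
  fix a b c d :: "'a free_algebra"
  assume "a - b \<in> uea_ideal" "c - d \<in> uea_ideal"
  then have "(a - b) * c + b * (c - d) \<in> uea_ideal"
    by (intro uea_ideal.add uea_ideal.mult_left uea_ideal.mult_right)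
  then show "a * c - b * d \<in> uea_ideal" by (simp add: algebra_simps)
qed
lift_definition scaleC_uea :: "complex \<Rightarrow> 'a uea \<Rightarrow> 'a uea" is scaleC
proof (unfold uea_rel_def)
  fix c and a b :: "'a free_algebra"
  assume "a - b \<in> uea_ideal"
  from uea_ideal.scale[OF this, of c] show "c *\<^sub>C a - c *\<^sub>C b \<in> uea_ideal"
    by (simp add: cvec.scale_right_diff_distrib)
qed
instance
  by standard
    (transfer; simp add: algebra_simps uea_rel_def uea_ideal.zero
      scaleC_add_right scaleC_add_left scaleC_scaleC scaleC_one)+
end

lift_definition uea_gen :: "'g::complex_lie_algebra \<Rightarrow> 'g uea" is free_gen .


section \<open>Induced modules\<close>

text \<open>
  The tensor product of \<open>'g uea\<close> with a module \<open>M\<close> over a subalgebra \<open>p\<close>, balanced over the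
  enveloping algebra of \<open>p\<close>, is the free vector space on pairs modulo \<open>tensor_relations\<close>.
  As that algebra is generated by \<open>p\<close>, balancing is imposed for elements of \<open>p\<close> only.
\<close>

definition tensor_relations ::
    "'g::complex_lie_algebra set \<Rightarrow> ('g \<Rightarrow> 'm::complex_vector \<Rightarrow> 'm)
      \<Rightarrow> ('g uea \<times> 'm \<Rightarrow>\<^sub>0 complex) set"
  where "tensor_relations p act = (let s = (\<lambda>u m. Poly_Mapping.single (u, m) (1::complex)) in
      {s (u + u') m - s u m - s u' m |u u' m. True}
    \<union> {s u (m + m') - s u m - s u m' |u m m'. True}
    \<union> {s (c *\<^sub>C u) m - c *\<^sub>C s u m |c u m. True}
    \<union> {s u (c *\<^sub>C m) - c *\<^sub>C s u m |c u m. True}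
    \<union> {s (u * uea_gen x) m - s u (act x m) |u x m. x \<in> p})"

definition tensor_eval ::
    "('u \<Rightarrow> 'm \<Rightarrow> 'n::complex_vector) \<Rightarrow> ('u \<times> 'm \<Rightarrow>\<^sub>0 complex) \<Rightarrow> 'n"
  where "tensor_eval t F =
    (\<Sum>(u, m) \<in> Poly_Mapping.keys F. Poly_Mapping.lookup F (u, m) *\<^sub>C t u m)"

text \<open>
  The quotient depends on terms and is therefore not a type; \<open>induced_module\<close> says that the
  space \<open>'n\<close>, with \<open>t u m\<close> for the pure tensors, is a copy of it (the linear map
  \<open>tensor_eval t\<close> from the free space is onto with exactly the span of the relations as its
  kernel), on which \<open>'g\<close> acts by left multiplication on the first factor.
\<close>

definition induced_module ::
    "'g::complex_lie_algebra set \<Rightarrow> ('g \<Rightarrow> 'm::complex_vector \<Rightarrow> 'm)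
      \<Rightarrow> ('g \<Rightarrow> 'n::complex_vector \<Rightarrow> 'n) \<Rightarrow> ('g uea \<Rightarrow> 'm \<Rightarrow> 'n) \<Rightarrow> bool"
  where "induced_module p actM actN t \<longleftrightarrow>
    surj (tensor_eval t) \<and>
    (\<forall>F. tensor_eval t F = 0 \<longleftrightarrow> F \<in> cvec.span (tensor_relations p actM)) \<and>
    lie_module UNIV actN \<and>
    (\<forall>x u m. actN x (t u m) = t (uea_gen x * u) m)"


section \<open>Lie algebras given by generators and relations\<close>

datatype 'a lie_term =
    LGen 'a
  | LZero
  | LAdd "'a lie_term" "'a lie_term"
  | LScale complex "'a lie_term"
  | LBr "'a lie_term" "'a lie_term"

text \<open>
  Equality in the Lie algebra presented by the generators \<open>'a\<close> and the relations \<open>R\<close>.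
\<close>

inductive presented_eq :: "('a lie_term \<times> 'a lie_term) set \<Rightarrow> 'a lie_term \<Rightarrow> 'a lie_term \<Rightarrow> bool"
  for R where
  rel: "(s, t) \<in> R \<Longrightarrow> presented_eq R s t"
| refl: "presented_eq R s s"
| sym: "presented_eq R s t \<Longrightarrow> presented_eq R t s"
| trans: "presented_eq R s t \<Longrightarrow> presented_eq R t u \<Longrightarrow> presented_eq R s u"
| cong_add: "presented_eq R s s' \<Longrightarrow> presented_eq R t t' \<Longrightarrow> presented_eq R (LAdd s t) (LAdd s' t')"
| cong_scale: "presented_eq R s s' \<Longrightarrow> presented_eq R (LScale c s) (LScale c s')"
| cong_br: "presented_eq R s s' \<Longrightarrow> presented_eq R t t' \<Longrightarrow> presented_eq R (LBr s t) (LBr s' t')"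
| add_assoc: "presented_eq R (LAdd (LAdd s t) u) (LAdd s (LAdd t u))"
| add_comm: "presented_eq R (LAdd s t) (LAdd t s)"
| add_zero: "presented_eq R (LAdd LZero s) s"
| add_inverse: "presented_eq R (LAdd s (LScale (-1) s)) LZero"
| scale_add: "presented_eq R (LScale c (LAdd s t)) (LAdd (LScale c s) (LScale c t))"
| add_scale: "presented_eq R (LScale (c + d) s) (LAdd (LScale c s) (LScale d s))"
| scale_scale: "presented_eq R (LScale c (LScale d s)) (LScale (c * d) s)"
| scale_one: "presented_eq R (LScale 1 s) s"
| br_add_left: "presented_eq R (LBr (LAdd s t) u) (LAdd (LBr s u) (LBr t u))"
| br_add_right: "presented_eq R (LBr u (LAdd s t)) (LAdd (LBr u s) (LBr u t))"
| br_scale_left: "presented_eq R (LBr (LScale c s) t) (LScale c (LBr s t))"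
| br_scale_right: "presented_eq R (LBr s (LScale c t)) (LScale c (LBr s t))"
| br_self: "presented_eq R (LBr s s) LZero"
| br_jacobi: "presented_eq R (LAdd (LBr s (LBr t u)) (LAdd (LBr t (LBr u s)) (LBr u (LBr s t)))) LZero"

text \<open>Ideals of the presented algebra, represented by their preimages in the set of terms.\<close>

definition presented_ideal :: "('a lie_term \<times> 'a lie_term) set \<Rightarrow> 'a lie_term set \<Rightarrow> bool"
  where "presented_ideal R T \<longleftrightarrow>
    (\<forall>s t. presented_eq R s t \<and> s \<in> T \<longrightarrow> t \<in> T) \<and>
    LZero \<in> T \<and>
    (\<forall>s\<in>T. \<forall>t\<in>T. LAdd s t \<in> T) \<and>
    (\<forall>c. \<forall>t\<in>T. LScale c t \<in> T) \<and>
    (\<forall>s. \<forall>t\<in>T. LBr s t \<in> T)"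

primrec lie_eval :: "('a \<Rightarrow> 'g::complex_lie_algebra) \<Rightarrow> 'a lie_term \<Rightarrow> 'g" where
  "lie_eval g (LGen a) = g a"
| "lie_eval g LZero = 0"
| "lie_eval g (LAdd s t) = lie_eval g s + lie_eval g t"
| "lie_eval g (LScale c t) = c *\<^sub>C lie_eval g t"
| "lie_eval g (LBr s t) = lie (lie_eval g s) (lie_eval g t)"


section \<open>Kac--Moody algebras\<close>

text \<open>
  The index set of the simple roots is the finite type \<open>'i\<close>, the Cartan subalgebra is the
  space \<open>'h\<close>, embedded in the Lie algebra \<open>'g\<close> by \<open>cartan\<close>; \<open>simple_root K i\<close> is the simple root
  \<open>\<alpha>\<^sub>i\<close> and \<open>simple_coroot K i\<close> the simple coroot.
\<close>

record ('i, 'h, 'g) km_data =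
  gcm :: "'i \<Rightarrow> 'i \<Rightarrow> int"
  simple_root :: "'i \<Rightarrow> 'h \<Rightarrow> complex"
  simple_coroot :: "'i \<Rightarrow> 'h"
  cartan :: "'h \<Rightarrow> 'g"
  gen_e :: "'i \<Rightarrow> 'g"
  gen_f :: "'i \<Rightarrow> 'g"

definition generalized_cartan_matrix :: "('i \<Rightarrow> 'i \<Rightarrow> int) \<Rightarrow> bool"
  where "generalized_cartan_matrix A \<longleftrightarrow>
    (\<forall>i. A i i = 2) \<and>
    (\<forall>i j. i \<noteq> j \<longrightarrow> A i j \<le> 0) \<and>
    (\<forall>i j. A i j = 0 \<longrightarrow> A j i = 0)"

definition principal_rank :: "('i::finite \<Rightarrow> 'i \<Rightarrow> int) \<Rightarrow> 'i set \<Rightarrow> nat"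
  where "principal_rank A J =
    rank (\<chi> i j. if i \<in> J \<and> j \<in> J then of_int (A i j) else 0 :: complex^'i^'i)"

text \<open>
  The subspace \<open>H\<close>, the simple roots restricted to \<open>H\<close> and the simple coroots, all for
  indices in \<open>J\<close>, form a realization of the principal submatrix of \<open>A\<close> on \<open>J\<close>:
  \<open>dim H = 2 |J| - rank\<close>, roots and coroots are linearly independent, and the pairing of
  \<open>\<alpha>\<^sub>i\<close>-check with \<open>\<alpha>\<^sub>j\<close> is \<open>A i j\<close>.
\<close>

definition realization ::
    "('i::finite, 'h::complex_vector, 'g) km_data \<Rightarrow> 'i set \<Rightarrow> 'h set \<Rightarrow> bool"
  where "realization K J H \<longleftrightarrow>
    cvec.subspace H \<and> fin_dim H \<and>
    cvec.dim H + principal_rank (gcm K) J = 2 * card J \<and>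
    simple_coroot K ` J \<subseteq> H \<and> inj_on (simple_coroot K) J \<and> cvec.independent (simple_coroot K ` J) \<and>
    (\<forall>j\<in>J. clinear (simple_root K j)) \<and>
    (\<forall>c. (\<forall>x\<in>H. (\<Sum>j\<in>J. c j * simple_root K j x) = 0) \<longrightarrow> (\<forall>j\<in>J. c j = 0)) \<and>
    (\<forall>i\<in>J. \<forall>j\<in>J. simple_root K j (simple_coroot K i) = of_int (gcm K i j))"

datatype ('i, 'h) km_gen = GenE 'i | GenF 'i | GenH 'h

text \<open>The defining relations of the auxiliary Lie algebra (without Serre relations).\<close>

inductive_set km_relations ::
    "('i, 'h::complex_vector, 'g) km_data
      \<Rightarrow> (('i, 'h) km_gen lie_term \<times> ('i, 'h) km_gen lie_term) set"
  for K where
  H_add: "(LGen (GenH (x + y)), LAdd (LGen (GenH x)) (LGen (GenH y))) \<in> km_relations K"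
| H_scale: "(LGen (GenH (c *\<^sub>C x)), LScale c (LGen (GenH x))) \<in> km_relations K"
| HH: "(LBr (LGen (GenH x)) (LGen (GenH y)), LZero) \<in> km_relations K"
| EF: "(LBr (LGen (GenE i)) (LGen (GenF j)),
        if i = j then LGen (GenH (simple_coroot K i)) else LZero) \<in> km_relations K"
| HE: "(LBr (LGen (GenH x)) (LGen (GenE i)), LScale (simple_root K i x) (LGen (GenE i)))
        \<in> km_relations K"
| HF: "(LBr (LGen (GenH x)) (LGen (GenF i)), LScale (- simple_root K i x) (LGen (GenF i)))
        \<in> km_relations K"

text \<open>
  The largest ideal of the auxiliary algebra that intersects the Cartan subalgebra trivially,
  obtained as the union of all ideals that do so.
\<close>

definition km_radical ::
    "('i, 'h::complex_vector, 'g) km_data \<Rightarrow> ('i, 'h) km_gen lie_term set"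
  where "km_radical K = \<Union>{T. presented_ideal (km_relations K) T \<and>
    (\<forall>x. LGen (GenH x) \<in> T \<longrightarrow> x = 0)}"

primrec km_generator :: "('i, 'h, 'g) km_data \<Rightarrow> ('i, 'h) km_gen \<Rightarrow> 'g" where
  "km_generator K (GenE i) = gen_e K i"
| "km_generator K (GenF i) = gen_f K i"
| "km_generator K (GenH x) = cartan K x"

text \<open>
  \<open>'g\<close> is the quotient of the auxiliary algebra of a realization of a generalized Cartan
  matrix by \<open>km_radical\<close>: evaluation of terms is onto, with that ideal as its kernel.
\<close>

definition kac_moody_algebra ::
    "('i::finite, 'h::complex_vector, 'g::complex_lie_algebra) km_data \<Rightarrow> bool"
  where "kac_moody_algebra K \<longleftrightarrow>
    generalized_cartan_matrix (gcm K) \<and>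
    realization K UNIV UNIV \<and>
    surj (lie_eval (km_generator K)) \<and>
    (\<forall>t. lie_eval (km_generator K) t = 0 \<longleftrightarrow> t \<in> km_radical K)"

definition root_comb ::
    "('i::finite, 'h, 'g) km_data \<Rightarrow> ('i \<Rightarrow> int) \<Rightarrow> 'h \<Rightarrow> complex"
  where "root_comb K c = (\<lambda>x. \<Sum>i\<in>UNIV. of_int (c i) * simple_root K i x)"

definition root_space ::
    "('i, 'h, 'g::complex_lie_algebra) km_data \<Rightarrow> ('h \<Rightarrow> complex) \<Rightarrow> 'g set"
  where "root_space K \<beta> = {x. \<forall>h. lie (cartan K h) x = \<beta> h *\<^sub>C x}"

definition roots ::
    "('i, 'h, 'g::complex_lie_algebra) km_data \<Rightarrow> ('h \<Rightarrow> complex) set"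
  where "roots K = {\<beta>. \<beta> \<noteq> (\<lambda>_. 0) \<and> root_space K \<beta> \<noteq> {0}}"

definition pos_roots ::
    "('i::finite, 'h, 'g::complex_lie_algebra) km_data \<Rightarrow> ('h \<Rightarrow> complex) set"
  where "pos_roots K = roots K \<inter> {root_comb K c |c. \<forall>i. c i \<ge> 0}"

definition pos_roots_on ::
    "('i::finite, 'h, 'g::complex_lie_algebra) km_data \<Rightarrow> 'i set \<Rightarrow> ('h \<Rightarrow> complex) set"
  where "pos_roots_on K J = pos_roots K \<inter> {root_comb K c |c. \<forall>i. i \<notin> J \<longrightarrow> c i = 0}"

definition n_plus :: "('i, 'h, 'g::complex_lie_algebra) km_data \<Rightarrow> 'g set"
  where "n_plus K = lie_subalgebra hull (range (gen_e K))"

text \<open>In the next three definitions \<open>HJ\<close> is the Cartan subalgebra of the subalgebra for \<open>J\<close>.\<close>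

definition g_sub ::
    "('i, 'h, 'g::complex_lie_algebra) km_data \<Rightarrow> 'i set \<Rightarrow> 'h set \<Rightarrow> 'g set"
  where "g_sub K J HJ = lie_subalgebra hull (gen_e K ` J \<union> gen_f K ` J \<union> cartan K ` HJ)"

definition levi ::
    "('i, 'h, 'g::complex_lie_algebra) km_data \<Rightarrow> 'i set \<Rightarrow> 'h set \<Rightarrow> 'g set"
  where "levi K J HJ = {x + cartan K h |x h. x \<in> g_sub K J HJ}"

definition parabolic ::
    "('i, 'h, 'g::complex_lie_algebra) km_data \<Rightarrow> 'i set \<Rightarrow> 'h set \<Rightarrow> 'g set"
  where "parabolic K J HJ =
    {x + cartan K h + y |x h y. x \<in> g_sub K J HJ \<and> y \<in> n_plus K}"


section \<open>Weights\<close>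

definition weight_space ::
    "('i, 'h, 'g) km_data \<Rightarrow> ('g \<Rightarrow> 'v::complex_vector \<Rightarrow> 'v) \<Rightarrow> ('h \<Rightarrow> complex) \<Rightarrow> 'v set"
  where "weight_space K act \<mu> = {v. \<forall>h. act (cartan K h) v = \<mu> h *\<^sub>C v}"

definition wt ::
    "('i, 'h::complex_vector, 'g) km_data \<Rightarrow> ('g \<Rightarrow> 'v::complex_vector \<Rightarrow> 'v)
      \<Rightarrow> ('h \<Rightarrow> complex) set"
  where "wt K act = {\<mu>. clinear \<mu> \<and> weight_space K act \<mu> \<noteq> {0}}"

definition weight_module ::
    "('i, 'h::complex_vector, 'g) km_data \<Rightarrow> ('g \<Rightarrow> 'v::complex_vector \<Rightarrow> 'v) \<Rightarrow> bool"
  where "weight_module K act \<longleftrightarrow>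
    (\<forall>v. \<exists>!c. finite {\<mu>. c \<mu> \<noteq> 0} \<and>
      (\<forall>\<mu>. c \<mu> \<in> weight_space K act \<mu>) \<and> {\<mu>. c \<mu> \<noteq> 0} \<subseteq> wt K act \<and>
      v = (\<Sum>\<mu> | c \<mu> \<noteq> 0. c \<mu>))"

text \<open>
  Integrability presupposes a weight module. Local nilpotency is kept as a separate notion
  because a finite-dimensional module over the parabolic subalgebra need not be a weight module
  (the part of the Cartan subalgebra outside that of the Levi factor's derived algebra may act
  non-diagonalizably), and then the module induced from it is not one either.
\<close>

definition locally_nilpotent_on ::
    "('i, 'h, 'g) km_data \<Rightarrow> 'i set \<Rightarrow> ('g \<Rightarrow> 'v::complex_vector \<Rightarrow> 'v) \<Rightarrow> bool"
  where "locally_nilpotent_on K J act \<longleftrightarrow>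
    (\<forall>j\<in>J. locally_nilpotent (act (gen_e K j)) \<and> locally_nilpotent (act (gen_f K j)))"

definition km_integrable ::
    "('i, 'h::complex_vector, 'g) km_data \<Rightarrow> 'i set \<Rightarrow> ('g \<Rightarrow> 'v::complex_vector \<Rightarrow> 'v) \<Rightarrow> bool"
  where "km_integrable K J act \<longleftrightarrow> weight_module K act \<and> locally_nilpotent_on K J act"

definition root_prec ::
    "('i::finite, 'h, 'g) km_data \<Rightarrow> ('h \<Rightarrow> complex) \<Rightarrow> ('h \<Rightarrow> complex) \<Rightarrow> bool"
  where "root_prec K x y \<longleftrightarrow> (\<exists>c. (\<forall>i. c i \<ge> 0) \<and> y - x = root_comb K c)"

text \<open>The coefficients are unique because the simple roots are linearly independent.\<close>

definition ht :: "('i::finite, 'h, 'g) km_data \<Rightarrow> ('h \<Rightarrow> complex) \<Rightarrow> int"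
  where "ht K \<beta> = (\<Sum>i\<in>UNIV. (THE c. \<beta> = root_comb K c) i)"

definition simple_root_chains ::
    "('i::finite, 'h, 'g) km_data \<Rightarrow> ('h \<Rightarrow> complex) set \<Rightarrow> bool"
  where "simple_root_chains K X \<longleftrightarrow>
    (\<forall>\<mu>0\<in>X. \<forall>\<mu>\<in>X. root_prec K \<mu>0 \<mu> \<and> \<mu>0 \<noteq> \<mu> \<longrightarrow>
      (\<exists>\<nu> :: nat \<Rightarrow> 'h \<Rightarrow> complex. let n = nat (ht K (\<mu> - \<mu>0)) in
        \<nu> 0 = \<mu>0 \<and> \<nu> n = \<mu> \<and>
        (\<forall>i\<in>{1..n}. \<nu> i \<in> X \<and> \<nu> i - \<nu> (i - 1) \<in> range (simple_root K))))"

text \<open>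
  How a module over the subalgebra for \<open>J\<close> is regarded as a module over the parabolic
  subalgebra: together with a compatible action of the Cartan subalgebra it is a module over
  \<open>levi\<close>, and the root spaces of positive roots outside \<open>J\<close> act by zero. (That this is a
  \<open>lie_module\<close> over \<open>parabolic\<close> is then a consequence.)
\<close>

definition inflated_module ::
    "('i::finite, 'h, 'g::complex_lie_algebra) km_data \<Rightarrow> 'i set \<Rightarrow> 'h set
      \<Rightarrow> ('g \<Rightarrow> 'm::complex_vector \<Rightarrow> 'm) \<Rightarrow> bool"
  where "inflated_module K J HJ act \<longleftrightarrow>
    lie_module (levi K J HJ) act \<and>
    linear_action (parabolic K J HJ) act \<and>
    (\<forall>\<beta> \<in> pos_roots K - pos_roots_on K J. \<forall>x\<in>root_space K \<beta>. \<forall>m. act x m = 0)"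

end

theory Submission
  imports Defs
begin

text \<open>
  For semisimple \<open>\<gg>\<^sub>J\<close> the matrix \<open>A\<^sub>J\<close> is of finite type, so a nonzero \<open>\<mu> - \<mu>\<^sub>0 \<in> \<int>\<^sub>\<ge>\<^sub>0\<Pi>\<^sub>J\<close> is positive on
  the coroot of some \<open>\<alpha>\<^sub>j\<close> in its support. In a \<open>\<gg>\<^sub>J\<close>-integrable module \<open>\<mu>\<close> and \<open>\<mu>\<^sub>0\<close> have integral values there,
  hence \<open>\<mu>\<close> has a positive or \<open>\<mu>\<^sub>0\<close> a negative value, and \<open>sl\<^sub>2\<close>-theory makes \<open>\<mu> - \<alpha>\<^sub>j\<close> or
  \<open>\<mu>\<^sub>0 + \<alpha>\<^sub>j\<close> a weight; the chain follows by induction on the height.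

  For an induced module and \<open>i \<notin> J\<close>, the set of weights is even closed under subtracting \<open>\<alpha>\<^sub>i\<close>, as \<open>f\<^sub>i\<close>
  acts injectively. The Poincare--Birkhoff--Witt theorem is not needed for this: if \<open>\<gg> = a \<oplus> p\<close>
  with subalgebras \<open>a\<close> and \<open>p\<close>, then \<open>\<gg>\<close> acts on \<open>U(a) \<otimes> M\<close> by
  \<open>x (y u \<otimes> m) = y (x (u \<otimes> m)) + [x, y] (u \<otimes> m)\<close> for \<open>y \<in> a\<close>, which identifies it with the induced
  module. On \<open>U(a)\<close> a linear functional \<open>\<phi>\<close> of \<open>a\<close> vanishing on \<open>[a, a]\<close> extends to a locally
  nilpotent derivation whose commutator with multiplication by \<open>f\<^sub>i\<close> is the scalar \<open>\<phi> f\<^sub>i\<close>.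
\<close>

section \<open>Linear algebra over the complex numbers\<close>

text \<open>Weight spaces may be infinite-dimensional, so no characters or dimensions are compared.
  The recurring tool is that \<open>f ^^ m\<close> is injective on vectors of weight m on which
  \<open>e\<close> is nilpotent: it gives the single steps of a chain, the reflection of a root, and
  the fact that proper multiples of a simple root are not roots. Finite type of A_J is read off from
  the root system: the sum of the positive roots of the finite-dimensional algebra pairs to 2 with
  every simple coroot of J. Local nilpotency of ad e_i rests on the Serre relations, which express
  the maximality of the ideal divided out in the Kac--Moody algebra; on N nilpotency spreads from 1
  \<otimes> M by the Leibniz rule. In the induced case p is the part of \<gg> of non-negative degree
  in the simple roots outside J, and a is the part of negative degree. For i outside J the generator
  f_i has degree -1, while [a, a] has degree at most -2; this separation is the source of \<phi>.
  The derivation D attached to \<phi> shortens words, hence is locally nilpotent, and D f_i - f_i D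
  = \<phi>(f_i), as in a Heisenberg algebra, rules out a kernel of f_i.\<close>

lemma clinear_iff:
  "clinear f \<longleftrightarrow> (\<forall>x y. f (x + y) = f x + f y) \<and> (\<forall>c x. f (c *\<^sub>C x) = c *\<^sub>C f x)"
  by (auto simp: Vector_Spaces.linear_def module_hom_def module_hom_axioms_def
      cvec.vector_space_axioms cvec.module_axioms)

lemma
  assumes "clinear f"
  shows clinear_add: "f (x + y) = f x + f y"
    and clinear_scale: "f (c *\<^sub>C x) = c *\<^sub>C f x"
    and clinear_0: "f 0 = 0"
    and clinear_minus: "f (- x) = - f x"
    and clinear_diff: "f (x - y) = f x - f y"
    and clinear_sum: "f (sum g A) = (\<Sum>a\<in>A. f (g a))"
proof -
  show add: "f (x + y) = f x + f y" for x y using assms by (simp add: clinear_iff)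
  show "f (c *\<^sub>C x) = c *\<^sub>C f x" for c x using assms by (simp add: clinear_iff)
  show zero: "f 0 = 0" using add[of 0 0] by simp
  show minus: "f (- x) = - f x" for x using add[of x "- x"] zero by (metis neg_eq_iff_add_eq_0 right_minus)
  show "f (x - y) = f x - f y" using add[of x "- y"] minus[of y] by simp
  show "f (sum g A) = (\<Sum>a\<in>A. f (g a))"
    by (induction A rule: infinite_finite_induct) (simp_all add: zero add)
qed

lemma clinear_funpow: "clinear f \<Longrightarrow> clinear (f ^^ n)" for f :: "'v::complex_vector \<Rightarrow> 'v"
  unfolding clinear_iff by (induction n) simp_all

lemma clinear_single: "clinear (Poly_Mapping.single k :: 'v::complex_vector \<Rightarrow> _)"
  unfolding clinear_iff
  by (auto simp: single_add) (transfer, auto simp: fun_eq_iff when_def)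

lemma lookup_scaleC: "Poly_Mapping.lookup (c *\<^sub>C F) k = c *\<^sub>C Poly_Mapping.lookup F k"
  by transfer simp

lemma clinear_span_subset:
  assumes "clinear f" "cvec.subspace W" "\<And>x. x \<in> S \<Longrightarrow> f x \<in> W" "x \<in> cvec.span S"
  shows "f x \<in> W"
  using assms(4)
proof (induction rule: cvec.span_induct_alt)
  case base
  then show ?case using assms(1,2) by (simp add: clinear_0 cvec.subspace_0)
next
  case (step c x y)
  then show ?case
    using assms by (simp add: clinear_add clinear_scale cvec.subspace_add cvec.subspace_scale)
qed

section \<open>Joint eigenspaces of families of operators\<close>

definition joint_eigenspace ::
    "('a \<Rightarrow> 'v::complex_vector \<Rightarrow> 'v) \<Rightarrow> ('a \<Rightarrow> complex) \<Rightarrow> 'v set"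
  where "joint_eigenspace T \<mu> = {v. \<forall>a. T a v = \<mu> a *\<^sub>C v}"

lemma subspace_joint_eigenspace:
  assumes "\<And>a. clinear (T a)"
  shows "cvec.subspace (joint_eigenspace T \<mu>)"
  using assms
  by (auto simp: cvec.subspace_def joint_eigenspace_def clinear_0 clinear_add clinear_scale
      scaleC_add_right scaleC_scaleC mult.commute)

text \<open>The operator \<open>T a - \<nu> a\<close> kills the \<nu>-component and rescales each
  other one by \<open>\<mu> a - \<nu> a\<close>. For a given \<mu> some index \<open>a\<close> makes
  this factor non-zero, so the induction hypothesis for the rescaled family kills that
  component.\<close>

lemma joint_eigenspace_sum_eq_0:
  assumes T: "\<And>a. clinear (T a)" and "finite S"
    and "\<And>\<mu>. \<mu> \<in> S \<Longrightarrow> c \<mu> \<in> joint_eigenspace T \<mu>"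
    and "(\<Sum>\<mu>\<in>S. c \<mu>) = 0"
  shows "\<forall>\<mu>\<in>S. c \<mu> = 0"
  using assms(2-4)
proof (induction S arbitrary: c rule: finite_induct)
  case empty
  then show ?case by simp
next
  case (insert \<nu> S)
  have van: "c \<mu> = 0" if \<mu>: "\<mu> \<in> S" for \<mu>
  proof -
    from \<mu> insert(2) have "\<mu> \<noteq> \<nu>" by auto
    then obtain a where a: "\<mu> a \<noteq> \<nu> a" by auto
    define c' where "c' \<mu> = (\<mu> a - \<nu> a) *\<^sub>C c \<mu>" for \<mu>
    have "(\<Sum>\<mu>\<in>insert \<nu> S. c' \<mu>) = T a (\<Sum>\<mu>\<in>insert \<nu> S. c \<mu>) - \<nu> a *\<^sub>C (\<Sum>\<mu>\<in>insert \<nu> S. c \<mu>)"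
      unfolding clinear_sum[OF T] c'_def cvec.scale_sum_right sum_subtractf[symmetric]
      by (rule sum.cong[OF HOL.refl])
        (use insert.prems(1) in \<open>auto simp: joint_eigenspace_def cvec.scale_left_diff_distrib\<close>)
    also have "\<dots> = 0" unfolding insert.prems(2) by (simp add: clinear_0[OF T])
    finally have "(\<Sum>\<mu>\<in>S. c' \<mu>) = 0" using insert(1,2) by (simp add: c'_def)
    moreover have "c' \<mu> \<in> joint_eigenspace T \<mu>" if "\<mu> \<in> S" for \<mu>
      unfolding c'_def
      by (rule cvec.subspace_scale[OF subspace_joint_eigenspace[of T, OF T]])
        (use insert.prems(1) that in auto)
    ultimately have "\<forall>\<mu>\<in>S. c' \<mu> = 0" by (intro insert.IH)
    with \<mu> a show ?thesis by (auto simp: c'_def)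
  qed
  moreover have "c \<nu> = 0" using insert.prems(2) insert(1,2) van by simp
  ultimately show ?case by auto
qed

text \<open>Phrased as a span so that membership can be propagated by linearity;
  \<open>eigensum_decomp\<close> recovers the components.\<close>

definition eigensum ::
    "('a \<Rightarrow> 'v::complex_vector \<Rightarrow> 'v) \<Rightarrow> ('a \<Rightarrow> complex) set \<Rightarrow> 'v set"
  where "eigensum T S = cvec.span (\<Union>\<mu>\<in>S. joint_eigenspace T \<mu>)"

lemma eigensum_decomp:
  assumes T: "\<And>a. clinear (T a)" and "v \<in> eigensum T S"
  obtains c where "finite {\<mu>. c \<mu> \<noteq> 0}" "\<And>\<mu>. c \<mu> \<in> joint_eigenspace T \<mu>"
    "{\<mu>. c \<mu> \<noteq> 0} \<subseteq> S" "v = (\<Sum>\<mu> | c \<mu> \<noteq> 0. c \<mu>)"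
proof -
  note sub = subspace_joint_eigenspace[of T, OF T]
  have "\<exists>c. finite {\<mu>. c \<mu> \<noteq> 0} \<and> (\<forall>\<mu>. c \<mu> \<in> joint_eigenspace T \<mu>) \<and>
      {\<mu>. c \<mu> \<noteq> 0} \<subseteq> S \<and> v = (\<Sum>\<mu> | c \<mu> \<noteq> 0. c \<mu>)"
    using assms(2) unfolding eigensum_def
  proof (induction rule: cvec.span_induct_alt)
    case base
    show ?case by (rule exI[of _ "\<lambda>_. 0"]) (simp add: cvec.subspace_0[OF sub])
  next
    case (step k x y)
    then obtain \<nu> c where \<nu>: "\<nu> \<in> S" "x \<in> joint_eigenspace T \<nu>"
      and c: "finite {\<mu>. c \<mu> \<noteq> 0}" "\<And>\<mu>. c \<mu> \<in> joint_eigenspace T \<mu>" "{\<mu>. c \<mu> \<noteq> 0} \<subseteq> S"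
        "y = (\<Sum>\<mu> | c \<mu> \<noteq> 0. c \<mu>)" by auto
    define c' where "c' = c(\<nu> := k *\<^sub>C x + c \<nu>)"
    have sup: "{\<mu>. c' \<mu> \<noteq> 0} \<subseteq> insert \<nu> {\<mu>. c \<mu> \<noteq> 0}" by (auto simp: c'_def)
    have "(\<Sum>\<mu> | c' \<mu> \<noteq> 0. c' \<mu>) = (\<Sum>\<mu>\<in>insert \<nu> {\<mu>. c \<mu> \<noteq> 0}. c' \<mu>)"
      by (rule sum.mono_neutral_left) (use c sup in auto)
    also have "\<dots> = c' \<nu> + (\<Sum>\<mu>\<in>{\<mu>. c \<mu> \<noteq> 0} - {\<nu>}. c' \<mu>)"
      using c by (simp add: sum.insert_remove)
    also have "(\<Sum>\<mu>\<in>{\<mu>. c \<mu> \<noteq> 0} - {\<nu>}. c' \<mu>) = (\<Sum>\<mu>\<in>{\<mu>. c \<mu> \<noteq> 0} - {\<nu>}. c \<mu>)"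
      by (rule sum.cong) (auto simp: c'_def)
    also have "c' \<nu> + \<dots> = k *\<^sub>C x + (c \<nu> + (\<Sum>\<mu>\<in>{\<mu>. c \<mu> \<noteq> 0} - {\<nu>}. c \<mu>))"
      by (simp add: c'_def add.assoc)
    also have "c \<nu> + (\<Sum>\<mu>\<in>{\<mu>. c \<mu> \<noteq> 0} - {\<nu>}. c \<mu>) = y"
      unfolding c(4) using c(1) by (cases "c \<nu> = 0") (simp_all add: sum.remove)
    finally have "k *\<^sub>C x + y = (\<Sum>\<mu> | c' \<mu> \<noteq> 0. c' \<mu>)" by simp
    moreover have "finite {\<mu>. c' \<mu> \<noteq> 0}" using sup c(1) by (rule finite_subset[OF _ finite.insertI])
    moreover have "c' \<mu> \<in> joint_eigenspace T \<mu>" for \<mu>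
      using \<nu> c(2) by (simp add: c'_def cvec.subspace_add[OF sub] cvec.subspace_scale[OF sub])
    moreover have "{\<mu>. c' \<mu> \<noteq> 0} \<subseteq> S" using sup c(3) \<nu>(1) by auto
    ultimately show ?case by blast
  qed
  with that show thesis by blast
qed

lemma eigensum_disjoint:
  assumes T: "\<And>a. clinear (T a)" and "v \<in> eigensum T S" "v \<in> eigensum T S'" "S \<inter> S' = {}"
  shows "v = 0"
proof -
  note sub = subspace_joint_eigenspace[of T, OF T]
  from eigensum_decomp[of T, OF T assms(2)] obtain c where
    c: "finite {\<mu>. c \<mu> \<noteq> 0}" "\<And>\<mu>. c \<mu> \<in> joint_eigenspace T \<mu>" "{\<mu>. c \<mu> \<noteq> 0} \<subseteq> S"
       "v = (\<Sum>\<mu> | c \<mu> \<noteq> 0. c \<mu>)" by blast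
  from eigensum_decomp[of T, OF T assms(3)] obtain d where
    d: "finite {\<mu>. d \<mu> \<noteq> 0}" "\<And>\<mu>. d \<mu> \<in> joint_eigenspace T \<mu>" "{\<mu>. d \<mu> \<noteq> 0} \<subseteq> S'"
       "v = (\<Sum>\<mu> | d \<mu> \<noteq> 0. d \<mu>)" by blast
  let ?U = "{\<mu>. c \<mu> \<noteq> 0} \<union> {\<mu>. d \<mu> \<noteq> 0}"
  have "v = (\<Sum>\<mu>\<in>?U. c \<mu>)" "v = (\<Sum>\<mu>\<in>?U. d \<mu>)"
    unfolding c(4) by (rule sum.mono_neutral_left; use c d in auto)
      (subst c(4)[symmetric], subst d(4), rule sum.mono_neutral_left; use c d in auto)
  then have "(\<Sum>\<mu>\<in>?U. c \<mu> - d \<mu>) = 0" by (simp add: sum_subtractf)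
  then have "\<forall>\<mu>\<in>?U. c \<mu> - d \<mu> = 0"
    by (intro joint_eigenspace_sum_eq_0[of T, OF T])
      (simp add: c(1) d(1), rule cvec.subspace_diff[OF sub c(2) d(2)])
  then have "c \<mu> - d \<mu> = 0" if "c \<mu> \<noteq> 0" for \<mu> using that by blast
  then have "c \<mu> = 0" for \<mu> using c(3) d(3) assms(4) by (metis (mono_tags, lifting) diff_zero disjoint_iff mem_Collect_eq subset_iff)
  then show ?thesis unfolding c(4) by simp
qed

lemma independent_eigenvectors:
  assumes T: "\<And>a. clinear (T a)"
    and x: "\<And>\<mu>. \<mu> \<in> S \<Longrightarrow> x \<mu> \<in> joint_eigenspace T \<mu>" "\<And>\<mu>. \<mu> \<in> S \<Longrightarrow> x \<mu> \<noteq> 0"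
  shows "inj_on x S" "cvec.independent (x ` S)"
proof -
  show inj: "inj_on x S"
  proof (rule inj_onI)
    fix \<mu> \<nu> assume *: "\<mu> \<in> S" "\<nu> \<in> S" "x \<mu> = x \<nu>"
    then have "(\<mu> a - \<nu> a) *\<^sub>C x \<mu> = 0" for a
      using x(1)[of \<mu>] x(1)[of \<nu>] by (auto simp: joint_eigenspace_def cvec.scale_left_diff_distrib)
    then have "\<mu> a - \<nu> a = 0" for a using x(2)[OF *(1)] by (metis cvec.scale_eq_0_iff)
    then show "\<mu> = \<nu>" by auto
  qed
  show "cvec.independent (x ` S)"
    unfolding cvec.independent_explicit_module
  proof (intro allI impI)
    fix t u v assume t: "finite t" "t \<subseteq> x ` S" "(\<Sum>v\<in>t. u v *\<^sub>C v) = 0" "v \<in> t"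
    define R where "R = {\<mu>\<in>S. x \<mu> \<in> t}"
    have tR: "t = x ` R" and injR: "inj_on x R"
      using t(2) inj by (auto simp: R_def intro: inj_on_subset)
    have finR: "finite R" using t(1) tR injR finite_imageD by blast
    have "(\<Sum>\<mu>\<in>R. u (x \<mu>) *\<^sub>C x \<mu>) = 0"
      using t(3) unfolding tR by (simp add: sum.reindex[OF injR])
    then have "\<forall>\<mu>\<in>R. u (x \<mu>) *\<^sub>C x \<mu> = 0"
      by (intro joint_eigenspace_sum_eq_0[of T] T finR)
        (auto simp: R_def intro!: x(1) cvec.subspace_scale[OF subspace_joint_eigenspace[of T, OF T]])
    with t(4) x(2) show "u v = 0" unfolding tR by (auto simp: R_def)
  qed
qed

lemma finite_eigenvalues:
  assumes T: "\<And>a. clinear (T a)" and "fin_dim L"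
    and x: "\<And>\<mu>. \<mu> \<in> S \<Longrightarrow> x \<mu> \<in> joint_eigenspace T \<mu> \<inter> L" "\<And>\<mu>. \<mu> \<in> S \<Longrightarrow> x \<mu> \<noteq> 0"
  shows "finite S"
proof -
  from assms(2) obtain B where B: "finite B" "L = cvec.span B" by (auto simp: fin_dim_def)
  have "inj_on x S" "cvec.independent (x ` S)"
    by (rule independent_eigenvectors[of T]; use T x in auto)+
  moreover have "x ` S \<subseteq> cvec.span B" using x(1) B(2) by auto
  ultimately show ?thesis using cvec.independent_span_bound[OF B(1)] finite_imageD by blast
qed

text \<open>The operators \<open>e ^^ k\<close> are eigenvectors of \<open>ad h\<close> with distinct eigenvalues.\<close>

lemma funpow_relation_trivial:
  fixes e h :: "'v::complex_vector \<Rightarrow> 'v"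
  assumes lin: "clinear e" "clinear h" and a: "a \<noteq> 0"
    and he: "\<And>v. h (e v) = e (h v) + a *\<^sub>C e v" and "finite S"
    and "\<And>v. (\<Sum>k\<in>S. c k *\<^sub>C (e ^^ k) v) = 0" and "k \<in> S"
  shows "c k *\<^sub>C (e ^^ k) v = 0"
  using assms(5-7)
proof (induction S arbitrary: c k v rule: finite_induct)
  case empty
  then show ?case by simp
next
  case (insert l S)
  have hek: "h ((e ^^ k) v) = (e ^^ k) (h v) + (of_nat k * a) *\<^sub>C (e ^^ k) v" for k v
    by (induction k) (simp_all add: he lin clinear_add clinear_scale scaleC_add_left
        distrib_right scaleC_add_right add.commute add.left_commute)
  have van: "c k *\<^sub>C (e ^^ k) v = 0" if k: "k \<in> S" for k v
  proof -
    define c' where "c' k = ((of_nat k - of_nat l) * a) * c k" for k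
    have "(\<Sum>k\<in>S. c' k *\<^sub>C (e ^^ k) v) = 0" for v
    proof -
      have "(\<Sum>k\<in>insert l S. c' k *\<^sub>C (e ^^ k) v) =
        h (\<Sum>k\<in>insert l S. c k *\<^sub>C (e ^^ k) v) - (\<Sum>k\<in>insert l S. c k *\<^sub>C (e ^^ k) (h v))
          - (of_nat l * a) *\<^sub>C (\<Sum>k\<in>insert l S. c k *\<^sub>C (e ^^ k) v)"
        unfolding clinear_sum[OF lin(2)] cvec.scale_sum_right sum_subtractf[symmetric]
        by (rule sum.cong[OF HOL.refl])
          (simp add: hek lin clinear_scale c'_def cvec.scale_left_diff_distrib scaleC_add_right
            algebra_simps)
      also have "\<dots> = 0" unfolding insert.prems(1) by (simp add: clinear_0[OF lin(2)])
      finally show ?thesis using insert(1,2) by (simp add: c'_def)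
    qed
    from insert.IH[OF this k] have "c' k *\<^sub>C (e ^^ k) v = 0" .
    moreover have "k \<noteq> l" using k insert(2) by auto
    ultimately show ?thesis using a by (auto simp: c'_def)
  qed
  moreover have "c l *\<^sub>C (e ^^ l) v = 0" using insert.prems(1)[of v] insert(1,2) van by simp
  ultimately show ?case using insert.prems(2) by auto
qed

text \<open>Linear dependence is a property of sets and does not see repetitions. A repeated value
  is therefore treated apart, with the relation x k - x l = 0.\<close>

lemma fin_dim_relation:
  fixes x :: "nat \<Rightarrow> 'v::complex_vector"
  assumes "finite B" "\<And>k. x k \<in> cvec.span B"
  obtains c S k where "finite S" "(\<Sum>k\<in>S. c k *\<^sub>C x k) = 0" "k \<in> S" "c k \<noteq> 0"
proof (cases "inj x")
  case False
  then obtain k l where "k \<noteq> l" "x k = x l" by (auto simp: inj_on_def)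
  then show thesis
    by (intro that[of "{k, l}" "\<lambda>i. if i = k then 1 else - 1" k]) (auto simp: scaleC_one)
next
  case True
  have "\<not> cvec.independent (range x)"
  proof
    assume "cvec.independent (range x)"
    from cvec.independent_span_bound[OF assms(1) this] assms(2) have "finite (range x)" by auto
    with True show False by (simp add: finite_image_iff)
  qed
  then obtain t u v where t: "finite t" "t \<subseteq> range x" "(\<Sum>v\<in>t. u v *\<^sub>C v) = 0" "v \<in> t" "u v \<noteq> 0"
    unfolding cvec.dependent_explicit by auto
  define S where "S = x -` t"
  have inj: "inj_on x S" using True by (rule inj_on_subset) simp
  have tS: "t = x ` S" using t(2) by (auto simp: S_def)
  have "finite S" using t(1) tS inj finite_imageD by blast
  moreover have "(\<Sum>k\<in>S. u (x k) *\<^sub>C x k) = 0"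
    using t(3) unfolding tS by (simp add: sum.reindex[OF inj])
  moreover obtain k where "k \<in> S" "v = x k" using t(4) tS by auto
  ultimately show thesis using t(5) by (intro that[of S "\<lambda>k. u (x k)" k]) auto
qed

text \<open>
  The space of endomorphisms is embedded into \<open>'v \<Rightarrow>\<^sub>0 'v\<close> by restricting them to a finite
  spanning set.
\<close>

lemma locally_nilpotent_fin_dim:
  fixes e h :: "'v::complex_vector \<Rightarrow> 'v"
  assumes "fin_dim (UNIV :: 'v set)" and lin: "clinear e" "clinear h" and a: "a \<noteq> 0"
    and he: "\<And>v. h (e v) = e (h v) + a *\<^sub>C e v"
  shows "locally_nilpotent e"
proof -
  from assms(1) obtain B where B: "finite B" "cvec.span B = (UNIV :: 'v set)"
    by (auto simp: fin_dim_def)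
  define x where "x k = (\<Sum>b\<in>B. Poly_Mapping.single b ((e ^^ k) b))" for k
  define B' where "B' = (\<lambda>(b, b'). Poly_Mapping.single b b' :: 'v \<Rightarrow>\<^sub>0 'v) ` (B \<times> B)"
  have "x k \<in> cvec.span B'" for k
    unfolding x_def
  proof (rule cvec.span_sum)
    fix b assume "b \<in> B"
    show "Poly_Mapping.single b ((e ^^ k) b) \<in> cvec.span B'"
      by (rule clinear_span_subset[OF clinear_single cvec.subspace_span, of B])
        (use \<open>b \<in> B\<close> B(2) in \<open>auto simp: B'_def intro!: cvec.span_base\<close>)
  qed
  moreover have "finite B'" using B(1) by (simp add: B'_def)
  ultimately obtain c S k where c: "finite S" "(\<Sum>k\<in>S. c k *\<^sub>C x k) = 0" "k \<in> S" "c k \<noteq> 0"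
    using fin_dim_relation[of B' x] by metis
  define T where "T v = (\<Sum>k\<in>S. c k *\<^sub>C (e ^^ k) v)" for v
  have "clinear T" unfolding T_def clinear_iff
    by (auto simp: clinear_add[OF clinear_funpow[OF lin(1)]] clinear_scale[OF clinear_funpow[OF lin(1)]]
        sum.distrib scaleC_add_right cvec.scale_sum_right scaleC_scaleC mult.commute)
  \<comment> \<open>The coefficient at \<open>b\<close> of the relation among the \<open>x k\<close>
    is the relation among the powers of \<open>e\<close>, applied to \<open>b\<close>.\<close>
  have Tb: "T b = 0" if "b \<in> B" for b
  proof -
    have "0 = Poly_Mapping.lookup (\<Sum>k\<in>S. c k *\<^sub>C x k) b" using c(2) by simp
    also have "\<dots> = T b" using that B(1)
      by (simp add: lookup_sum lookup_scaleC x_def T_def lookup_single when_def if_distrib[of "\<lambda>v. _ *\<^sub>C v"] cong: if_cong)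
    finally show ?thesis by simp
  qed
  have "T v = 0" for v
    using clinear_span_subset[OF \<open>clinear T\<close>, of "{0}" B v] Tb B(2)
    by (auto simp: cvec.subspace_def)
  then have "c k *\<^sub>C (e ^^ k) v = 0" for v
    unfolding T_def by (intro funpow_relation_trivial[OF lin a he c(1) _ c(3)])
  with c(4) show ?thesis unfolding locally_nilpotent_def by auto
qed

section \<open>Representations of \<open>sl\<^sub>2\<close>\<close>

locale sl2_action =
  fixes e f h :: "'v::complex_vector \<Rightarrow> 'v"
  assumes lin: "clinear e" "clinear f" "clinear h"
    and he: "h (e v) = e (h v) + 2 *\<^sub>C e v"
    and hf: "h (f v) = f (h v) - 2 *\<^sub>C f v"
    and ef: "e (f v) = f (e v) + h v"
begin

text \<open>The Chevalley involution of sl_2: facts about \<open>e\<close> transfer to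
  \<open>f\<close> with weights negated.\<close>

lemma swap: "sl2_action f e (\<lambda>v. - h v)"
proof -
  have "clinear (\<lambda>v. - h v)"
    unfolding clinear_iff by (simp add: clinear_add[OF lin(3)] clinear_scale[OF lin(3)])
  then show ?thesis
    by (intro sl2_action.intro) (simp_all add: lin he hf ef clinear_minus[OF lin(1)] clinear_minus[OF lin(2)])
qed

lemma h_e_funpow: "h v = m *\<^sub>C v \<Longrightarrow> h ((e ^^ n) v) = (m + 2 * of_nat n) *\<^sub>C (e ^^ n) v"
proof (induction n)
  case (Suc n)
  have "h ((e ^^ Suc n) v) = (m + 2 * of_nat n + 2) *\<^sub>C (e ^^ Suc n) v"
    using Suc by (simp add: he clinear_scale[OF lin(1)] clinear_add[OF lin(1)] scaleC_add_left)
  also have "m + 2 * of_nat n + 2 = m + 2 * of_nat (Suc n)" by simp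
  finally show ?case .
qed simp

lemma h_f_funpow:
  assumes "h v = m *\<^sub>C v"
  shows "h ((f ^^ n) v) = (m - 2 * of_nat n) *\<^sub>C (f ^^ n) v"
proof -
  interpret s: sl2_action f e "\<lambda>v. - h v" by (rule swap)
  have "- h ((f ^^ n) v) = (- m + 2 * of_nat n) *\<^sub>C (f ^^ n) v"
    by (rule s.h_e_funpow) (simp add: assms)
  also have "- m + 2 * of_nat n = - (m - 2 * of_nat n)" by simp
  finally show ?thesis by (metis cvec.scale_minus_left neg_equal_iff_equal)
qed

text \<open>This is the rule [e, f^(n+1)] = (n+1) f^n (h - n) in U(sl_2), evaluated at a weight
  vector.\<close>

lemma e_f_funpow:
  assumes "h v = m *\<^sub>C v"
  shows "e ((f ^^ Suc n) v) = (f ^^ Suc n) (e v) + (of_nat (Suc n) * (m - of_nat n)) *\<^sub>C (f ^^ n) v"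
proof (induction n)
  case 0
  then show ?case using assms by (simp add: ef)
next
  case (Suc n)
  have "e ((f ^^ Suc (Suc n)) v) = f (e ((f ^^ Suc n) v)) + h ((f ^^ Suc n) v)"
    by (simp add: ef)
  also have "\<dots> = (f ^^ Suc (Suc n)) (e v) +
      (of_nat (Suc n) * (m - of_nat n) + (m - 2 * of_nat (Suc n))) *\<^sub>C (f ^^ Suc n) v"
    unfolding Suc h_f_funpow[OF assms]
    by (simp add: clinear_add[OF lin(2)] clinear_scale[OF lin(2)] scaleC_add_left add.assoc)
  also have "of_nat (Suc n) * (m - of_nat n) + (m - 2 * of_nat (Suc n)) =
      of_nat (Suc (Suc n)) * (m - of_nat (Suc n))" by (simp add: algebra_simps)
  finally show ?case .
qed

text \<open>For n < m the factor (n+1)(m-n) in \<open>e_f_funpow\<close> is non-zero, so each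
  application of \<open>e\<close> cancels one power of \<open>f\<close>.\<close>

lemma highest_weight_funpow_eq_0:
  assumes "h v = of_nat m *\<^sub>C v" "e v = 0" "n \<le> m" "(f ^^ n) v = 0"
  shows "v = 0"
  using assms(3,4)
proof (induction n)
  case (Suc n)
  have "0 = (of_nat (Suc n) * (of_nat m - of_nat n)) *\<^sub>C (f ^^ n) v"
    using e_f_funpow[OF assms(1), of n] Suc(3)
    by (simp add: assms(2) clinear_0 lin clinear_funpow)
  moreover have "of_nat (Suc n) * (of_nat m - of_nat n) \<noteq> (0::complex)"
    using Suc(2) by (metis Suc_le_lessD mult_eq_0_iff of_nat_eq_0_iff of_nat_eq_iff
        old.nat.distinct(2) order_less_irrefl right_minus_eq)
  ultimately show ?case using Suc by auto
qed simp

text \<open>Induction on the nilpotency order k of \<open>e\<close> at v. The vector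
  \<open>e v\<close> has weight m+2, and the commutation rule shows that \<open>f ^^ (m + 2)\<close>
  kills it, because \<open>f ^^ (m + 1)\<close> and \<open>f ^^ (m + 2)\<close> kill v. Hence
  \<open>e v = 0\<close>, and v is a highest weight vector.\<close>

lemma f_funpow_eq_0:
  assumes "h v = of_nat m *\<^sub>C v" "(e ^^ k) v = 0" "(f ^^ m) v = 0"
  shows "v = 0"
  using assms
proof (induction k arbitrary: v m)
  case (Suc k)
  have fm: "(f ^^ (m + i)) v = 0" for i
    using Suc.prems(3) by (induction i) (simp_all add: clinear_0 lin)
  have "h (e v) = of_nat (m + 2) *\<^sub>C e v"
    using h_e_funpow[OF Suc.prems(1), of 1] by simp
  moreover have "(e ^^ k) (e v) = 0" using Suc.prems(2) by (simp add: funpow_swap1)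
  moreover have "(f ^^ (m + 2)) (e v) = 0"
    using e_f_funpow[OF Suc.prems(1), of "Suc m"] fm[of 1] fm[of 2] by (simp add: clinear_0 lin)
  ultimately have "e v = 0" by (rule Suc.IH)
  then show ?case by (rule highest_weight_funpow_eq_0[OF Suc.prems(1) _ order_refl Suc.prems(3)])
qed simp

text \<open>Take the last non-zero vector \<open>(e ^^ n) v\<close>, of weight m + 2n, and then the
  last non-zero \<open>(f ^^ k)\<close> of it. The commutation rule forces m + 2n = k.\<close>

lemma weight_in_Ints:
  assumes "locally_nilpotent e" "locally_nilpotent f" "h v = m *\<^sub>C v" "v \<noteq> 0"
  shows "m \<in> \<int>"
proof -
  have last: "\<exists>n. (T ^^ n) w \<noteq> 0 \<and> T ((T ^^ n) w) = 0"
    if "locally_nilpotent T" "w \<noteq> 0" for T and w :: 'v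
  proof -
    from that(1) obtain n where "(T ^^ n) w = 0" by (auto simp: locally_nilpotent_def)
    then show ?thesis using that(2) by (induction n) auto
  qed
  from last[OF assms(1,4)] obtain n where n: "(e ^^ n) v \<noteq> 0" "e ((e ^^ n) v) = 0" by blast
  let ?w = "(e ^^ n) v"
  from last[OF assms(2) n(1)] obtain k where k: "(f ^^ k) ?w \<noteq> 0" "f ((f ^^ k) ?w) = 0" by blast
  have "0 = (of_nat (Suc k) * (m + 2 * of_nat n - of_nat k)) *\<^sub>C (f ^^ k) ?w"
    using e_f_funpow[OF h_e_funpow[OF assms(3)], of k n] k(2) n(2)
    by (simp add: clinear_0 lin clinear_funpow)
  with k(1) have "of_nat (Suc k) * (m + 2 * of_nat n - of_nat k) = 0" by (metis cvec.scale_eq_0_iff)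
  then have "m = of_nat k - 2 * of_nat n"
    by (metis add_diff_cancel_right' eq_iff_diff_eq_0 mult_eq_0_iff nat.distinct(1) of_nat_eq_0_iff)
  then show ?thesis by simp
qed

end

section \<open>Lie algebras and their modules\<close>

lemma clinear_lie: "clinear (lie x)"
  by (simp add: clinear_iff lie_add_right lie_scaleC_right)

lemma clinear_lie_left: "clinear (\<lambda>x. lie x y)"
  by (simp add: clinear_iff lie_add_left lie_scaleC_left)

lemmas lie_0_right [simp] = clinear_0[OF clinear_lie]
  and lie_0_left [simp] = clinear_0[OF clinear_lie_left]
  and lie_minus_right = clinear_minus[OF clinear_lie]
  and lie_minus_left = clinear_minus[OF clinear_lie_left]

lemma lie_swap: "lie x y = - lie y x"
proof -
  have "lie (x + y) (x + y) = 0" by (rule lie_self)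
  then have "lie x y + lie y x = 0"
    unfolding lie_add_left lie_add_right by (simp add: lie_self add.commute)
  then show ?thesis by (simp add: eq_neg_iff_add_eq_0)
qed

lemma lie_leibniz: "lie x (lie y z) = lie (lie x y) z + lie y (lie x z)"
proof -
  have "lie x (lie y z) + (lie y (lie z x) + lie z (lie x y)) = 0"
    using jacobi[of x y z] by (simp add: add.assoc)
  then have "lie x (lie y z) = - lie y (lie z x) - lie z (lie x y)"
    by (simp add: eq_neg_iff_add_eq_0 algebra_simps)
  then show ?thesis by (simp add: lie_swap[of z "lie x y"] lie_swap[of z x] lie_minus_right)
qed

lemma lie_lie: "lie (lie x y) z = lie x (lie y z) - lie y (lie x z)"
  by (simp add: lie_leibniz[of x y z])

lemma lie_subalgebraD:
  assumes "lie_subalgebra L"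
  shows "cvec.subspace L" "x \<in> L \<Longrightarrow> y \<in> L \<Longrightarrow> lie x y \<in> L"
  using assms by (auto simp: lie_subalgebra_def)

lemma lie_subalgebra_hull: "lie_subalgebra (lie_subalgebra hull S)"
  by (rule hull_in) (auto simp: lie_subalgebra_def intro: cvec.subspace_Inter)

lemma lie_hull_least:
  "lie_subalgebra T \<Longrightarrow> S \<subseteq> T \<Longrightarrow> x \<in> lie_subalgebra hull S \<Longrightarrow> x \<in> T"
  using hull_minimal[of S T lie_subalgebra] by blast

text \<open>Reduces stability under a whole Lie algebra to stability under generators.\<close>

lemma lie_subalgebra_stabilizer:
  assumes "cvec.subspace W"
  shows "lie_subalgebra {x. \<forall>w\<in>W. lie x w \<in> W}"
proof -
  have "lie (lie x y) w \<in> W" if "\<And>w. w \<in> W \<Longrightarrow> lie x w \<in> W" "\<And>w. w \<in> W \<Longrightarrow> lie y w \<in> W" "w \<in> W"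
    for x y w
    using that by (simp add: lie_lie cvec.subspace_diff[OF assms])
  then show ?thesis
    using assms
    by (auto simp: lie_subalgebra_def cvec.subspace_def lie_add_left lie_scaleC_left)
qed

lemma lie_module_adjoint: "lie_module UNIV lie"
  unfolding lie_module_def linear_action_def
  by (simp add: clinear_lie lie_add_left lie_scaleC_left lie_lie)

lemma
  assumes "linear_action S act" "x \<in> S"
  shows action_clinear: "clinear (act x)"
    and action_add: "y \<in> S \<Longrightarrow> act (x + y) v = act x v + act y v"
    and action_scale: "act (c *\<^sub>C x) v = c *\<^sub>C act x v"
  using assms by (auto simp: linear_action_def)

lemma lie_module_lie:
  "lie_module S act \<Longrightarrow> x \<in> S \<Longrightarrow> y \<in> S \<Longrightarrow> act (lie x y) v = act x (act y v) - act y (act x v)"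
  by (auto simp: lie_module_def)

lemma lie_module_linear: "lie_module S act \<Longrightarrow> linear_action S act"
  by (simp add: lie_module_def)

text \<open>After a + b applications of the Leibniz rule every term has at least a copies of
  \<open>D1\<close> on x or b copies of \<open>D2\<close> on y. Induction on a + b avoids the
  binomial expansion. It serves for the bracket and for the action on a module.\<close>

lemma bilinear_funpow_derivation:
  assumes "\<And>x. B x 0 = 0" "\<And>y. B 0 y = 0" "clinear D"
    and der: "\<And>x y. D (B x y) = B (D1 x) y + B x (D2 y)"
    and "(D1 ^^ a) x = 0" "(D2 ^^ b) y = 0"
  shows "(D ^^ (a + b)) (B x y) = 0"
  using assms(5,6)
proof (induction "a + b" arbitrary: a b x y)
  case 0
  then show ?case using assms(1) by simp
next
  case (Suc n)
  note lin = clinear_funpow[OF assms(3)]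
  have D0: "(D ^^ k) 0 = 0" for k by (rule clinear_0[OF lin])
  show ?case
  proof (cases a; cases b)
    fix a' b' assume ab: "a = Suc a'" "b = Suc b'"
    have "(D ^^ (a' + b)) (B (D1 x) y) = 0"
      using Suc ab by (intro Suc.hyps(1)) (auto simp: funpow_swap1)
    moreover have "(D ^^ (a + b')) (B x (D2 y)) = 0"
      using Suc ab by (intro Suc.hyps(1)) (auto simp: funpow_swap1)
    moreover have "(D ^^ (a + b)) (B x y) = (D ^^ n) (D (B x y))"
      unfolding Suc(2)[symmetric] by (simp add: funpow_swap1)
    moreover have "n = a' + b" "n = a + b'" using Suc(2) ab by auto
    ultimately show ?thesis by (simp add: der clinear_add[OF lin])
  qed (use Suc.prems in \<open>simp_all add: assms(1,2) D0 clinear_0[OF assms(3)]\<close>)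
qed

section \<open>Kac--Moody algebras\<close>

text \<open>Collects what is used of the presentation, without terms. The radical survives as
  \<open>no_ideal\<close>. The list is symmetric under exchanging e and f with the signs of roots
  and coroots reversed, so that results for one half yield the other.\<close>

locale km =
  fixes K :: "('i::finite, 'h::complex_vector, 'g::complex_lie_algebra) km_data"
  assumes cartan_linear: "clinear (cartan K)"
    and cartan_inj: "cartan K x = 0 \<Longrightarrow> x = 0"
    and HH: "lie (cartan K x) (cartan K y) = 0"
    and EF: "lie (gen_e K i) (gen_f K j) = (if i = j then cartan K (simple_coroot K i) else 0)"
    and HE: "lie (cartan K x) (gen_e K i) = simple_root K i x *\<^sub>C gen_e K i"
    and HF: "lie (cartan K x) (gen_f K i) = (- simple_root K i x) *\<^sub>C gen_f K i"
    and generated: "lie_subalgebra S \<Longrightarrow> range (gen_e K) \<subseteq> S \<Longrightarrow> range (gen_f K) \<subseteq> S \<Longrightarrow>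
      range (cartan K) \<subseteq> S \<Longrightarrow> S = UNIV"
    and no_ideal: "lie_ideal UNIV I \<Longrightarrow> (\<And>x. cartan K x \<in> I \<Longrightarrow> x = 0) \<Longrightarrow> I = {0}"
    and root_linear: "clinear (simple_root K i)"
    and root_indep: "(\<And>x. (\<Sum>j\<in>UNIV. c j * simple_root K j x) = 0) \<Longrightarrow> c i = 0"
    and coroot_nonzero: "simple_coroot K i \<noteq> 0"
    and pairing: "simple_root K j (simple_coroot K i) = of_int (gcm K i j)"
    and gcm: "generalized_cartan_matrix (gcm K)"

section \<open>From the presentation to the structural axioms\<close>

lemma presented_eq_LZero_if_idempotent:
  assumes "presented_eq R s (LAdd s s)"
  shows "presented_eq R s LZero"
proof -
  let ?n = "LScale (- 1) s"
  have "presented_eq R (LAdd s ?n) (LAdd (LAdd s s) ?n)"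
    by (intro presented_eq.cong_add assms presented_eq.refl)
  then have "presented_eq R LZero (LAdd s (LAdd s ?n))"
    by (meson presented_eq.trans presented_eq.sym presented_eq.add_inverse presented_eq.add_assoc)
  moreover have "presented_eq R (LAdd s (LAdd s ?n)) (LAdd s LZero)"
    by (intro presented_eq.cong_add presented_eq.refl presented_eq.add_inverse)
  moreover have "presented_eq R (LAdd s LZero) s"
    by (meson presented_eq.trans presented_eq.add_comm presented_eq.add_zero)
  ultimately show ?thesis by (meson presented_eq.trans presented_eq.sym)
qed

lemma presented_ideal_zero: "presented_ideal R {t. presented_eq R t LZero}"
proof -
  have zz: "presented_eq R (LAdd LZero LZero) LZero" by (rule presented_eq.add_zero)
  have "presented_eq R (LScale c LZero) LZero" for c
    by (rule presented_eq_LZero_if_idempotent)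
      (meson zz presented_eq.cong_scale presented_eq.scale_add presented_eq.sym presented_eq.trans)
  moreover have "presented_eq R (LBr s LZero) LZero" for s
    by (rule presented_eq_LZero_if_idempotent)
      (meson zz presented_eq.cong_br presented_eq.br_add_right presented_eq.sym presented_eq.trans
        presented_eq.refl)
  ultimately show ?thesis
    unfolding presented_ideal_def
    by (auto intro: presented_eq.refl)
      (meson zz presented_eq.cong_add presented_eq.cong_scale presented_eq.cong_br
        presented_eq.sym presented_eq.trans presented_eq.refl)+
qed

text \<open>That the relations do not collapse the Cartan part of the auxiliary algebra is read off
  from the kernel of evaluation: \<open>LZero\<close> evaluates to 0, so the radical is inhabited
  and some admissible ideal T exists. T contains every term equal to zero, so these terms form an
  admissible ideal themselves and lie in the kernel.\<close>

lemma lie_eval_presented_eq: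
  assumes "kac_moody_algebra K" "presented_eq (km_relations K) s t"
  shows "lie_eval (km_generator K) s = lie_eval (km_generator K) t"
proof -
  let ?T0 = "{t. presented_eq (km_relations K) t LZero}"
  have ker: "lie_eval (km_generator K) t = 0 \<longleftrightarrow> t \<in> km_radical K" for t
    using assms(1) by (simp add: kac_moody_algebra_def)
  have "LZero \<in> km_radical K" using ker[of LZero] by simp
  then obtain T where T: "presented_ideal (km_relations K) T" "\<And>x. LGen (GenH x) \<in> T \<Longrightarrow> x = 0"
    by (auto simp: km_radical_def)
  have "?T0 \<subseteq> T" using T(1) unfolding presented_ideal_def by (blast intro: presented_eq.sym)
  with T(2) have "\<forall>x. LGen (GenH x) \<in> ?T0 \<longrightarrow> x = 0" by blast
  then have sub: "?T0 \<subseteq> km_radical K"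
    unfolding km_radical_def by (intro Union_upper CollectI conjI presented_ideal_zero)
  have "presented_eq (km_relations K) (LAdd s (LScale (- 1) t)) (LAdd t (LScale (- 1) t))"
    by (intro presented_eq.cong_add presented_eq.refl assms(2))
  then have "LAdd s (LScale (- 1) t) \<in> ?T0"
    by (auto intro: presented_eq.trans presented_eq.add_inverse)
  then have "LAdd s (LScale (- 1) t) \<in> km_radical K" using sub by blast
  then have "lie_eval (km_generator K) (LAdd s (LScale (- 1) t)) = 0" by (simp only: ker)
  then show ?thesis by (simp add: cvec.scale_minus_left scaleC_one)
qed

lemma kac_moody_algebra_imp_km:
  assumes K: "kac_moody_algebra K"
  shows "km K"
proof -
  have ker: "lie_eval (km_generator K) t = 0 \<longleftrightarrow> t \<in> km_radical K" for t
    using assms(1) by (simp add: kac_moody_algebra_def)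
  have sur: "\<exists>t. x = lie_eval (km_generator K) t" for x
    using K unfolding kac_moody_algebra_def surj_def by blast
  have re: "realization K UNIV UNIV" using K by (simp add: kac_moody_algebra_def)
  note rel = lie_eval_presented_eq[OF K presented_eq.rel]
  have ind: "cvec.independent (range (simple_coroot K))"
    using re by (simp add: realization_def)
  show ?thesis
  proof (rule km.intro)
    show "clinear (cartan K)"
      unfolding clinear_iff
      using rel[OF km_relations.H_add] rel[OF km_relations.H_scale] by simp
    show "x = 0" if "cartan K x = 0" for x
      using ker[of "LGen (GenH x)"] that by (auto simp: km_radical_def)
    show "lie (cartan K x) (cartan K y) = 0" for x y
      using rel[OF km_relations.HH] by simp
    show "lie (gen_e K i) (gen_f K j) = (if i = j then cartan K (simple_coroot K i) else 0)" for i j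
      using rel[OF km_relations.EF] by (simp split: if_splits)
    show "lie (cartan K x) (gen_e K i) = simple_root K i x *\<^sub>C gen_e K i" for x i
      using rel[OF km_relations.HE] by simp
    show "lie (cartan K x) (gen_f K i) = (- simple_root K i x) *\<^sub>C gen_f K i" for x i
      using rel[OF km_relations.HF] by simp
    show "S = UNIV" if S: "lie_subalgebra S" "range (gen_e K) \<subseteq> S" "range (gen_f K) \<subseteq> S"
      "range (cartan K) \<subseteq> S" for S
    proof -
      note sub = lie_subalgebraD[OF S(1)]
      have gen: "km_generator K a \<in> S" for a by (cases a) (use S(2-4) in auto)
      have "lie_eval (km_generator K) t \<in> S" for t
        by (induction t)
          (simp_all add: gen sub cvec.subspace_0 cvec.subspace_add cvec.subspace_scale)
      then show ?thesis using sur by (metis UNIV_eq_I)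
    qed
    show "I = {0}" if I: "lie_ideal UNIV I" "\<And>x. cartan K x \<in> I \<Longrightarrow> x = 0" for I
    proof -
      \<comment> \<open>The preimage of I is one of the ideals whose union is the radical, and the
        radical evaluates to 0.\<close>
      let ?T = "{t. lie_eval (km_generator K) t \<in> I}"
      have sub: "cvec.subspace I" and "\<And>x y. y \<in> I \<Longrightarrow> lie x y \<in> I"
        using I(1) by (auto simp: lie_ideal_def)
      then have "presented_ideal (km_relations K) ?T"
        unfolding presented_ideal_def using lie_eval_presented_eq[OF K]
        by (auto simp: cvec.subspace_0 cvec.subspace_add cvec.subspace_scale)
      then have "?T \<subseteq> km_radical K"
        unfolding km_radical_def using I(2) by auto
      then have "x = 0" if "x \<in> I" for x
        using that sur[of x] ker by auto
      then show ?thesis using cvec.subspace_0[OF sub] by auto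
    qed
    show "clinear (simple_root K i)" for i using re by (simp add: realization_def)
    show "c i = 0" if "\<And>x. (\<Sum>j\<in>UNIV. c j * simple_root K j x) = 0" for c i
      using re that by (simp add: realization_def)
    show "simple_coroot K i \<noteq> 0" for i
      using ind cvec.dependent_zero[of "range (simple_coroot K)"] by (metis rangeI)
    show "simple_root K j (simple_coroot K i) = of_int (gcm K i j)" for i j
      using re by (simp add: realization_def)
    show "generalized_cartan_matrix (gcm K)" using K by (simp add: kac_moody_algebra_def)
  qed
qed

text \<open>The Chevalley involution on the level of data. The Cartan matrix stays the same because
  roots and coroots change sign together.\<close>

definition km_opposite ::
    "('i, 'h::complex_vector, 'g) km_data \<Rightarrow> ('i, 'h, 'g) km_data"
  where "km_opposite K = K\<lparr>gen_e := gen_f K, gen_f := gen_e K,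
    simple_root := \<lambda>i h. - simple_root K i h, simple_coroot := \<lambda>i. - simple_coroot K i\<rparr>"

lemma km_opposite_simps [simp]:
  "gen_e (km_opposite K) = gen_f K"
  "gen_f (km_opposite K) = gen_e K"
  "simple_root (km_opposite K) i h = - simple_root K i h"
  "simple_coroot (km_opposite K) i = - simple_coroot K i"
  "cartan (km_opposite K) = cartan K"
  "gcm (km_opposite K) = gcm K"
  by (simp_all add: km_opposite_def)

context km
begin

lemma km_opposite: "km (km_opposite K)"
proof (rule km.intro)
  show "lie (gen_e (km_opposite K) i) (gen_f (km_opposite K) j) =
      (if i = j then cartan (km_opposite K) (simple_coroot (km_opposite K) i) else 0)" for i j
    by (simp add: lie_swap[of "gen_f K i"] EF clinear_minus[OF cartan_linear])
  show "clinear (simple_root (km_opposite K) i)" for i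
    using root_linear[of i] by (simp add: clinear_iff scaleC_complex_def)
  show "c i = 0" if "\<And>x. (\<Sum>j\<in>UNIV. c j * simple_root (km_opposite K) j x) = 0" for c i
    using root_indep[of c i] that by (simp add: sum_negf)
  show "simple_root (km_opposite K) j (simple_coroot (km_opposite K) i) = of_int (gcm (km_opposite K) i j)"
    for i j by (simp add: clinear_minus[OF root_linear] pairing)
  show "S = UNIV" if "lie_subalgebra S" "range (gen_e (km_opposite K)) \<subseteq> S"
    "range (gen_f (km_opposite K)) \<subseteq> S" "range (cartan (km_opposite K)) \<subseteq> S" for S
    using generated that by simp
  show "I = {0}" if "lie_ideal UNIV I" "\<And>x. cartan (km_opposite K) x \<in> I \<Longrightarrow> x = 0" for I
    using no_ideal that by simp
qed (simp_all add: cartan_linear cartan_inj HH HE HF coroot_nonzero gcm)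

lemma gcm_diag: "gcm K i i = 2"
  using gcm by (simp add: generalized_cartan_matrix_def)

lemma gcm_nonpos: "i \<noteq> j \<Longrightarrow> gcm K i j \<le> 0"
  using gcm by (simp add: generalized_cartan_matrix_def)

lemma sl2_action_module:
  assumes "lie_module S act"
    and S: "gen_e K i \<in> S" "gen_f K i \<in> S" "cartan K (simple_coroot K i) \<in> S"
  shows "sl2_action (act (gen_e K i)) (act (gen_f K i)) (act (cartan K (simple_coroot K i)))"
proof (rule sl2_action.intro)
  note lin = lie_module_linear[OF assms(1)]
  note lie = lie_module_lie[OF assms(1)]
  let ?h = "cartan K (simple_coroot K i)"
  show "act ?h (act (gen_e K i) v) = act (gen_e K i) (act ?h v) + 2 *\<^sub>C act (gen_e K i) v" for v
    using lie[OF S(3) S(1), of v] by (simp add: HE pairing gcm_diag action_scale[OF lin S(1)] algebra_simps)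
  show "act ?h (act (gen_f K i) v) = act (gen_f K i) (act ?h v) - 2 *\<^sub>C act (gen_f K i) v" for v
    using lie[OF S(3) S(2), of v] action_scale[OF lin S(2), of "- 2" v]
    by (simp add: HF pairing gcm_diag algebra_simps)
  show "act (gen_e K i) (act (gen_f K i) v) = act (gen_f K i) (act (gen_e K i) v) + act ?h v" for v
    using lie[OF S(1) S(2), of v] by (simp add: EF algebra_simps)
qed (rule action_clinear[OF lie_module_linear[OF assms(1)]], fact S)+

text \<open>The stabilizer of W is a subalgebra containing the generators, hence everything; so W is
  an ideal, in particular a subalgebra, and it contains the generators too.\<close>

lemma stable_eq_UNIV:
  assumes "cvec.subspace W" "range (gen_e K) \<subseteq> W" "range (gen_f K) \<subseteq> W" "range (cartan K) \<subseteq> W"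
    and "\<And>i w. w \<in> W \<Longrightarrow> lie (gen_e K i) w \<in> W" "\<And>i w. w \<in> W \<Longrightarrow> lie (gen_f K i) w \<in> W"
      "\<And>x w. w \<in> W \<Longrightarrow> lie (cartan K x) w \<in> W"
  shows "W = UNIV"
proof -
  have "{x. \<forall>w\<in>W. lie x w \<in> W} = UNIV"
    by (rule generated[OF lie_subalgebra_stabilizer[OF assms(1)]]) (use assms(5-7) in auto)
  then have "lie_subalgebra W" using assms(1) unfolding lie_subalgebra_def by blast
  then show ?thesis using assms(2-4) by (rule generated)
qed

lemma stable_eq_0:
  assumes "cvec.subspace W" "\<And>x. cartan K x \<in> W \<Longrightarrow> x = 0"
    and "\<And>i w. w \<in> W \<Longrightarrow> lie (gen_e K i) w \<in> W" "\<And>i w. w \<in> W \<Longrightarrow> lie (gen_f K i) w \<in> W"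
      "\<And>x w. w \<in> W \<Longrightarrow> lie (cartan K x) w \<in> W"
  shows "W = {0}"
proof -
  have "{x. \<forall>w\<in>W. lie x w \<in> W} = UNIV"
    by (rule generated[OF lie_subalgebra_stabilizer[OF assms(1)]]) (use assms(3-5) in auto)
  then have "lie_ideal UNIV W" using assms(1) unfolding lie_ideal_def by blast
  then show ?thesis using assms(2) by (rule no_ideal)
qed

end

section \<open>The grading by the root lattice\<close>

definition unit_vec :: "'i \<Rightarrow> 'i \<Rightarrow> int"
  where "unit_vec i j = (if j = i then 1 else 0)"

context km
begin

text \<open>Spaces are indexed by integer coefficient vectors, faithfully by
  \<open>root_comb_inj\<close>. The vector need not be a root: the space may be zero, and for c = 0
  it is the Cartan subalgebra.\<close>

abbreviation RV :: "('i \<Rightarrow> int) \<Rightarrow> 'g set"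
  where "RV c \<equiv> root_space K (root_comb K c)"

text \<open>Allowing any set S turns questions on brackets and intersections of the relevant
  subalgebras into arithmetic of coefficient vectors.\<close>

definition root_sum :: "('i \<Rightarrow> int) set \<Rightarrow> 'g set"
  where "root_sum S = cvec.span (\<Union>c\<in>S. RV c)"

lemma root_comb_inj: "root_comb K c = root_comb K d \<Longrightarrow> c = d"
proof -
  assume eq: "root_comb K c = root_comb K d"
  have "(\<Sum>j\<in>UNIV. of_int (c j - d j) * simple_root K j x) = 0" for x
    using fun_cong[OF eq, of x] by (simp add: root_comb_def left_diff_distrib sum_subtractf)
  from root_indep[of "\<lambda>j. of_int (c j - d j)", OF this] show "c = d"
    by (metis ext of_int_eq_0_iff right_minus_eq)
qed

lemma RV_eq: "RV c = joint_eigenspace (\<lambda>x. lie (cartan K x)) (root_comb K c)"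
  by (simp add: root_space_def joint_eigenspace_def)

lemma subspace_RV: "cvec.subspace (RV c)"
  unfolding RV_eq by (rule subspace_joint_eigenspace) (rule clinear_lie)

lemma root_sum_eq: "root_sum S = eigensum (\<lambda>x. lie (cartan K x)) (root_comb K ` S)"
  by (simp add: root_sum_def eigensum_def RV_eq)

lemma subspace_root_sum: "cvec.subspace (root_sum S)"
  by (simp add: root_sum_def)

lemma root_sum_mono: "S \<subseteq> T \<Longrightarrow> root_sum S \<subseteq> root_sum T"
  unfolding root_sum_def by (intro cvec.span_mono) auto

lemma RV_subset_root_sum: "c \<in> S \<Longrightarrow> x \<in> RV c \<Longrightarrow> x \<in> root_sum S"
  unfolding root_sum_def by (rule cvec.span_base) auto

lemma root_sum_disjoint: "x \<in> root_sum S \<Longrightarrow> x \<in> root_sum T \<Longrightarrow> S \<inter> T = {} \<Longrightarrow> x = 0"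
  unfolding root_sum_eq
  by (rule eigensum_disjoint[of "\<lambda>x. lie (cartan K x)" _ "root_comb K ` S" "root_comb K ` T"])
    (auto simp: clinear_lie dest: root_comb_inj)

lemma root_sum_Un:
  assumes "x \<in> root_sum (S \<union> T)"
  obtains y z where "y \<in> root_sum S" "z \<in> root_sum T" "x = y + z"
proof -
  have "x \<in> cvec.span ((\<Union>c\<in>S. RV c) \<union> (\<Union>c\<in>T. RV c))"
    using assms by (simp add: root_sum_def)
  then show thesis unfolding cvec.span_Un root_sum_def[symmetric] using that by blast
qed

lemma root_sum_Int:
  assumes "x \<in> root_sum S" "x \<in> root_sum T"
  shows "x \<in> root_sum (S \<inter> T)"
proof -
  have "x \<in> root_sum ((S \<inter> T) \<union> (S - T))" using assms(1) by (simp add: Int_Diff_Un)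
  then obtain y z where yz: "y \<in> root_sum (S \<inter> T)" "z \<in> root_sum (S - T)" "x = y + z"
    by (rule root_sum_Un)
  have "y \<in> root_sum T" using yz(1) root_sum_mono[of "S \<inter> T" T] by blast
  then have "x - y \<in> root_sum T" by (rule cvec.subspace_diff[OF subspace_root_sum assms(2)])
  then have "z = 0" using yz by (intro root_sum_disjoint[of z "S - T" T]) auto
  with yz show ?thesis by simp
qed

lemma lie_RV:
  assumes "x \<in> RV c" "y \<in> RV d"
  shows "lie x y \<in> RV (\<lambda>i. c i + d i)"
  using assms unfolding root_space_def
  by (auto simp: lie_leibniz[of "cartan K _"] lie_scaleC_left lie_scaleC_right root_comb_def
      distrib_right sum.distrib scaleC_add_left)

lemma lie_root_sum:
  assumes "x \<in> root_sum S" "y \<in> root_sum T" "\<And>c d. c \<in> S \<Longrightarrow> d \<in> T \<Longrightarrow> (\<lambda>i. c i + d i) \<in> U"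
  shows "lie x y \<in> root_sum U"
proof (rule clinear_span_subset[OF clinear_lie_left subspace_root_sum])
  show "x \<in> cvec.span (\<Union>c\<in>S. RV c)" using assms(1) by (simp add: root_sum_def)
  fix x' assume x': "x' \<in> (\<Union>c\<in>S. RV c)"
  show "lie x' y \<in> root_sum U"
  proof (rule clinear_span_subset[OF clinear_lie subspace_root_sum])
    show "y \<in> cvec.span (\<Union>c\<in>T. RV c)" using assms(2) by (simp add: root_sum_def)
    show "lie x' y' \<in> root_sum U" if "y' \<in> (\<Union>c\<in>T. RV c)" for y'
      using that x' assms(3) by (auto intro: RV_subset_root_sum lie_RV)
  qed
qed

lemma lie_subalgebra_root_sum:
  "(\<And>c d. c \<in> S \<Longrightarrow> d \<in> S \<Longrightarrow> (\<lambda>i. c i + d i) \<in> S) \<Longrightarrow> lie_subalgebra (root_sum S)"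
  using subspace_root_sum lie_root_sum[of _ S _ S S] by (auto simp: lie_subalgebra_def)

lemma root_comb_unit_vec: "root_comb K (unit_vec i) = simple_root K i"
proof
  fix x
  have "root_comb K (unit_vec i) x = (\<Sum>j\<in>UNIV. if j = i then simple_root K j x else 0)"
    unfolding root_comb_def by (rule sum.cong) (auto simp: unit_vec_def)
  then show "root_comb K (unit_vec i) x = simple_root K i x" by simp
qed

lemma root_comb_uminus: "root_comb K (\<lambda>j. - c j) x = - root_comb K c x"
  by (simp add: root_comb_def sum_negf)

lemma gen_e_RV: "gen_e K i \<in> RV (unit_vec i)"
  by (simp add: root_space_def root_comb_unit_vec HE)

lemma gen_f_RV: "gen_f K i \<in> RV (\<lambda>j. - unit_vec i j)"
  by (simp add: root_space_def root_comb_uminus root_comb_unit_vec HF)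

lemma cartan_RV: "cartan K x \<in> RV (\<lambda>_. 0)"
  by (simp add: root_space_def root_comb_def HH)

lemma RV_cartan: "x \<in> RV c \<Longrightarrow> lie (cartan K h) x = root_comb K c h *\<^sub>C x"
  by (simp add: root_space_def)

section \<open>The triangular decomposition\<close>

definition pos_vecs :: "('i \<Rightarrow> int) set"
  where "pos_vecs = {c. (\<forall>i. c i \<ge> 0) \<and> c \<noteq> (\<lambda>_. 0)}"

definition neg_vecs :: "('i \<Rightarrow> int) set"
  where "neg_vecs = {c. (\<forall>i. c i \<le> 0) \<and> c \<noteq> (\<lambda>_. 0)}"

lemma unit_vec_pos: "unit_vec i \<in> pos_vecs" "(\<lambda>j. - unit_vec i j) \<in> neg_vecs"
  by (auto simp: pos_vecs_def neg_vecs_def unit_vec_def fun_eq_iff)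

lemma add_pos_vecs: "c \<in> pos_vecs \<Longrightarrow> d \<in> pos_vecs \<Longrightarrow> (\<lambda>i. c i + d i) \<in> pos_vecs"
  unfolding pos_vecs_def fun_eq_iff by (auto simp: add_nonneg_eq_0_iff)

lemma add_neg_vecs: "c \<in> neg_vecs \<Longrightarrow> d \<in> neg_vecs \<Longrightarrow> (\<lambda>i. c i + d i) \<in> neg_vecs"
  unfolding neg_vecs_def fun_eq_iff by (auto simp: add_nonpos_eq_0_iff intro: add_nonpos_nonpos)

lemma n_plus_subset: "n_plus K \<subseteq> root_sum pos_vecs"
  unfolding n_plus_def
  by (intro hull_minimal lie_subalgebra_root_sum add_pos_vecs)
    (auto intro: RV_subset_root_sum gen_e_RV unit_vec_pos)

lemma lie_subalgebra_n_plus: "lie_subalgebra (n_plus K)"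
  unfolding n_plus_def by (rule lie_subalgebra_hull)

lemmas subspace_n_plus = lie_subalgebraD(1)[OF lie_subalgebra_n_plus]

lemma gen_e_n_plus: "gen_e K i \<in> n_plus K"
  unfolding n_plus_def by (rule hull_inc) simp

lemma lie_cartan_n_plus:
  assumes "x \<in> n_plus K"
  shows "lie (cartan K h) x \<in> n_plus K"
proof -
  have "lie_subalgebra {x \<in> n_plus K. lie (cartan K h) x \<in> n_plus K}"
    using lie_subalgebraD[OF lie_subalgebra_n_plus]
    by (auto simp: lie_subalgebra_def cvec.subspace_def lie_add_right lie_scaleC_right
        lie_leibniz[of "cartan K h"])
  moreover have "range (gen_e K) \<subseteq> {x \<in> n_plus K. lie (cartan K h) x \<in> n_plus K}"
    by (auto simp: HE gen_e_n_plus cvec.subspace_scale[OF subspace_n_plus])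
  ultimately show ?thesis using assms lie_hull_least[of _ "range (gen_e K)" x]
    unfolding n_plus_def[symmetric] by blast
qed

text \<open>ad f_i sends each e_j into the Cartan subalgebra, and the Cartan subalgebra plus n_+
  normalizes n_+. By the Leibniz rule the elements of n_+ with the required property therefore form
  a subalgebra containing all e_j.\<close>

lemma lie_gen_f_n_plus:
  assumes "x \<in> n_plus K"
  obtains h y where "y \<in> n_plus K" "lie (gen_f K i) x = cartan K h + y"
proof -
  let ?W = "{cartan K h + y |h y. y \<in> n_plus K}"
  let ?L = "{x \<in> n_plus K. lie (gen_f K i) x \<in> ?W}"
  note n = lie_subalgebraD[OF lie_subalgebra_n_plus]
  have sub: "cvec.subspace ?W"
    unfolding cvec.subspace_def
  proof (intro conjI ballI allI)
    show "0 \<in> ?W"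
      using clinear_0[OF cartan_linear] cvec.subspace_0[OF n(1)] by (auto intro!: exI[of _ 0])
    show "x + y \<in> ?W" if "x \<in> ?W" "y \<in> ?W" for x y
    proof -
      from that obtain h z h' z' where "x = cartan K h + z" "z \<in> n_plus K"
        "y = cartan K h' + z'" "z' \<in> n_plus K" by auto
      then show ?thesis
        by (auto intro!: exI[of _ "h + h'"] exI[of _ "z + z'"] cvec.subspace_add[OF n(1)]
            simp: clinear_add[OF cartan_linear])
    qed
    show "c *\<^sub>C x \<in> ?W" if "x \<in> ?W" for x c
    proof -
      from that obtain h z where "x = cartan K h + z" "z \<in> n_plus K" by auto
      then show ?thesis
        by (auto intro!: exI[of _ "c *\<^sub>C h"] exI[of _ "c *\<^sub>C z"] cvec.subspace_scale[OF n(1)]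
            simp: clinear_scale[OF cartan_linear] scaleC_add_right)
    qed
  qed
  have in_W: "y \<in> ?W" if "y \<in> n_plus K" for y
    using that clinear_0[OF cartan_linear] by (intro CollectI exI[of _ 0] exI[of _ y]) simp
  have W_n: "lie w x \<in> n_plus K" "lie x w \<in> n_plus K" if "w \<in> ?W" "x \<in> n_plus K" for w x
  proof -
    from that(1) obtain h z where "w = cartan K h + z" "z \<in> n_plus K" by auto
    then show "lie w x \<in> n_plus K"
      using that(2) by (auto simp: lie_add_left intro: cvec.subspace_add[OF n(1)] n(2) lie_cartan_n_plus)
    then show "lie x w \<in> n_plus K"
      by (subst lie_swap) (rule cvec.subspace_neg[OF n(1)])
  qed
  have "lie_subalgebra ?L"
    unfolding lie_subalgebra_def
  proof (intro conjI ballI)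
    show "cvec.subspace ?L"
      using n(1) sub unfolding cvec.subspace_def by (simp add: lie_add_right lie_scaleC_right)
    fix x y assume xy: "x \<in> ?L" "y \<in> ?L"
    then have "lie (lie (gen_f K i) x) y \<in> n_plus K" "lie x (lie (gen_f K i) y) \<in> n_plus K"
      using W_n by blast+
    then have "lie (gen_f K i) (lie x y) \<in> n_plus K"
      unfolding lie_leibniz[of "gen_f K i"] by (rule cvec.subspace_add[OF n(1)])
    then show "lie x y \<in> ?L" using xy n(2) in_W by blast
  qed
  moreover have "range (gen_e K) \<subseteq> ?L"
  proof safe
    fix j
    show "gen_e K j \<in> n_plus K" by (rule gen_e_n_plus)
    have "lie (gen_f K i) (gen_e K j) = cartan K (if i = j then - simple_coroot K j else 0) + 0"
      by (simp add: lie_swap[of "gen_f K i"] EF clinear_minus[OF cartan_linear] clinear_0[OF cartan_linear])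
    then show "\<exists>h y. lie (gen_f K i) (gen_e K j) = cartan K h + y \<and> y \<in> n_plus K"
      using cvec.subspace_0[OF n(1)] by blast
  qed
  ultimately have "x \<in> ?L" using assms lie_hull_least[of ?L "range (gen_e K)" x]
    unfolding n_plus_def[symmetric] by blast
  then show thesis using that by blast
qed

definition n_minus :: "'g set"
  where "n_minus = lie_subalgebra hull (range (gen_f K))"

lemma n_minus_eq: "n_minus = n_plus (km_opposite K)"
  by (simp add: n_minus_def n_plus_def)

lemma
  shows lie_subalgebra_n_minus: "lie_subalgebra n_minus"
    and gen_f_n_minus: "gen_f K i \<in> n_minus"
    and lie_cartan_n_minus: "y \<in> n_minus \<Longrightarrow> lie (cartan K h) y \<in> n_minus"
proof -
  interpret op: km "km_opposite K" by (rule km_opposite)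
  show "lie_subalgebra n_minus" unfolding n_minus_eq by (rule op.lie_subalgebra_n_plus)
  show "gen_f K i \<in> n_minus" unfolding n_minus_eq using op.gen_e_n_plus[of i] by simp
  show "lie (cartan K h) y \<in> n_minus" if "y \<in> n_minus"
    using op.lie_cartan_n_plus[of y h] that by (simp add: n_minus_eq)
qed

lemma lie_gen_e_n_minus:
  assumes "y \<in> n_minus"
  obtains h z where "z \<in> n_minus" "lie (gen_e K i) y = cartan K h + z"
proof -
  interpret op: km "km_opposite K" by (rule km_opposite)
  show thesis
    using op.lie_gen_f_n_plus[of y i] assms that unfolding n_minus_eq[symmetric] by auto
qed

lemma n_minus_subset: "n_minus \<subseteq> root_sum neg_vecs"
  unfolding n_minus_def
  by (intro hull_minimal lie_subalgebra_root_sum add_neg_vecs)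
    (auto intro: RV_subset_root_sum gen_f_RV unit_vec_pos)

text \<open>The sum of the three parts contains the generators and is stable under bracketing with
  them, so \<open>stable_eq_UNIV\<close> applies.\<close>

lemma triangular_decomposition:
  obtains y h z where "y \<in> n_minus" "z \<in> n_plus K" "x = y + cartan K h + z"
proof -
  let ?W = "{y + cartan K h + z |y h z. y \<in> n_minus \<and> z \<in> n_plus K}"
  note np = lie_subalgebraD[OF lie_subalgebra_n_plus]
  note nm = lie_subalgebraD[OF lie_subalgebra_n_minus]
  have W: "y + cartan K h + z \<in> ?W" if "y \<in> n_minus" "z \<in> n_plus K" for y h z
    using that by auto
  have zero: "0 \<in> n_minus" "0 \<in> n_plus K" "cartan K 0 = 0"
    using cvec.subspace_0 np(1) nm(1) clinear_0[OF cartan_linear] by auto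
  have sub: "cvec.subspace ?W"
    unfolding cvec.subspace_def
  proof (intro conjI ballI allI)
    show "0 \<in> ?W" using W[of 0 0 0] zero by simp
    show "x + y \<in> ?W" if "x \<in> ?W" "y \<in> ?W" for x y
    proof -
      from that obtain a h b a' h' b' where *: "a \<in> n_minus" "b \<in> n_plus K" "a' \<in> n_minus" "b' \<in> n_plus K"
        "x = a + cartan K h + b" "y = a' + cartan K h' + b'" by auto
      have "(a + a') + cartan K (h + h') + (b + b') \<in> ?W"
        by (intro W cvec.subspace_add[OF np(1)] cvec.subspace_add[OF nm(1)] *)
      then show ?thesis by (simp add: * clinear_add[OF cartan_linear] add_ac)
    qed
    show "c *\<^sub>C x \<in> ?W" if "x \<in> ?W" for x c
    proof -
      from that obtain a h b where *: "a \<in> n_minus" "b \<in> n_plus K" "x = a + cartan K h + b" by auto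
      have "c *\<^sub>C a + cartan K (c *\<^sub>C h) + c *\<^sub>C b \<in> ?W"
        by (intro W cvec.subspace_scale[OF np(1)] cvec.subspace_scale[OF nm(1)] *)
      then show ?thesis by (simp add: * clinear_scale[OF cartan_linear] scaleC_add_right)
    qed
  qed
  have nmW: "y \<in> ?W" if "y \<in> n_minus" for y using W[OF that zero(2), of 0] zero by simp
  have npW: "z \<in> ?W" if "z \<in> n_plus K" for z using W[OF zero(1) that, of 0] zero by simp
  have hW: "cartan K h \<in> ?W" for h using W[OF zero(1,2), of h] by simp
  have "?W = UNIV"
  proof (rule stable_eq_UNIV[OF sub])
    show "range (gen_e K) \<subseteq> ?W" "range (gen_f K) \<subseteq> ?W" "range (cartan K) \<subseteq> ?W"
      using npW gen_e_n_plus nmW gen_f_n_minus hW by blast+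
  next
    fix i w assume "w \<in> ?W"
    then obtain y h z where *: "y \<in> n_minus" "z \<in> n_plus K" "w = y + cartan K h + z" by auto
    obtain h' y' where 1: "y' \<in> n_minus" "lie (gen_e K i) y = cartan K h' + y'"
      using lie_gen_e_n_minus[OF *(1)] .
    have "lie (gen_e K i) (cartan K h) \<in> n_plus K"
      by (simp add: lie_swap[of "gen_e K i" "cartan K h"] HE cvec.subspace_neg[OF np(1)]
          cvec.subspace_scale[OF np(1)] gen_e_n_plus)
    moreover have "lie (gen_e K i) z \<in> n_plus K" by (rule np(2)[OF gen_e_n_plus *(2)])
    ultimately show "lie (gen_e K i) w \<in> ?W"
      unfolding *(3) lie_add_right 1(2)
      by (intro cvec.subspace_add[OF sub] hW nmW 1 npW)
  next
    fix i w assume "w \<in> ?W"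
    then obtain y h z where *: "y \<in> n_minus" "z \<in> n_plus K" "w = y + cartan K h + z" by auto
    obtain h' z' where 1: "z' \<in> n_plus K" "lie (gen_f K i) z = cartan K h' + z'"
      using lie_gen_f_n_plus[OF *(2)] .
    have "lie (gen_f K i) (cartan K h) \<in> n_minus"
      by (simp add: lie_swap[of "gen_f K i" "cartan K h"] HF cvec.subspace_neg[OF nm(1)]
          cvec.subspace_scale[OF nm(1)] gen_f_n_minus)
    moreover have "lie (gen_f K i) y \<in> n_minus" by (rule nm(2)[OF gen_f_n_minus *(1)])
    ultimately show "lie (gen_f K i) w \<in> ?W"
      unfolding *(3) lie_add_right 1(2)
      by (intro cvec.subspace_add[OF sub] hW nmW 1 npW)
  next
    fix x w assume "w \<in> ?W"
    then obtain y h z where *: "y \<in> n_minus" "z \<in> n_plus K" "w = y + cartan K h + z" by auto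
    then show "lie (cartan K x) w \<in> ?W"
      unfolding *(3) lie_add_right HH
      by (intro cvec.subspace_add[OF sub] nmW npW cvec.subspace_0[OF sub]
          lie_cartan_n_plus lie_cartan_n_minus)
  qed
  then have "x \<in> ?W" by simp
  then show thesis using that by blast
qed

lemma root_sum_UNIV: "x \<in> root_sum (neg_vecs \<union> {\<lambda>_. 0} \<union> pos_vecs)"
proof -
  obtain y h z where *: "y \<in> n_minus" "z \<in> n_plus K" "x = y + cartan K h + z"
    by (rule triangular_decomposition)
  have "y \<in> root_sum (neg_vecs \<union> {\<lambda>_. 0} \<union> pos_vecs)" "z \<in> root_sum (neg_vecs \<union> {\<lambda>_. 0} \<union> pos_vecs)"
    using n_minus_subset n_plus_subset *(1,2) root_sum_mono[of neg_vecs "neg_vecs \<union> {\<lambda>_. 0} \<union> pos_vecs"]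
      root_sum_mono[of pos_vecs "neg_vecs \<union> {\<lambda>_. 0} \<union> pos_vecs"] by auto
  then show ?thesis
    unfolding *(3)
    by (intro cvec.subspace_add[OF subspace_root_sum])
      (auto intro: RV_subset_root_sum[OF _ cartan_RV])
qed

text \<open>The triangular decomposition involves sign-coherent vectors only; an element of mixed
  degree would lie in two sums with disjoint index sets.\<close>

lemma root_sign:
  assumes "x \<in> RV c" "x \<noteq> 0"
  shows "(\<forall>i. c i \<ge> 0) \<or> (\<forall>i. c i \<le> 0)"
proof (rule ccontr)
  assume "\<not> ?thesis"
  then have "{c} \<inter> (neg_vecs \<union> {\<lambda>_. 0} \<union> pos_vecs) = {}"
    by (auto simp: neg_vecs_def pos_vecs_def)
  with root_sum_disjoint[OF RV_subset_root_sum[OF _ assms(1), of "{c}"] root_sum_UNIV] assms(2)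
  show False by blast
qed

lemma RV_0: "RV (\<lambda>_. 0) = range (cartan K)"
proof (intro subset_antisym subsetI)
  fix x assume x: "x \<in> RV (\<lambda>_. 0)"
  obtain y h z where *: "y \<in> n_minus" "z \<in> n_plus K" "x = y + cartan K h + z"
    by (rule triangular_decomposition)
  have "y + z \<in> root_sum (neg_vecs \<union> pos_vecs)"
    using *(1,2) n_minus_subset n_plus_subset root_sum_mono[of neg_vecs "neg_vecs \<union> pos_vecs"]
      root_sum_mono[of pos_vecs "neg_vecs \<union> pos_vecs"]
    by (intro cvec.subspace_add[OF subspace_root_sum]) auto
  moreover have "x - cartan K h \<in> RV (\<lambda>_. 0)"
    by (rule cvec.subspace_diff[OF subspace_RV x cartan_RV])
  then have "y + z \<in> root_sum {\<lambda>_. 0}"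
    by (intro RV_subset_root_sum[of "\<lambda>_. 0"]) (simp_all add: *(3) add.commute)
  moreover have "{\<lambda>_. 0} \<inter> (neg_vecs \<union> pos_vecs) = {}" by (auto simp: pos_vecs_def neg_vecs_def)
  ultimately have "y + z = 0" using root_sum_disjoint by blast
  then have "x = cartan K h" by (simp add: *(3) algebra_simps)
  then show "x \<in> range (cartan K)" by simp
qed (use cartan_RV in auto)

subsection \<open>Serre relations and local nilpotency of the adjoint action\<close>

text \<open>Applying all words in the ad e_i to x spans a subspace W. It is stable under the Cartan
  subalgebra, and under each f_j because f_j kills x and [f_j, e_i] lies in the Cartan subalgebra.
  So W is an ideal with positive degrees only, and it meets the Cartan subalgebra trivially.\<close>

lemma killed_by_gen_f_eq_0:
  assumes c: "c \<in> pos_vecs" and x: "x \<in> RV c" and f: "\<And>i. lie (gen_f K i) x = 0"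
  shows "x = 0"
proof -
  define W where "W = cvec.span {fold (\<lambda>i. lie (gen_e K i)) js x |js. True}"
  have sub: "cvec.subspace W" by (simp add: W_def)
  have base: "fold (\<lambda>i. lie (gen_e K i)) js x \<in> W" for js
    unfolding W_def by (rule cvec.span_base) blast
  have weight: "\<exists>d\<in>pos_vecs. fold (\<lambda>i. lie (gen_e K i)) js x \<in> RV d" for js
  proof (induction js rule: rev_induct)
    case (snoc i js)
    then show ?case using lie_RV[OF gen_e_RV] add_pos_vecs[OF unit_vec_pos(1)] by fastforce
  qed (use c x in auto)
  have E: "lie (gen_e K i) w \<in> W" if "w \<in> W" for i w
  proof (rule clinear_span_subset[OF clinear_lie sub _ that[unfolded W_def]])
    fix y assume "y \<in> {fold (\<lambda>i. lie (gen_e K i)) js x |js. True}"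
    then obtain js where "y = fold (\<lambda>i. lie (gen_e K i)) js x" by blast
    then show "lie (gen_e K i) y \<in> W" using base[of "js @ [i]"] by simp
  qed
  have H: "lie (cartan K h) (fold (\<lambda>i. lie (gen_e K i)) js x) \<in> W" for h js
    using weight[of js] base[of js] by (auto simp: RV_cartan cvec.subspace_scale[OF sub])
  have F: "lie (gen_f K j) (fold (\<lambda>i. lie (gen_e K i)) js x) \<in> W" for j js
  proof (induction js rule: rev_induct)
    case Nil
    then show ?case by (simp add: f cvec.subspace_0[OF sub])
  next
    case (snoc i js)
    let ?y = "fold (\<lambda>i. lie (gen_e K i)) js x"
    have "lie (lie (gen_f K j) (gen_e K i)) ?y \<in> W"
      using H by (simp add: lie_swap[of "gen_f K j"] EF lie_minus_left cvec.subspace_neg[OF sub]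
          cvec.subspace_0[OF sub])
    then show ?case
      using snoc E by (simp add: lie_leibniz[of "gen_f K j"] cvec.subspace_add[OF sub])
  qed
  have "W = {0}"
  proof (rule stable_eq_0[OF sub])
    show "h = 0" if "cartan K h \<in> W" for h
    proof -
      have "W \<subseteq> root_sum pos_vecs"
        unfolding W_def
        by (rule cvec.span_minimal[OF _ subspace_root_sum]) (use weight RV_subset_root_sum in blast)
      with that have "cartan K h = 0"
        using root_sum_disjoint[OF RV_subset_root_sum[OF _ cartan_RV, of "{\<lambda>_. 0}"], of h pos_vecs]
        by (auto simp: pos_vecs_def)
      then show ?thesis by (rule cartan_inj)
    qed
    show "lie (gen_e K i) w \<in> W" if "w \<in> W" for i w using E[OF that] .
    show "lie (gen_f K i) w \<in> W" if "w \<in> W" for i w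
      by (rule clinear_span_subset[OF clinear_lie sub _ that[unfolded W_def]]) (use F in auto)
    show "lie (cartan K h) w \<in> W" if "w \<in> W" for h w
      by (rule clinear_span_subset[OF clinear_lie sub _ that[unfolded W_def]]) (use H in auto)
  qed
  then show ?thesis using base[of "[]"] by simp
qed

lemma sl2_action_adjoint:
  "sl2_action (lie (gen_e K i)) (lie (gen_f K i)) (lie (cartan K (simple_coroot K i)))"
  by (rule sl2_action_module[OF lie_module_adjoint]) simp_all

lemma
  assumes "x \<in> RV c"
  shows ad_e_funpow_RV: "(lie (gen_e K i) ^^ n) x \<in> RV (\<lambda>j. c j + int n * unit_vec i j)"
    and ad_f_funpow_RV: "(lie (gen_f K i) ^^ n) x \<in> RV (\<lambda>j. c j - int n * unit_vec i j)"
proof -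
  have "(\<lambda>j. c j + int (Suc n) * unit_vec i j) = (\<lambda>j. unit_vec i j + (c j + int n * unit_vec i j))"
    "(\<lambda>j. c j - int (Suc n) * unit_vec i j) = (\<lambda>j. - unit_vec i j + (c j - int n * unit_vec i j))" for n
    by (auto simp: algebra_simps)
  note eq = this
  show "(lie (gen_e K i) ^^ n) x \<in> RV (\<lambda>j. c j + int n * unit_vec i j)"
  proof (induction n)
    case (Suc n)
    then show ?case unfolding eq using lie_RV[OF gen_e_RV] by simp
  qed (use assms in simp)
  show "(lie (gen_f K i) ^^ n) x \<in> RV (\<lambda>j. c j - int n * unit_vec i j)"
  proof (induction n)
    case (Suc n)
    then show ?case unfolding eq using lie_RV[OF gen_f_RV] by simp
  qed (use assms in simp)
qed

text \<open>The element is killed by every f_k and has positive degree. For k different from i, ad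
  f_k commutes with ad e_i, which leaves a power of ad e_i on [f_k, e_j]: this bracket is zero for k
  different from j and minus the coroot for k = j. The case k = i is sl_2-theory.\<close>

lemma serre:
  assumes "i \<noteq> j"
  shows "(lie (gen_e K i) ^^ nat (1 - gcm K i j)) (gen_e K j) = 0"
proof -
  define n where "n = nat (- gcm K i j)"
  have n: "nat (1 - gcm K i j) = Suc n" "gcm K i j = - int n"
    using gcm_nonpos[OF assms] by (auto simp: n_def)
  let ?z = "(lie (gen_e K i) ^^ Suc n) (gen_e K j)"
  interpret sl2_action "lie (gen_e K i)" "lie (gen_f K i)" "lie (cartan K (simple_coroot K i))"
    by (rule sl2_action_adjoint)
  interpret s: sl2_action "lie (gen_f K i)" "lie (gen_e K i)" "\<lambda>v. - lie (cartan K (simple_coroot K i)) v"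
    by (rule swap)
  have comm: "lie (gen_f K k) ((lie (gen_e K i) ^^ m) x) = (lie (gen_e K i) ^^ m) (lie (gen_f K k) x)"
    if "k \<noteq> i" for k m x
    by (induction m) (use that in \<open>simp_all add: lie_leibniz[of "gen_f K k" "gen_e K i"]
        lie_swap[of "gen_f K k" "gen_e K i"] EF lie_minus_left\<close>)
  have "?z = 0"
  proof (rule killed_by_gen_f_eq_0)
    show "?z \<in> RV (\<lambda>k. unit_vec j k + int (Suc n) * unit_vec i k)"
      by (rule ad_e_funpow_RV[OF gen_e_RV])
    show "(\<lambda>k. unit_vec j k + int (Suc n) * unit_vec i k) \<in> pos_vecs"
      using assms by (auto simp: pos_vecs_def unit_vec_def fun_eq_iff)
    fix k
    consider "k = i" | "k = j" | "k \<noteq> i" "k \<noteq> j" by blast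
    then show "lie (gen_f K k) ?z = 0"
    proof cases
      case 1
      have "lie (gen_f K i) (gen_e K j) = 0"
        using assms by (simp add: lie_swap[of "gen_f K i"] EF)
      \<comment> \<open>In the swapped triple e_j is a highest weight vector of weight n, so the
        factor (n+1)(n-n) in the commutation rule vanishes.\<close>
      moreover have "- lie (cartan K (simple_coroot K i)) (gen_e K j) = of_nat n *\<^sub>C gen_e K j"
        by (simp add: HE pairing n)
      ultimately show ?thesis
        using s.e_f_funpow[of "gen_e K j" "of_nat n" n] 1
        by (simp del: funpow.simps add: clinear_0[OF clinear_funpow[OF clinear_lie]])
    next
      case 2
      have e: "lie (gen_e K i) (cartan K (simple_coroot K j)) = - of_int (gcm K j i) *\<^sub>C gen_e K i"
        by (simp add: lie_swap[of "gen_e K i" "cartan K _"] HE pairing)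
      have "lie (gen_f K k) ?z = (lie (gen_e K i) ^^ Suc n) (lie (gen_f K j) (gen_e K j))"
        unfolding 2 by (rule comm) (use assms in simp)
      also have "lie (gen_f K j) (gen_e K j) = - cartan K (simple_coroot K j)"
        by (simp add: lie_swap[of "gen_f K j"] EF)
      also have "(lie (gen_e K i) ^^ Suc n) (- cartan K (simple_coroot K j)) =
          - (lie (gen_e K i) ^^ n) (lie (gen_e K i) (cartan K (simple_coroot K j)))"
        unfolding funpow_Suc_right o_def
        by (simp add: lie_minus_right clinear_minus[OF clinear_funpow[OF clinear_lie]])
      also have "\<dots> = 0"
      proof (cases n)
        case 0
        \<comment> \<open>Here only a first power of ad e_i meets the coroot; the zero pattern of a
          generalized Cartan matrix is symmetric, which makes that bracket vanish.\<close>
        then have "gcm K j i = 0" using n(2) gcm by (auto simp: generalized_cartan_matrix_def)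
        then show ?thesis using e 0 by simp
      next
        case (Suc m)
        have "lie (gen_e K i) (lie (gen_e K i) (cartan K (simple_coroot K j))) = 0"
          unfolding e by (simp add: lie_scaleC_right lie_self lie_minus_right)
        then show ?thesis
          unfolding Suc funpow_Suc_right by (simp add: clinear_0[OF clinear_funpow[OF clinear_lie]])
      qed
      finally show ?thesis .
    next
      case 3
      have "lie (gen_f K k) ?z = (lie (gen_e K i) ^^ Suc n) (lie (gen_f K k) (gen_e K j))"
        by (rule comm[OF 3(1)])
      also have "lie (gen_f K k) (gen_e K j) = 0"
        using 3(2) by (simp add: lie_swap[of "gen_f K k"] EF)
      finally show ?thesis by (simp only: clinear_0[OF clinear_funpow[OF clinear_lie]])
    qed
  qed
  then show ?thesis by (simp only: n(1))
qed

text \<open>By the Leibniz rule the elements killed by some power of ad e_i form a subalgebra. It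
  contains the e_j by the Serre relations, the Cartan subalgebra with exponent 2 and the f_j with
  exponent 3.\<close>

lemma ad_gen_e_locally_nilpotent: "locally_nilpotent (lie (gen_e K i))"
proof -
  let ?e = "lie (gen_e K i)"
  let ?L = "{x. \<exists>n. (?e ^^ n) x = 0}"
  have zero: "(?e ^^ n) 0 = 0" for n by (simp add: clinear_0[OF clinear_funpow[OF clinear_lie]])
  have later: "(?e ^^ (k + n)) x = 0" "(?e ^^ (n + k)) x = 0" if "(?e ^^ n) x = 0" for n k x
    using that zero[of k] by (simp_all add: funpow_add add.commute[of n k])
  have "?L = UNIV"
  proof (rule generated)
    show "lie_subalgebra ?L"
      unfolding lie_subalgebra_def cvec.subspace_def
    proof (safe, goal_cases)
      case 1
      show ?case by (rule exI[of _ 0]) simp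
    next
      case (2 x y m n)
      then show ?case
        by (intro exI[of _ "m + n"]) (simp add: clinear_add[OF clinear_funpow[OF clinear_lie]] later)
    next
      case (3 c x n)
      then show ?case
        by (intro exI[of _ n]) (simp add: clinear_scale[OF clinear_funpow[OF clinear_lie]])
    next
      case (4 x y m n)
      then show ?case
        by (intro exI[of _ "m + n"] bilinear_funpow_derivation[where B = lie and D = ?e,
              OF lie_0_right lie_0_left clinear_lie lie_leibniz])
    qed
    show "range (gen_e K) \<subseteq> ?L"
    proof safe
      fix j
      show "\<exists>n. (?e ^^ n) (gen_e K j) = 0"
        using serre[of i j] lie_self[of "gen_e K i"] by (cases "i = j") (auto intro: exI[of _ 1])
    qed
    have h: "(?e ^^ 2) (cartan K x) = 0" for x
      by (simp add: numeral_2_eq_2 lie_swap[of "gen_e K i" "cartan K x"] HE lie_minus_right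
          lie_scaleC_right lie_self)
    then show "range (cartan K) \<subseteq> ?L" by blast
    show "range (gen_f K) \<subseteq> ?L"
    proof safe
      fix j
      have "(?e ^^ Suc 2) (gen_f K j) = 0"
        unfolding funpow_Suc_right o_def EF using h zero[of 2] by (cases "i = j") simp_all
      then show "\<exists>n. (?e ^^ n) (gen_f K j) = 0" by blast
    qed
  qed
  then show ?thesis unfolding locally_nilpotent_def by blast
qed

lemma ad_gen_f_locally_nilpotent: "locally_nilpotent (lie (gen_f K i))"
proof -
  interpret op: km "km_opposite K" by (rule km_opposite)
  show ?thesis using op.ad_gen_e_locally_nilpotent[of i] by simp
qed

lemma gen_nonzero: "gen_e K i \<noteq> 0" "gen_f K i \<noteq> 0"
  using EF[of i i] cartan_inj[of "simple_coroot K i"] coroot_nonzero[of i] by auto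

subsection \<open>Subalgebras of finite dimension and matrices of finite type\<close>

definition pair_coroot :: "'i \<Rightarrow> ('i \<Rightarrow> int) \<Rightarrow> int"
  where "pair_coroot i c = (\<Sum>k\<in>UNIV. gcm K i k * c k)"

lemma root_comb_coroot: "root_comb K c (simple_coroot K i) = of_int (pair_coroot i c)"
  by (simp add: root_comb_def pair_coroot_def pairing mult.commute)

lemma pair_coroot_unit_vec: "pair_coroot i (unit_vec j) = gcm K i j"
proof -
  have "pair_coroot i (unit_vec j) = (\<Sum>k\<in>UNIV. if k = j then gcm K i k else 0)"
    unfolding pair_coroot_def by (rule sum.cong) (auto simp: unit_vec_def)
  then show ?thesis by simp
qed

text \<open>x has weight 2n for the i-th triple, while (ad f_i)^n x lies in the Cartan subalgebra
  and is killed by two more applications. Since 2n \<ge> n + 2 exactly when n \<ge> 2, (ad f_i)^(2n)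
  kills x, which is impossible unless x = 0.\<close>

lemma RV_multiple_eq_0:
  assumes x: "x \<in> RV (\<lambda>k. int n * unit_vec i k)" and "n \<ge> 2"
  shows "x = 0"
proof -
  interpret sl2_action "lie (gen_e K i)" "lie (gen_f K i)" "lie (cartan K (simple_coroot K i))"
    by (rule sl2_action_adjoint)
  let ?f = "lie (gen_f K i)"
  have "(?f ^^ n) x \<in> RV (\<lambda>_. 0)"
    using ad_f_funpow_RV[OF x, where i = i and n = n] by simp
  then obtain h where "(?f ^^ n) x = cartan K h" using RV_0 by auto
  then have f2: "(?f ^^ (n + 2)) x = 0"
    by (simp add: numeral_2_eq_2 lie_swap[of "gen_f K i" "cartan K h"] HF
        lie_scaleC_right lie_self lie_minus_right)
  have "(?f ^^ (n - 2 + (n + 2))) x = 0"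
    unfolding funpow_add[of "n - 2"] o_def f2 by (simp only: clinear_0[OF clinear_funpow[OF clinear_lie]])
  moreover have "n - 2 + (n + 2) = 2 * n" using assms(2) by simp
  ultimately have "(?f ^^ (2 * n)) x = 0" by (simp only:)
  moreover have "pair_coroot i (\<lambda>k. int n * unit_vec i k) = int (2 * n)"
  proof -
    have "pair_coroot i (\<lambda>k. int n * unit_vec i k) = int n * pair_coroot i (unit_vec i)"
      unfolding pair_coroot_def sum_distrib_left by (rule sum.cong) (simp_all add: algebra_simps)
    then show ?thesis by (simp add: pair_coroot_unit_vec gcm_diag)
  qed
  then have "lie (cartan K (simple_coroot K i)) x = of_nat (2 * n) *\<^sub>C x"
    using RV_cartan[OF x] by (simp only: root_comb_coroot of_int_of_nat_eq)
  moreover obtain k where "(lie (gen_e K i) ^^ k) x = 0"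
    using ad_gen_e_locally_nilpotent unfolding locally_nilpotent_def by blast
  ultimately show ?thesis by (intro f_funpow_eq_0[of x "2 * n" k])
qed

definition reflect :: "'i \<Rightarrow> ('i \<Rightarrow> int) \<Rightarrow> 'i \<Rightarrow> int"
  where "reflect i c = (\<lambda>k. c k - pair_coroot i c * unit_vec i k)"

lemma pair_coroot_reflect: "pair_coroot i (reflect i c) = - pair_coroot i c"
proof -
  have "pair_coroot i (reflect i c) = pair_coroot i c - pair_coroot i c * pair_coroot i (unit_vec i)"
    unfolding reflect_def pair_coroot_def[of i "\<lambda>k. _ k - _ k"]
    by (simp add: right_diff_distrib sum_subtractf pair_coroot_def sum_distrib_left mult.left_commute)
  then show ?thesis by (simp add: pair_coroot_unit_vec gcm_diag)
qed

lemma reflect_reflect: "reflect i (reflect i c) = c"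
  unfolding reflect_def[of i "reflect i c"] pair_coroot_reflect by (simp add: reflect_def fun_eq_iff)

text \<open>A power of ad f_i or ad e_i, with exponent the absolute value of the pairing, realizes
  the reflection. It is injective by \<open>f_funpow_eq_0\<close> and does not leave L.\<close>

lemma reflect_RV:
  assumes "cvec.subspace L" "\<And>x. x \<in> L \<Longrightarrow> lie (gen_e K i) x \<in> L" "\<And>x. x \<in> L \<Longrightarrow> lie (gen_f K i) x \<in> L"
    and x: "x \<in> RV c" "x \<in> L" "x \<noteq> 0"
  obtains y where "y \<in> RV (reflect i c)" "y \<in> L" "y \<noteq> 0"
proof -
  interpret sl2_action "lie (gen_e K i)" "lie (gen_f K i)" "lie (cartan K (simple_coroot K i))"
    by (rule sl2_action_adjoint)
  interpret s: sl2_action "lie (gen_f K i)" "lie (gen_e K i)" "\<lambda>v. - lie (cartan K (simple_coroot K i)) v"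
    by (rule swap)
  have hx: "lie (cartan K (simple_coroot K i)) x = of_int (pair_coroot i c) *\<^sub>C x"
    using RV_cartan[OF x(1)] by (simp add: root_comb_coroot)
  have L: "(lie (gen_e K i) ^^ n) x \<in> L" "(lie (gen_f K i) ^^ n) x \<in> L" for n
    by (induction n) (simp_all add: assms)
  obtain k l where kl: "(lie (gen_e K i) ^^ k) x = 0" "(lie (gen_f K i) ^^ l) x = 0"
    using ad_gen_e_locally_nilpotent ad_gen_f_locally_nilpotent unfolding locally_nilpotent_def by blast
  show thesis
  proof (cases "pair_coroot i c \<ge> 0")
    case True
    define n where "n = nat (pair_coroot i c)"
    have n: "pair_coroot i c = int n" using True by (simp add: n_def)
    show thesis
    proof (rule that[of "(lie (gen_f K i) ^^ n) x"])
      show "(lie (gen_f K i) ^^ n) x \<in> RV (reflect i c)"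
        using ad_f_funpow_RV[OF x(1)] by (simp add: reflect_def n)
      show "(lie (gen_f K i) ^^ n) x \<noteq> 0"
        using f_funpow_eq_0[of x n k] hx kl(1) x(3) by (auto simp: n)
    qed (rule L)
  next
    case False
    define n where "n = nat (- pair_coroot i c)"
    have n: "pair_coroot i c = - int n" using False by (simp add: n_def)
    show thesis
    proof (rule that[of "(lie (gen_e K i) ^^ n) x"])
      show "(lie (gen_e K i) ^^ n) x \<in> RV (reflect i c)"
        using ad_e_funpow_RV[OF x(1)] by (simp add: reflect_def n)
      show "(lie (gen_e K i) ^^ n) x \<noteq> 0"
        using s.f_funpow_eq_0[of x n l] hx kl(2) x(3) by (auto simp: n)
    qed (rule L)
  qed
qed

text \<open>
  The reflection at \<open>\<alpha>\<^sub>i\<close> permutes the positive roots of \<open>L\<close> other than \<open>\<alpha>\<^sub>i\<close>, so their sum \<open>b\<close>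
  satisfies \<open>A b = 2\<close> on \<open>J\<close>. The required index maximizes the ratio \<open>c i / b i\<close>.
\<close>

lemma finite_type:
  assumes L: "cvec.subspace L" "fin_dim L" "L \<subseteq> root_sum {c. \<forall>i. i \<notin> J \<longrightarrow> c i = 0}"
    and gen: "\<And>j. j \<in> J \<Longrightarrow> gen_e K j \<in> L"
    and stable: "\<And>j x. j \<in> J \<Longrightarrow> x \<in> L \<Longrightarrow> lie (gen_e K j) x \<in> L"
      "\<And>j x. j \<in> J \<Longrightarrow> x \<in> L \<Longrightarrow> lie (gen_f K j) x \<in> L"
    and c: "c \<in> pos_vecs" "\<And>i. i \<notin> J \<Longrightarrow> c i = 0"
  obtains i where "i \<in> J" "c i > 0" "pair_coroot i c > 0"
proof -
  define \<Phi> where "\<Phi> = {c \<in> pos_vecs. \<exists>x\<in>RV c \<inter> L. x \<noteq> 0}"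
  define b where "b i = (\<Sum>c\<in>\<Phi>. c i)" for i
  have fin: "finite \<Phi>"
  proof -
    have "\<forall>c\<in>\<Phi>. \<exists>x. x \<in> RV c \<inter> L \<and> x \<noteq> 0" by (auto simp: \<Phi>_def)
    from bchoice[OF this] obtain x where x: "\<forall>c\<in>\<Phi>. x c \<in> RV c \<inter> L \<and> x c \<noteq> 0" ..
    have inj: "inj_on (root_comb K) \<Phi>" by (auto intro: inj_onI root_comb_inj)
    have "finite (root_comb K ` \<Phi>)"
      by (rule finite_eigenvalues[of "\<lambda>h. lie (cartan K h)", OF clinear_lie L(2),
            of _ "\<lambda>\<mu>. x (inv_into \<Phi> (root_comb K) \<mu>)"])
        (use x inj in \<open>auto simp: RV_eq inv_into_f_f\<close>)
    then show ?thesis using inj finite_imageD by blast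
  qed
  have supp: "d i = 0" if d: "d \<in> \<Phi>" "i \<notin> J" for d i
  proof (rule ccontr)
    assume "d i \<noteq> 0"
    then have "{d} \<inter> {c. \<forall>i. i \<notin> J \<longrightarrow> c i = 0} = {}" using d(2) by auto
    moreover obtain x where "x \<in> RV d" "x \<in> L" "x \<noteq> 0" using d(1) by (auto simp: \<Phi>_def)
    ultimately show False
      using root_sum_disjoint[OF RV_subset_root_sum[of d "{d}"], of x "{c. \<forall>i. i \<notin> J \<longrightarrow> c i = 0}"] L(3)
      by blast
  qed
  have unit: "unit_vec j \<in> \<Phi>" if "j \<in> J" for j
    using that by (auto simp: \<Phi>_def unit_vec_pos intro!: bexI[of _ "gen_e K j"] gen_e_RV gen gen_nonzero(1))
  have b_pos: "b j > 0" if "j \<in> J" for j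
  proof -
    have "b j = unit_vec j j + (\<Sum>c\<in>\<Phi> - {unit_vec j}. c j)"
      unfolding b_def by (rule sum.remove[OF fin unit[OF that]])
    moreover have "(\<Sum>c\<in>\<Phi> - {unit_vec j}. c j) \<ge> 0"
      by (rule sum_nonneg) (auto simp: \<Phi>_def pos_vecs_def)
    ultimately show ?thesis by (simp add: unit_vec_def)
  qed
  have perm: "reflect j d \<in> \<Phi> - {unit_vec j}" if j: "j \<in> J" and d: "d \<in> \<Phi> - {unit_vec j}" for j d
  proof -
    from d obtain x where x: "x \<in> RV d" "x \<in> L" "x \<noteq> 0" by (auto simp: \<Phi>_def)
    \<comment> \<open>Otherwise d is a multiple of \<alpha>_j other than \<alpha>_j itself and so
      not a root. The reflection leaves the coefficient at k unchanged, and one positive coefficient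
      makes a root positive.\<close>
    have "\<exists>k. k \<noteq> j \<and> d k > 0"
    proof (rule ccontr)
      assume "\<not> ?thesis"
      moreover have "d k \<ge> 0" for k using d by (auto simp: \<Phi>_def pos_vecs_def)
      ultimately have "d k = 0" if "k \<noteq> j" for k
        using that by (metis order_antisym not_le)
      then have eq: "d = (\<lambda>k. int (nat (d j)) * unit_vec j k)"
        using d by (auto simp: unit_vec_def fun_eq_iff \<Phi>_def pos_vecs_def)
      have "nat (d j) \<noteq> 0"
      proof
        assume "nat (d j) = 0"
        then have "d = (\<lambda>_. 0)" by (subst eq) simp
        with d show False by (simp add: \<Phi>_def pos_vecs_def)
      qed
      moreover have "nat (d j) \<noteq> 1"
      proof
        assume "nat (d j) = 1"
        then have "d = unit_vec j" by (subst eq) simp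
        with d show False by simp
      qed
      ultimately have "x = 0" using x(1) eq by (intro RV_multiple_eq_0[of x "nat (d j)" j]) auto
      with x(3) show False by simp
    qed
    then obtain k where k: "k \<noteq> j" "d k > 0" by blast
    then have rk: "reflect j d k > 0" by (simp add: reflect_def unit_vec_def)
    obtain y where y: "y \<in> RV (reflect j d)" "y \<in> L" "y \<noteq> 0"
      using reflect_RV[OF L(1) stable(1)[OF j] stable(2)[OF j] x] by metis
    have "\<forall>i. reflect j d i \<ge> 0" using root_sign[OF y(1,3)] rk by (metis linorder_not_le)
    then have "reflect j d \<in> pos_vecs" using rk by (auto simp: pos_vecs_def)
    moreover have "reflect j d \<noteq> unit_vec j" using rk k by (auto simp: unit_vec_def)
    ultimately show ?thesis using y by (auto simp: \<Phi>_def)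
  qed
  have Ab: "pair_coroot j b = 2" if j: "j \<in> J" for j
  proof -
    let ?S = "\<Phi> - {unit_vec j}"
    \<comment> \<open>The coordinate at j drops by exactly the pairing, so the permutation of the
      roots forces the pairings to add up to 0. Only the root \<alpha>_j then contributes to the
      pairing of b, namely 2.\<close>
    have "(\<Sum>d\<in>?S. d j) = (\<Sum>d\<in>?S. reflect j d j)"
      by (rule sum.reindex_bij_witness[of _ "reflect j" "reflect j"])
        (use perm[OF j] in \<open>auto simp: reflect_reflect\<close>)
    then have "(\<Sum>d\<in>?S. pair_coroot j d) = 0"
      by (simp add: reflect_def sum_subtractf unit_vec_def)
    moreover have "pair_coroot j b = (\<Sum>d\<in>\<Phi>. pair_coroot j d)"
      unfolding pair_coroot_def b_def sum_distrib_left by (rule sum.swap)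
    ultimately show ?thesis
      by (simp add: sum.remove[OF fin unit[OF j]] pair_coroot_unit_vec gcm_diag)
  qed
  let ?r = "\<lambda>i. of_int (c i) / of_int (b i) :: real"
  obtain i0 where i0: "c i0 > 0" using c(1) by (force simp: pos_vecs_def fun_eq_iff le_less)
  then have i0J: "i0 \<in> J" using c(2) by force
  have "Max (?r ` J) \<in> ?r ` J" using i0J by (intro Max_in) auto
  then obtain i where i: "i \<in> J" "?r i = Max (?r ` J)" by auto
  have max: "?r k \<le> ?r i" if "k \<in> J" for k
    unfolding i(2) by (rule Max_ge) (use that in auto)
  have "0 < ?r i" using max[OF i0J] i0 b_pos[OF i0J] by (smt (verit) divide_pos_pos of_int_0_less_iff)
  then have ci: "c i > 0" using b_pos[OF i(1)] by (simp add: zero_less_divide_iff)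
  \<comment> \<open>Maximality of the ratio at i, with denominators cleared, says u \<ge> 0;
    moreover u i = 0. Off-diagonal entries being non-positive, u has pairing at most 0 with the i-th
    coroot, that is, b i times the pairing of c is at least 2 c i.\<close>
  define u where "u k = c i * b k - b i * c k" for k
  have u_nonneg: "u k \<ge> 0" for k
  proof (cases "k \<in> J")
    case True
    have "of_int (c k) * of_int (b i) \<le> (of_int (c i) * of_int (b k) :: real)"
      using max[OF True] b_pos[OF True] b_pos[OF i(1)] by (simp add: field_simps)
    then have "c k * b i \<le> c i * b k" by (metis of_int_le_iff of_int_mult)
    then show ?thesis by (simp add: u_def mult.commute)
  next
    case False
    then have "b k = 0" unfolding b_def by (intro sum.neutral) (use supp in blast)
    then show ?thesis using False c(2) by (simp add: u_def)
  qed
  have "pair_coroot i u \<le> 0"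
    unfolding pair_coroot_def
  proof (rule sum_nonpos)
    fix k
    show "gcm K i k * u k \<le> 0"
    proof (cases "k = i")
      case False
      then show ?thesis using gcm_nonpos[of i k] u_nonneg[of k] by (simp add: mult_nonpos_nonneg)
    qed (simp add: u_def mult.commute)
  qed
  moreover have "pair_coroot i u = c i * pair_coroot i b - b i * pair_coroot i c"
    unfolding pair_coroot_def u_def
    by (simp add: right_diff_distrib sum_subtractf sum_distrib_left mult.left_commute)
  ultimately have "b i * pair_coroot i c > 0" using ci Ab[OF i(1)] by simp
  then have "pair_coroot i c > 0" using b_pos[OF i(1)] by (simp add: zero_less_mult_iff)
  with i(1) ci that show thesis by blast
qed

end

section \<open>Modules induced from a subalgebra with a complementary subalgebra\<close>

lemma poly_mapping_eq_sum_single: "F = (\<Sum>k\<in>Poly_Mapping.keys F. Poly_Mapping.single k (Poly_Mapping.lookup F k))"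
  by (rule poly_mapping_eqI)
    (simp add: lookup_sum lookup_single when_def if_distrib in_keys_iff cong: if_cong)

lemma additive_eq_on_single:
  fixes f g :: "('k \<Rightarrow>\<^sub>0 'v::comm_monoid_add) \<Rightarrow> 'w::cancel_comm_monoid_add"
  assumes "\<And>x y. f (x + y) = f x + f y" "\<And>x y. g (x + y) = g x + g y"
    and "\<And>k v. f (Poly_Mapping.single k v) = g (Poly_Mapping.single k v)"
  shows "f F = g F"
proof -
  have "f 0 = 0" "g 0 = 0" using assms(1,2)[of 0 0] by simp_all
  then have "f (sum h A) = (\<Sum>a\<in>A. f (h a))" "g (sum h A) = (\<Sum>a\<in>A. g (h a))"
    for h :: "'k \<Rightarrow> _" and A
    by (induction A rule: infinite_finite_induct) (simp_all add: assms(1,2))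
  then show ?thesis
    by (subst (1 2) poly_mapping_eq_sum_single) (simp add: assms(3))
qed

text \<open>The universal property of a direct sum of copies of one space: every map out of the free
  constructions below is defined on monomials and extended this way.\<close>

definition linext :: "('k \<Rightarrow> 'v::zero \<Rightarrow> 'w::comm_monoid_add) \<Rightarrow> ('k \<Rightarrow>\<^sub>0 'v) \<Rightarrow> 'w"
  where "linext g F = (\<Sum>k\<in>Poly_Mapping.keys F. g k (Poly_Mapping.lookup F k))"

lemma linext_single: "g k 0 = 0 \<Longrightarrow> linext g (Poly_Mapping.single k v) = g k v"
  by (cases "v = 0") (simp_all add: linext_def)

lemma linext_superset:
  assumes "\<And>k. g k 0 = 0" "finite A" "Poly_Mapping.keys F \<subseteq> A"
  shows "linext g F = (\<Sum>k\<in>A. g k (Poly_Mapping.lookup F k))"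
  unfolding linext_def
  by (rule sum.mono_neutral_left) (use assms in \<open>auto simp: in_keys_iff\<close>)

lemma linext_add:
  fixes g :: "'k \<Rightarrow> 'v::comm_monoid_add \<Rightarrow> 'w::cancel_comm_monoid_add"
  assumes "\<And>k x y. g k (x + y) = g k x + g k y"
  shows "linext g (F + G) = linext g F + linext g G"
proof -
  have 0: "g k 0 = 0" for k using assms[of k 0 0] by simp
  let ?A = "Poly_Mapping.keys F \<union> Poly_Mapping.keys G"
  have "linext g H = (\<Sum>k\<in>?A. g k (Poly_Mapping.lookup H k))" if "H \<in> {F, G, F + G}" for H
    by (rule linext_superset[of g, OF 0]) (use that keys_add[of F G] in auto)
  then show ?thesis by (simp add: lookup_add assms sum.distrib)
qed

lemma clinear_linext:
  assumes "\<And>k. clinear (g k)"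
  shows "clinear (linext g)"
  unfolding clinear_iff
proof (intro conjI allI)
  show "linext g (F + G) = linext g F + linext g G" for F G
    by (rule linext_add) (rule clinear_add[OF assms])
  show "linext g (c *\<^sub>C F) = c *\<^sub>C linext g F" for c F
  proof -
    have "linext g (c *\<^sub>C F) = (\<Sum>k\<in>Poly_Mapping.keys F. g k (Poly_Mapping.lookup (c *\<^sub>C F) k))"
      by (rule linext_superset) (auto simp: clinear_0[OF assms] in_keys_iff lookup_scaleC)
    then show ?thesis
      by (simp add: lookup_scaleC clinear_scale[OF assms] linext_def cvec.scale_sum_right)
  qed
qed

lemma clinear_linext_single:
  "(\<And>k. clinear (g k)) \<Longrightarrow> linext g (Poly_Mapping.single k v) = g k v"
  by (rule linext_single) (rule clinear_0)

lemma clinear_eq_on_single: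
  assumes "clinear f" "clinear g"
    and "\<And>k v. f (Poly_Mapping.single k v) = g (Poly_Mapping.single k v)"
  shows "f F = g F"
  by (rule additive_eq_on_single) (simp_all add: clinear_add[OF assms(1)] clinear_add[OF assms(2)] assms(3))

lemma clinear_compose: "clinear f \<Longrightarrow> clinear g \<Longrightarrow> clinear (\<lambda>x. f (g x))"
  by (simp add: clinear_iff)

lemma clinear_plus: "clinear f \<Longrightarrow> clinear g \<Longrightarrow> clinear (\<lambda>x. f x + g x)"
  by (simp add: clinear_iff scaleC_add_right add_ac)

lemma clinear_id: "clinear (\<lambda>x. x)"
  by (simp add: clinear_iff)

lemma clinear_scaled: "clinear f \<Longrightarrow> clinear (\<lambda>x. c *\<^sub>C f x)"
  by (simp add: clinear_iff scaleC_add_right scaleC_scaleC mult.commute)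

text \<open>An element of \<open>'g list \<Rightarrow>\<^sub>0 'm\<close> is a tensor in the tensor product of the tensor algebra on the
  set \<open>'g\<close> with \<open>'m\<close>.\<close>

definition lmul :: "'g \<Rightarrow> ('g list \<Rightarrow>\<^sub>0 'm::complex_vector) \<Rightarrow> ('g list \<Rightarrow>\<^sub>0 'm)"
  where "lmul y = linext (\<lambda>w. Poly_Mapping.single (y # w))"

lemma clinear_lmul: "clinear (lmul y)"
  unfolding lmul_def by (rule clinear_linext) (rule clinear_single)

lemma lmul_single: "lmul y (Poly_Mapping.single w m) = Poly_Mapping.single (y # w) m"
  unfolding lmul_def by (rule clinear_linext_single) (rule clinear_single)

locale split_lie_algebra =
  fixes a p :: "'g::complex_lie_algebra set" and actM :: "'g \<Rightarrow> 'm::complex_vector \<Rightarrow> 'm"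
  assumes a_subalgebra: "lie_subalgebra a" and p_subalgebra: "lie_subalgebra p"
    and split_sum: "\<exists>y\<in>a. x - y \<in> p" and split_Int: "x \<in> a \<Longrightarrow> x \<in> p \<Longrightarrow> x = 0"
    and M: "lie_module p actM"
begin

lemmas subspace_a = lie_subalgebraD(1)[OF a_subalgebra]
  and lie_a = lie_subalgebraD(2)[OF a_subalgebra]
  and subspace_p = lie_subalgebraD(1)[OF p_subalgebra]
  and lie_p = lie_subalgebraD(2)[OF p_subalgebra]

text \<open>\<open>pa\<close> and \<open>pp\<close> are the projections onto the two summands; the
  choice is unique by \<open>pa_eqI\<close>.\<close>

definition pa :: "'g \<Rightarrow> 'g"
  where "pa x = (SOME y. y \<in> a \<and> x - y \<in> p)"

definition pp :: "'g \<Rightarrow> 'g"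
  where "pp x = x - pa x"

lemma pa_in: "pa x \<in> a" and pp_in: "pp x \<in> p"
  unfolding pp_def pa_def using someI_ex[of "\<lambda>y. y \<in> a \<and> x - y \<in> p"] split_sum[of x] by blast+

lemma pa_eqI: "y \<in> a \<Longrightarrow> x - y \<in> p \<Longrightarrow> pa x = y"
  using split_Int[of "pa x - y"] cvec.subspace_diff[OF subspace_a pa_in[of x], of y]
    cvec.subspace_diff[OF subspace_p _ pp_in[of x], of "x - y"]
  by (simp add: pp_def)

lemma clinear_pa: "clinear pa"
  unfolding clinear_iff
proof (intro conjI allI)
  fix x y c
  have "(x + y) - (pa x + pa y) = pp x + pp y" by (simp add: pp_def)
  then show "pa (x + y) = pa x + pa y"
    by (intro pa_eqI) (simp_all add: pa_in pp_in cvec.subspace_add subspace_a subspace_p)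
  have "c *\<^sub>C x - c *\<^sub>C pa x = c *\<^sub>C pp x" by (simp add: pp_def cvec.scale_right_diff_distrib)
  then show "pa (c *\<^sub>C x) = c *\<^sub>C pa x"
    by (intro pa_eqI) (simp_all add: pa_in pp_in cvec.subspace_scale subspace_a subspace_p)
qed

lemma clinear_pp: "clinear pp"
  using clinear_pa by (simp add: clinear_iff pp_def cvec.scale_right_diff_distrib)

lemma pa_a: "y \<in> a \<Longrightarrow> pa y = y"
  by (rule pa_eqI) (simp_all add: cvec.subspace_0[OF subspace_p])

lemma pa_p: "q \<in> p \<Longrightarrow> pa q = 0"
  by (rule pa_eqI) (simp_all add: cvec.subspace_0[OF subspace_a])

lemmas M_linear = lie_module_linear[OF M]
  and M_clinear = action_clinear[OF lie_module_linear[OF M]]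

lemma actM_0: "actM 0 m = 0"
  using action_scale[OF M_linear cvec.subspace_0[OF subspace_p], of 0] by simp

text \<open>On the empty word the a-part of x becomes a letter and the p-part acts on m. The result
  is linear in m, but in x only modulo \<open>rels\<close>, since the letters x, x' and x + x' are
  unrelated in the free space.\<close>

primrec word_act :: "'g list \<Rightarrow> 'g \<Rightarrow> 'm \<Rightarrow> ('g list \<Rightarrow>\<^sub>0 'm)" where
  "word_act [] x m = Poly_Mapping.single [pa x] m + Poly_Mapping.single [] (actM (pp x) m)"
| "word_act (y # w) x m = lmul y (word_act w x m) + word_act w (lie x y) m"

lemma clinear_word_act: "clinear (word_act w x)"
proof (induction w arbitrary: x)
  case Nil
  show ?case unfolding word_act.simps[abs_def]
    by (intro clinear_plus clinear_single clinear_compose[OF clinear_single M_clinear[OF pp_in]])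
next
  case (Cons y w)
  then show ?case unfolding word_act.simps[abs_def]
    by (intro clinear_plus clinear_compose[OF clinear_lmul])
qed

definition actF :: "'g \<Rightarrow> ('g list \<Rightarrow>\<^sub>0 'm) \<Rightarrow> ('g list \<Rightarrow>\<^sub>0 'm)"
  where "actF x = linext (\<lambda>w. word_act w x)"

abbreviation unitF :: "'m \<Rightarrow> ('g list \<Rightarrow>\<^sub>0 'm)"
  where "unitF \<equiv> Poly_Mapping.single []"

lemma clinear_actF: "clinear (actF x)"
  unfolding actF_def by (rule clinear_linext) (rule clinear_word_act)

lemma actF_single: "actF x (Poly_Mapping.single w m) = word_act w x m"
  unfolding actF_def by (rule clinear_linext_single) (rule clinear_word_act)

lemma actF_unitF: "actF x (unitF m) = lmul (pa x) (unitF m) + unitF (actM (pp x) m)"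
  by (simp add: actF_single lmul_single)

lemma actF_lmul: "actF x (lmul y s) = lmul y (actF x s) + actF (lie x y) s"
  by (rule clinear_eq_on_single[of "\<lambda>s. actF x (lmul y s)"
        "\<lambda>s. lmul y (actF x s) + actF (lie x y) s"])
    (auto intro!: clinear_plus clinear_compose[OF clinear_actF] clinear_compose[OF clinear_lmul]
      clinear_actF clinear_lmul simp: lmul_single actF_single)

definition Fa :: "('g list \<Rightarrow>\<^sub>0 'm) set"
  where "Fa = cvec.span {Poly_Mapping.single w m |w m. set w \<subseteq> a}"

lemma subspace_Fa: "cvec.subspace Fa"
  by (simp add: Fa_def)

lemma single_Fa: "set w \<subseteq> a \<Longrightarrow> Poly_Mapping.single w m \<in> Fa"
  unfolding Fa_def by (rule cvec.span_base) blast

lemma lmul_Fa: "y \<in> a \<Longrightarrow> s \<in> Fa \<Longrightarrow> lmul y s \<in> Fa"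
  by (rule clinear_span_subset[OF clinear_lmul subspace_Fa,
        of "{Poly_Mapping.single w m |w m. set w \<subseteq> a}"])
    (force simp: lmul_single intro!: single_Fa, simp add: Fa_def)

lemma Fa_induct [consumes 1, case_names zero add unit lmul]:
  assumes "s \<in> Fa" "P 0" "\<And>s t. P s \<Longrightarrow> P t \<Longrightarrow> P (s + t)" "\<And>m. P (unitF m)"
    and "\<And>y s. y \<in> a \<Longrightarrow> s \<in> Fa \<Longrightarrow> P s \<Longrightarrow> P (lmul y s)"
  shows "P s"
  using assms(1) unfolding Fa_def
proof (induction rule: cvec.span_induct_alt)
  case base
  show ?case by fact
next
  case (step c x y)
  then obtain w m where x: "x = Poly_Mapping.single w m" "set w \<subseteq> a" by blast
  have "P (Poly_Mapping.single w m)" for m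
    using x(2)
  proof (induction w)
    case Nil
    show ?case by fact
  next
    case (Cons y w)
    then show ?case using assms(5)[of y "Poly_Mapping.single w m"] single_Fa by (simp add: lmul_single)
  qed
  then have "P (c *\<^sub>C x)" unfolding x(1) by (metis clinear_scale[OF clinear_single])
  then show ?case using step assms(3) by blast
qed

text \<open>Modulo \<open>rels\<close>, the span \<open>Fa\<close> of the words in \<open>a\<close> becomes \<open>U(a) \<otimes> M\<close>.\<close>

inductive_set rels :: "('g list \<Rightarrow>\<^sub>0 'm) set" where
  zero: "0 \<in> rels"
| add: "r \<in> rels \<Longrightarrow> r' \<in> rels \<Longrightarrow> r + r' \<in> rels"
| scale: "r \<in> rels \<Longrightarrow> c *\<^sub>C r \<in> rels"
| lmul: "y \<in> a \<Longrightarrow> r \<in> rels \<Longrightarrow> lmul y r \<in> rels"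
| gen_add: "y \<in> a \<Longrightarrow> y' \<in> a \<Longrightarrow> s \<in> Fa \<Longrightarrow> lmul (y + y') s - lmul y s - lmul y' s \<in> rels"
| gen_scale: "y \<in> a \<Longrightarrow> s \<in> Fa \<Longrightarrow> lmul (c *\<^sub>C y) s - c *\<^sub>C lmul y s \<in> rels"
| gen_lie: "y \<in> a \<Longrightarrow> y' \<in> a \<Longrightarrow> s \<in> Fa \<Longrightarrow>
    lmul y (lmul y' s) - lmul y' (lmul y s) - lmul (lie y y') s \<in> rels"

lemma subspace_rels: "cvec.subspace rels"
  unfolding cvec.subspace_def by (blast intro: rels.zero rels.add rels.scale)

definition eqr :: "('g list \<Rightarrow>\<^sub>0 'm) \<Rightarrow> ('g list \<Rightarrow>\<^sub>0 'm) \<Rightarrow> bool"  (infix \<open>\<doteq>\<close> 50)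
  where "s \<doteq> t \<longleftrightarrow> s - t \<in> rels"

lemma eqr_refl [simp, intro]: "s \<doteq> s"
  by (simp add: eqr_def rels.zero)

lemma eqr_sym: "s \<doteq> t \<Longrightarrow> t \<doteq> s"
  unfolding eqr_def using cvec.subspace_neg[OF subspace_rels, of "s - t"] by simp

lemma eqr_trans [trans]: "s \<doteq> t \<Longrightarrow> t \<doteq> u \<Longrightarrow> s \<doteq> u"
  unfolding eqr_def using cvec.subspace_add[OF subspace_rels, of "s - t" "t - u"] by simp

lemma eqr_add: "s \<doteq> t \<Longrightarrow> s' \<doteq> t' \<Longrightarrow> s + s' \<doteq> t + t'"
  unfolding eqr_def using cvec.subspace_add[OF subspace_rels, of "s - t" "s' - t'"]
  by (simp add: algebra_simps)

lemma eqr_diff: "s \<doteq> t \<Longrightarrow> s' \<doteq> t' \<Longrightarrow> s - s' \<doteq> t - t'"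
  unfolding eqr_def using cvec.subspace_diff[OF subspace_rels, of "s - t" "s' - t'"]
  by (simp add: algebra_simps)

lemma eqr_lmul: "y \<in> a \<Longrightarrow> s \<doteq> t \<Longrightarrow> lmul y s \<doteq> lmul y t"
  unfolding eqr_def using rels.lmul[of y "s - t"] by (simp add: clinear_diff[OF clinear_lmul])

lemma lmul_add_left: "y \<in> a \<Longrightarrow> y' \<in> a \<Longrightarrow> s \<in> Fa \<Longrightarrow> lmul (y + y') s \<doteq> lmul y s + lmul y' s"
  unfolding eqr_def using rels.gen_add[of y y' s] by (simp add: algebra_simps)

lemma lmul_scale_left: "y \<in> a \<Longrightarrow> s \<in> Fa \<Longrightarrow> lmul (c *\<^sub>C y) s \<doteq> c *\<^sub>C lmul y s"
  unfolding eqr_def by (rule rels.gen_scale)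

lemma lmul_lie_left:
  "y \<in> a \<Longrightarrow> y' \<in> a \<Longrightarrow> s \<in> Fa \<Longrightarrow> lmul y (lmul y' s) - lmul y' (lmul y s) \<doteq> lmul (lie y y') s"
  unfolding eqr_def by (rule rels.gen_lie)

lemma lmul_0_left: "s \<in> Fa \<Longrightarrow> lmul 0 s \<doteq> 0"
  using lmul_scale_left[of 0 s 0] cvec.subspace_0[OF subspace_a] by simp

lemma unitF_Fa: "unitF m \<in> Fa"
  by (rule single_Fa) simp

lemma actF_Fa: "s \<in> Fa \<Longrightarrow> actF x s \<in> Fa"
proof (induction arbitrary: x rule: Fa_induct)
  case zero
  then show ?case by (simp add: clinear_0[OF clinear_actF] cvec.subspace_0[OF subspace_Fa])
next
  case (add s t)
  then show ?case by (simp add: clinear_add[OF clinear_actF] cvec.subspace_add[OF subspace_Fa])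
next
  case (unit m)
  then show ?case
    by (simp add: actF_unitF cvec.subspace_add[OF subspace_Fa] lmul_Fa[OF pa_in] unitF_Fa)
next
  case (lmul y s)
  then show ?case by (simp add: actF_lmul cvec.subspace_add[OF subspace_Fa] lmul_Fa)
qed

lemma actF_add_left: "s \<in> Fa \<Longrightarrow> actF (x + x') s \<doteq> actF x s + actF x' s"
proof (induction arbitrary: x x' rule: Fa_induct)
  case zero
  then show ?case by (simp add: clinear_0[OF clinear_actF])
next
  case (add s t)
  then show ?case
    using eqr_add[OF add(1)[of x x'] add(2)[of x x']]
    by (simp add: clinear_add[OF clinear_actF] add_ac)
next
  case (unit m)
  have "lmul (pa x + pa x') (unitF m) + unitF (actM (pp x + pp x') m) \<doteq>
    (lmul (pa x) (unitF m) + lmul (pa x') (unitF m)) + unitF (actM (pp x) m + actM (pp x') m)"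
    by (intro eqr_add lmul_add_left) (simp_all add: pa_in unitF_Fa action_add[OF M_linear] pp_in)
  then show ?case
    by (simp add: actF_unitF clinear_add[OF clinear_pa] clinear_add[OF clinear_pp] single_add add_ac)
next
  case (lmul y s)
  have "lmul y (actF (x + x') s) + actF (lie x y + lie x' y) s \<doteq>
    lmul y (actF x s + actF x' s) + (actF (lie x y) s + actF (lie x' y) s)"
    by (intro eqr_add eqr_lmul lmul)
  then show ?case by (simp add: actF_lmul lie_add_left clinear_add[OF clinear_lmul] add_ac)
qed

lemma actF_scale_left: "s \<in> Fa \<Longrightarrow> actF (c *\<^sub>C x) s \<doteq> c *\<^sub>C actF x s"
proof (induction arbitrary: x rule: Fa_induct)
  case zero
  then show ?case by (simp add: clinear_0[OF clinear_actF])
next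
  case (add s t)
  then show ?case
    using eqr_add[OF add(1)[of x] add(2)[of x]]
    by (simp add: clinear_add[OF clinear_actF] scaleC_add_right)
next
  case (unit m)
  have "lmul (c *\<^sub>C pa x) (unitF m) + unitF (actM (c *\<^sub>C pp x) m) \<doteq>
    c *\<^sub>C lmul (pa x) (unitF m) + c *\<^sub>C unitF (actM (pp x) m)"
    by (intro eqr_add lmul_scale_left)
      (simp_all add: pa_in unitF_Fa action_scale[OF M_linear] pp_in clinear_scale[OF clinear_single])
  then show ?case
    by (simp add: actF_unitF clinear_scale[OF clinear_pa] clinear_scale[OF clinear_pp] scaleC_add_right)
next
  case (lmul y s)
  have "lmul y (actF (c *\<^sub>C x) s) + actF (c *\<^sub>C lie x y) s \<doteq>
    lmul y (c *\<^sub>C actF x s) + c *\<^sub>C actF (lie x y) s"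
    by (intro eqr_add eqr_lmul lmul)
  then show ?case
    by (simp add: actF_lmul lie_scaleC_left clinear_scale[OF clinear_lmul] scaleC_add_right)
qed

lemma actF_diff_left: "s \<in> Fa \<Longrightarrow> actF (x - x') s \<doteq> actF x s - actF x' s"
  using eqr_trans[OF actF_add_left[of s x "(- 1) *\<^sub>C x'"] eqr_add[OF eqr_refl actF_scale_left]]
  by (simp add: cvec.scale_minus_left scaleC_one)

text \<open>Moving y past a letter z costs the term [y, z], which the Lie relation in
  \<open>rels\<close> pays back.\<close>

lemma actF_a: "s \<in> Fa \<Longrightarrow> y \<in> a \<Longrightarrow> actF y s \<doteq> lmul y s"
proof (induction arbitrary: y rule: Fa_induct)
  case zero
  then show ?case by (simp add: clinear_0[OF clinear_actF] clinear_0[OF clinear_lmul])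
next
  case (add s t)
  then show ?case
    using eqr_add[OF add(1)[of y] add(2)[of y]]
    by (simp add: clinear_add[OF clinear_actF] clinear_add[OF clinear_lmul])
next
  case (unit m)
  then show ?case by (simp add: actF_unitF pa_a pp_def actM_0)
next
  case (lmul z s)
  have "lmul z (actF y s) + actF (lie y z) s \<doteq> lmul z (lmul y s) + lmul (lie y z) s"
    by (intro eqr_add eqr_lmul lmul lie_a)
  also have "\<dots> \<doteq> lmul z (lmul y s) + (lmul y (lmul z s) - lmul z (lmul y s))"
    by (intro eqr_add eqr_refl eqr_sym[OF lmul_lie_left] lmul)
  finally show ?case by (simp add: actF_lmul)
qed

text \<open>The action descends to the quotient. For the Lie relation the Jacobi identity rewrites
  [x, [y, y']] as [[x, y], y'] - [[x, y'], y].\<close>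

lemma actF_rels: "r \<in> rels \<Longrightarrow> actF x r \<in> rels"
proof (induction arbitrary: x rule: rels.induct)
  case zero
  then show ?case by (simp add: clinear_0[OF clinear_actF] rels.zero)
next
  case (add r r')
  then show ?case by (simp add: clinear_add[OF clinear_actF] rels.add)
next
  case (scale r c)
  then show ?case by (simp add: clinear_scale[OF clinear_actF] rels.scale)
next
  case (lmul y r)
  then show ?case by (simp add: actF_lmul rels.add rels.lmul)
next
  case (gen_add y y' s)
  have "lmul (y + y') (actF x s) + actF (lie x y + lie x y') s \<doteq>
    (lmul y (actF x s) + lmul y' (actF x s)) + (actF (lie x y) s + actF (lie x y') s)"
    by (intro eqr_add lmul_add_left actF_add_left actF_Fa gen_add)
  then show ?case
    by (simp add: eqr_def clinear_diff[OF clinear_actF] clinear_add[OF clinear_actF] actF_lmul lie_add_right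
        algebra_simps)
next
  case (gen_scale y s c)
  have "lmul (c *\<^sub>C y) (actF x s) + actF (c *\<^sub>C lie x y) s \<doteq>
    c *\<^sub>C lmul y (actF x s) + c *\<^sub>C actF (lie x y) s"
    by (intro eqr_add lmul_scale_left actF_scale_left actF_Fa gen_scale)
  then show ?case
    by (simp add: eqr_def clinear_diff[OF clinear_actF] clinear_scale[OF clinear_actF] actF_lmul
        lie_scaleC_right scaleC_add_right)
next
  case (gen_lie y y' s)
  have jac: "lie x (lie y y') = lie (lie x y) y' - lie (lie x y') y"
    by (simp add: lie_leibniz[of x y y'] lie_swap[of "lie x y'" y])
  have "actF x (lmul y (lmul y' s) - lmul y' (lmul y s)) =
    (lmul y (lmul y' (actF x s)) - lmul y' (lmul y (actF x s))) +
      (actF (lie (lie x y) y') s - actF (lie (lie x y') y) s)"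
    by (simp add: clinear_diff[OF clinear_actF] actF_lmul clinear_add[OF clinear_lmul])
  also have "\<dots> \<doteq> lmul (lie y y') (actF x s) + actF (lie (lie x y) y' - lie (lie x y') y) s"
    by (intro eqr_add lmul_lie_left eqr_sym[OF actF_diff_left] actF_Fa gen_lie)
  also have "\<dots> = actF x (lmul (lie y y') s)" by (simp add: actF_lmul jac)
  finally show ?case by (simp add: eqr_def clinear_diff[OF clinear_actF])
qed

text \<open>Past a letter the claim follows from the Jacobi identity and the induction hypothesis
  for three pairs. The substance is the empty word: there x and x' are split, the bracket of the
  a-parts acts by the Lie relation, that of the p-parts because M is a p-module, and the mixed terms
  are already brackets.\<close>

lemma actF_lie:
  "s \<in> Fa \<Longrightarrow> actF x (actF x' s) - actF x' (actF x s) \<doteq> actF (lie x x') s"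
proof (induction arbitrary: x x' rule: Fa_induct)
  case zero
  then show ?case by (simp add: clinear_0[OF clinear_actF])
next
  case (add s t)
  then show ?case
    using eqr_add[OF add(1)[of x x'] add(2)[of x x']]
    by (simp add: clinear_add[OF clinear_actF] algebra_simps)
next
  case (unit m)
  let ?y = "pa x" and ?y' = "pa x'" and ?q = "pp x" and ?q' = "pp x'" and ?s = "unitF m"
  have x: "x = ?y + ?q" "x' = ?y' + ?q'" by (simp_all add: pp_def)
  have 1: "actF z (actF z' ?s) = lmul (pa z') (lmul (pa z) ?s) + lmul (pa z') (unitF (actM (pp z) m))
      + actF (lie z (pa z')) ?s + lmul (pa z) (unitF (actM (pp z') m)) + unitF (actM (pp z) (actM (pp z') m))"
    for z z'
    by (subst actF_unitF[of z']) (simp add: clinear_add[OF clinear_actF] actF_lmul actF_unitF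
        clinear_add[OF clinear_lmul] add_ac)
  have "actF x (actF x' ?s) - actF x' (actF x ?s) =
      ((lmul ?y' (lmul ?y ?s) - lmul ?y (lmul ?y' ?s)) + (actF (lie x ?y') ?s - actF (lie x' ?y) ?s))
      + unitF (actM (lie ?q ?q') m)"
    unfolding 1 lie_module_lie[OF M pp_in pp_in]
    by (simp add: clinear_diff[OF clinear_single] algebra_simps)
  also have "\<dots> \<doteq> (actF (lie ?y' ?y) ?s + actF (lie x ?y' - lie x' ?y) ?s) + actF (lie ?q ?q') ?s"
  proof (intro eqr_add)
    show "lmul ?y' (lmul ?y ?s) - lmul ?y (lmul ?y' ?s) \<doteq> actF (lie ?y' ?y) ?s"
      by (rule eqr_trans[OF lmul_lie_left eqr_sym[OF actF_a]]) (simp_all add: pa_in unitF_Fa lie_a)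
    show "actF (lie x ?y') ?s - actF (lie x' ?y) ?s \<doteq> actF (lie x ?y' - lie x' ?y) ?s"
      by (intro eqr_sym[OF actF_diff_left] unitF_Fa)
    show "unitF (actM (lie ?q ?q') m) \<doteq> actF (lie ?q ?q') ?s"
      using eqr_sym[OF eqr_add[OF lmul_0_left[OF unitF_Fa[of m]] eqr_refl[of "unitF (actM (lie ?q ?q') m)"]]]
      by (simp add: actF_unitF pp_def pa_p lie_p[OF pp_in pp_in, unfolded pp_def])
  qed
  also have "\<dots> \<doteq> actF ((lie ?y' ?y + (lie x ?y' - lie x' ?y)) + lie ?q ?q') ?s"
  proof (rule eqr_sym)
    have "actF ((lie ?y' ?y + (lie x ?y' - lie x' ?y)) + lie ?q ?q') ?s \<doteq>
        actF (lie ?y' ?y + (lie x ?y' - lie x' ?y)) ?s + actF (lie ?q ?q') ?s"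
      by (rule actF_add_left[OF unitF_Fa])
    also have "\<dots> \<doteq> (actF (lie ?y' ?y) ?s + actF (lie x ?y' - lie x' ?y) ?s) + actF (lie ?q ?q') ?s"
      by (rule eqr_add[OF actF_add_left[OF unitF_Fa] eqr_refl])
    finally show "actF ((lie ?y' ?y + (lie x ?y' - lie x' ?y)) + lie ?q ?q') ?s \<doteq>
      (actF (lie ?y' ?y) ?s + actF (lie x ?y' - lie x' ?y) ?s) + actF (lie ?q ?q') ?s" .
  qed
  also have "(lie ?y' ?y + (lie x ?y' - lie x' ?y)) + lie ?q ?q' = lie x x'"
  proof -
    have "lie x x' = lie x ?y' + lie ?y ?q' + lie ?q ?q'"
      using arg_cong[OF x(2), of "lie x"] arg_cong[OF x(1), of "\<lambda>z. lie z ?q'"]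
      by (simp add: lie_add_right lie_add_left add.assoc)
    moreover have "lie x' ?y = - lie ?y ?y' - lie ?y ?q'"
      using arg_cong[OF x(2), of "lie ?y"] by (simp add: lie_add_right lie_swap[of x' ?y])
    ultimately show ?thesis by (simp add: lie_swap[of ?y' ?y])
  qed
  finally show ?case .
next
  case (lmul y s)
  have exp: "actF z (actF z' (lmul y s)) = lmul y (actF z (actF z' s)) + actF (lie z y) (actF z' s)
      + actF z (actF (lie z' y) s)" for z z'
    by (simp add: actF_lmul clinear_add[OF clinear_actF])
  have jac: "lie (lie x x') y = lie x (lie x' y) - lie x' (lie x y)" by (rule lie_lie)
  have "actF x (actF x' (lmul y s)) - actF x' (actF x (lmul y s)) =
      lmul y (actF x (actF x' s) - actF x' (actF x s)) +
      ((actF x (actF (lie x' y) s) - actF (lie x' y) (actF x s))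
       - (actF x' (actF (lie x y) s) - actF (lie x y) (actF x' s)))"
    unfolding exp by (simp add: clinear_diff[OF clinear_lmul] algebra_simps)
  moreover have "lmul y (actF x (actF x' s) - actF x' (actF x s)) \<doteq> lmul y (actF (lie x x') s)"
    by (rule eqr_lmul[OF lmul(1) lmul(3)])
  moreover have "(actF x (actF (lie x' y) s) - actF (lie x' y) (actF x s))
       - (actF x' (actF (lie x y) s) - actF (lie x y) (actF x' s)) \<doteq> actF (lie (lie x x') y) s"
    unfolding jac
    by (rule eqr_trans[OF eqr_diff[OF lmul(3) lmul(3)] eqr_sym[OF actF_diff_left[OF lmul(2)]]])
  ultimately show ?case unfolding actF_lmul[of "lie x x'" y s] by (simp only: eqr_add)
qed

section \<open>The action of the enveloping algebra on the quotient\<close>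

definition free_act :: "'g free_algebra \<Rightarrow> ('g list \<Rightarrow>\<^sub>0 'm) \<Rightarrow> ('g list \<Rightarrow>\<^sub>0 'm)"
  where "free_act A s = linext (\<lambda>k c. case k of Mon w \<Rightarrow> c *\<^sub>C foldr actF w s) A"

lemma clinear_foldr_actF: "clinear (foldr actF w)"
proof (induction w)
  case (Cons x w)
  then show ?case by (simp add: clinear_compose[OF clinear_actF, of "foldr actF w"] o_def)
qed (simp add: clinear_iff)

lemma free_act_clinear_left: "clinear (\<lambda>A. free_act A s)"
  unfolding free_act_def
  by (rule clinear_linext)
    (auto simp: clinear_iff scaleC_add_left scaleC_complex_def scaleC_scaleC split: free_monoid.split)

lemma free_act_clinear_right: "clinear (free_act A)"
  unfolding clinear_iff free_act_def linext_def
  by (auto simp: clinear_add[OF clinear_foldr_actF] clinear_scale[OF clinear_foldr_actF]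
      scaleC_add_right scaleC_scaleC mult.commute sum.distrib[symmetric] cvec.scale_sum_right
      intro!: sum.cong split: free_monoid.split)

lemma free_act_single: "free_act (Poly_Mapping.single (Mon w) c) s = c *\<^sub>C foldr actF w s"
  unfolding free_act_def by (subst linext_single) auto

lemma free_act_gen: "free_act (free_gen x) s = actF x s"
  by (simp add: free_gen_def free_act_single scaleC_one)

lemma free_act_mult: "free_act (A * B) s = free_act A (free_act B s)"
proof (rule additive_eq_on_single[of "\<lambda>A. free_act (A * B) s" "\<lambda>A. free_act A (free_act B s)"])
  show "free_act (Poly_Mapping.single k c * B) s = free_act (Poly_Mapping.single k c) (free_act B s)" for k c
  proof (rule additive_eq_on_single[of "\<lambda>B. free_act (Poly_Mapping.single k c * B) s"
        "\<lambda>B. free_act (Poly_Mapping.single k c) (free_act B s)"])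
    show "free_act (Poly_Mapping.single k c * Poly_Mapping.single l d) s =
        free_act (Poly_Mapping.single k c) (free_act (Poly_Mapping.single l d) s)" for l d
      by (cases k; cases l)
        (simp add: mult_single free_act_single clinear_scale[OF clinear_foldr_actF] scaleC_scaleC)
  qed (simp_all add: distrib_left clinear_add[OF free_act_clinear_left] clinear_add[OF free_act_clinear_right])
qed (simp_all add: distrib_right clinear_add[OF free_act_clinear_left])

lemma foldr_actF_Fa: "s \<in> Fa \<Longrightarrow> foldr actF w s \<in> Fa"
  by (induction w) (simp_all add: actF_Fa)

lemma foldr_actF_rels: "s \<in> rels \<Longrightarrow> foldr actF w s \<in> rels"
  by (induction w) (simp_all add: actF_rels)

lemma free_act_Fa: "s \<in> Fa \<Longrightarrow> free_act A s \<in> Fa"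
  unfolding free_act_def linext_def
  by (auto intro!: cvec.subspace_sum[OF subspace_Fa] cvec.subspace_scale[OF subspace_Fa]
      foldr_actF_Fa split: free_monoid.split)

lemma free_act_rels: "s \<in> rels \<Longrightarrow> free_act A s \<in> rels"
  unfolding free_act_def linext_def
  by (auto intro!: cvec.subspace_sum[OF subspace_rels] cvec.subspace_scale[OF subspace_rels]
      foldr_actF_rels split: free_monoid.split)

text \<open>The defining relations act by zero modulo \<open>rels\<close>. The claim is made for all
  s at once because a right multiple replaces s by another element of \<open>Fa\<close>; left
  multiples preserve \<open>rels\<close>.\<close>

lemma free_act_uea_ideal: "A \<in> uea_ideal \<Longrightarrow> s \<in> Fa \<Longrightarrow> free_act A s \<in> rels"
proof (induction arbitrary: s rule: uea_ideal.induct)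
  case zero
  then show ?case by (simp add: clinear_0[OF free_act_clinear_left] rels.zero)
next
  case (add A B)
  then show ?case by (simp add: clinear_add[OF free_act_clinear_left] rels.add)
next
  case (scale A c)
  then show ?case by (simp add: clinear_scale[OF free_act_clinear_left] rels.scale)
next
  case (mult_left A B)
  then show ?case by (simp add: free_act_mult free_act_rels)
next
  case (mult_right A B)
  then show ?case by (simp add: free_act_mult free_act_Fa)
next
  case (gen_add x y)
  then show ?case
    using actF_add_left[of s x y]
    by (simp add: clinear_diff[OF free_act_clinear_left] clinear_add[OF free_act_clinear_left] free_act_gen
        eqr_def algebra_simps)
next
  case (gen_scale c x)
  then show ?case
    using actF_scale_left[of s c x]
    by (simp add: clinear_diff[OF free_act_clinear_left] clinear_scale[OF free_act_clinear_left]
        free_act_gen eqr_def)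
next
  case (gen_lie x y)
  then show ?case
    using actF_lie[of s x y]
    by (simp add: clinear_diff[OF free_act_clinear_left] free_act_mult free_act_gen eqr_def)
qed


text \<open>The derivation of the tensor algebra that extends \<phi>, extended by zero to M: it sums
  over all ways to delete one letter, weighted by \<phi> of that letter.\<close>

definition word_deriv :: "('g \<Rightarrow> complex) \<Rightarrow> ('g list \<Rightarrow>\<^sub>0 'm) \<Rightarrow> ('g list \<Rightarrow>\<^sub>0 'm)"
  where "word_deriv \<phi> = linext (rec_list (\<lambda>m. 0)
    (\<lambda>y w d m. \<phi> y *\<^sub>C Poly_Mapping.single w m + lmul y (d m)))"

lemma
  shows clinear_word_deriv: "clinear (word_deriv \<phi>)"
    and word_deriv_unitF: "word_deriv \<phi> (unitF m) = 0"
    and word_deriv_lmul: "word_deriv \<phi> (lmul y s) = \<phi> y *\<^sub>C s + lmul y (word_deriv \<phi> s)"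
proof -
  let ?d = "rec_list (\<lambda>m. 0)
    (\<lambda>y w d m. \<phi> y *\<^sub>C Poly_Mapping.single w m + lmul y (d m)) :: 'g list \<Rightarrow> 'm \<Rightarrow> ('g list \<Rightarrow>\<^sub>0 'm)"
  have lin: "clinear (?d w)" for w
  proof (induction w)
    case (Cons y w)
    then show ?case
      by (simp only: list.rec) (intro clinear_plus clinear_scaled clinear_single clinear_compose[OF clinear_lmul])
  qed (simp add: clinear_iff)
  show 1: "clinear (word_deriv \<phi>)" unfolding word_deriv_def by (rule clinear_linext[OF lin])
  have single: "word_deriv \<phi> (Poly_Mapping.single w m) = ?d w m" for w m
    unfolding word_deriv_def by (rule clinear_linext_single[OF lin])
  then show "word_deriv \<phi> (unitF m) = 0" by simp
  show "word_deriv \<phi> (lmul y s) = \<phi> y *\<^sub>C s + lmul y (word_deriv \<phi> s)"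
    by (rule clinear_eq_on_single[of "\<lambda>s. word_deriv \<phi> (lmul y s)"
          "\<lambda>s. \<phi> y *\<^sub>C s + lmul y (word_deriv \<phi> s)"])
      (auto intro!: clinear_plus clinear_scaled clinear_id clinear_compose[OF 1] clinear_lmul
        clinear_compose[OF clinear_lmul] 1 simp: lmul_single single)
qed

lemma word_deriv_Fa: "s \<in> Fa \<Longrightarrow> word_deriv \<phi> s \<in> Fa"
proof (induction rule: Fa_induct)
  case (lmul y s)
  then show ?case
    by (simp add: word_deriv_lmul cvec.subspace_add[OF subspace_Fa] cvec.subspace_scale[OF subspace_Fa] lmul_Fa)
qed (simp_all add: clinear_0[OF clinear_word_deriv] clinear_add[OF clinear_word_deriv]
    word_deriv_unitF cvec.subspace_0[OF subspace_Fa] cvec.subspace_add[OF subspace_Fa])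

lemma word_deriv_funpow_lmul:
  "(word_deriv \<phi> ^^ Suc k) (lmul y s) = lmul y ((word_deriv \<phi> ^^ Suc k) s) +
    (of_nat (Suc k) * \<phi> y) *\<^sub>C (word_deriv \<phi> ^^ k) s"
proof (induction k)
  case 0
  show ?case by (simp add: word_deriv_lmul)
next
  case (Suc k)
  let ?D = "word_deriv \<phi>"
  have "(?D ^^ Suc (Suc k)) (lmul y s) = ?D ((?D ^^ Suc k) (lmul y s))" by simp
  also have "\<dots> = lmul y ((?D ^^ Suc (Suc k)) s) + (\<phi> y + of_nat (Suc k) * \<phi> y) *\<^sub>C (?D ^^ Suc k) s"
    unfolding Suc by (simp add: word_deriv_lmul clinear_add[OF clinear_word_deriv]
        clinear_scale[OF clinear_word_deriv] scaleC_add_left add_ac del: of_nat_Suc)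
  also have "\<phi> y + of_nat (Suc k) * \<phi> y = of_nat (Suc (Suc k)) * \<phi> y" by (simp add: algebra_simps)
  finally show ?case .
qed

text \<open>Each application deletes a letter; the commutation with a letter turns the exponent k
  for s into k + 1 for the longer word.\<close>

lemma word_deriv_nilpotent: "s \<in> Fa \<Longrightarrow> \<exists>n. (word_deriv \<phi> ^^ n) s = 0"
proof (induction rule: Fa_induct)
  case zero
  show ?case by (rule exI[of _ 0]) simp
next
  case (add s t)
  note lin = clinear_funpow[OF clinear_word_deriv]
  from add obtain k l where kl: "(word_deriv \<phi> ^^ k) s = 0" "(word_deriv \<phi> ^^ l) t = 0" by blast
  have "(word_deriv \<phi> ^^ (l + k)) s = 0" "(word_deriv \<phi> ^^ (k + l)) t = 0"
    unfolding funpow_add o_def kl by (rule clinear_0[OF lin])+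
  then show ?case by (intro exI[of _ "k + l"]) (simp add: clinear_add[OF lin] add.commute[of l k])
next
  case (unit m)
  show ?case by (rule exI[of _ 1]) (simp add: word_deriv_unitF)
next
  case (lmul y s)
  then obtain k where k: "(word_deriv \<phi> ^^ k) s = 0" by blast
  have "(word_deriv \<phi> ^^ Suc k) (lmul y s) = 0"
    unfolding word_deriv_funpow_lmul using k by (simp add: clinear_0[OF clinear_word_deriv] clinear_0[OF clinear_lmul])
  then show ?case by blast
qed

text \<open>Applied to the Lie relation, the terms in which y or y' is deleted cancel in pairs. What
  remains is \<phi> of the bracket, zero by hypothesis.\<close>

lemma word_deriv_rels:
  fixes \<phi> :: "'g \<Rightarrow> complex"
  assumes \<phi>: "clinear \<phi>" "\<And>y y'. y \<in> a \<Longrightarrow> y' \<in> a \<Longrightarrow> \<phi> (lie y y') = 0"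
  shows "r \<in> rels \<Longrightarrow> word_deriv \<phi> r \<in> rels"
proof (induction rule: rels.induct)
  case (lmul y r)
  then show ?case by (simp add: word_deriv_lmul rels.add rels.scale rels.lmul)
next
  case (gen_add y y' s)
  then have "lmul (y + y') (word_deriv \<phi> s) - lmul y (word_deriv \<phi> s) - lmul y' (word_deriv \<phi> s) \<in> rels"
    by (intro rels.gen_add word_deriv_Fa)
  then show ?case
    by (simp add: clinear_diff[OF clinear_word_deriv] clinear_add[OF clinear_word_deriv] word_deriv_lmul
        clinear_add[OF \<phi>(1)] scaleC_add_left algebra_simps)
next
  case (gen_scale y s c)
  then have "lmul (c *\<^sub>C y) (word_deriv \<phi> s) - c *\<^sub>C lmul y (word_deriv \<phi> s) \<in> rels"
    by (intro rels.gen_scale word_deriv_Fa)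
  then show ?case
    by (simp add: clinear_diff[OF clinear_word_deriv] clinear_scale[OF clinear_word_deriv] word_deriv_lmul
        clinear_scale[OF \<phi>(1)] scaleC_add_right scaleC_scaleC scaleC_complex_def)
next
  case (gen_lie y y' s)
  then have "lmul y (lmul y' (word_deriv \<phi> s)) - lmul y' (lmul y (word_deriv \<phi> s))
      - lmul (lie y y') (word_deriv \<phi> s) \<in> rels"
    by (intro rels.gen_lie word_deriv_Fa)
  then show ?case
    using gen_lie(1,2)
    by (simp add: clinear_diff[OF clinear_word_deriv] clinear_add[OF clinear_word_deriv] word_deriv_lmul
        clinear_add[OF clinear_lmul]
        clinear_scale[OF clinear_lmul] \<phi>(2) algebra_simps)
qed (simp_all add: clinear_0[OF clinear_word_deriv] clinear_add[OF clinear_word_deriv]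
    clinear_scale[OF clinear_word_deriv] rels.zero rels.add rels.scale)

text \<open>The commutator of \<open>word_deriv \<phi>\<close> and \<open>lmul f\<close> is the nonzero scalar \<open>\<phi> f\<close>.\<close>

lemma lmul_injective_mod_rels:
  fixes \<phi> :: "'g \<Rightarrow> complex"
  assumes \<phi>: "clinear \<phi>" "\<And>y y'. y \<in> a \<Longrightarrow> y' \<in> a \<Longrightarrow> \<phi> (lie y y') = 0"
    and f: "f \<in> a" "\<phi> f \<noteq> 0" and s: "s \<in> Fa" "lmul f s \<in> rels"
  shows "s \<in> rels"
proof -
  let ?D = "word_deriv \<phi>"
  obtain n where "(?D ^^ n) s = 0" using word_deriv_nilpotent[OF s(1)] by blast
  then have "(?D ^^ n) s \<in> rels" by (simp add: rels.zero)
  then show ?thesis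
  \<comment> \<open>Descent on the power of \<open>?D\<close>: D^(n+1) (f s) and f D^(n+1) s both
    lie in \<open>rels\<close>, and they differ by the non-zero multiple (n+1) \<phi>(f) of D^n
    s.\<close>
  proof (induction n)
    case (Suc n)
    have "(?D ^^ Suc n) (lmul f s) \<in> rels"
      by (induction n) (simp_all add: word_deriv_rels[OF \<phi>] s(2))
    moreover have "lmul f ((?D ^^ Suc n) s) \<in> rels" by (rule rels.lmul[OF f(1) Suc.prems])
    ultimately have "(of_nat (Suc n) * \<phi> f) *\<^sub>C (?D ^^ n) s \<in> rels"
      unfolding word_deriv_funpow_lmul using cvec.subspace_diff[OF subspace_rels] by fastforce
    note scaled = rels.scale[OF this, of "inverse (of_nat (Suc n) * \<phi> f)"]
    have nz: "of_nat (Suc n) * \<phi> f \<noteq> 0"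
      using f(2) by (metis mult_eq_0_iff of_nat_eq_0_iff nat.distinct(1))
    have "(?D ^^ n) s \<in> rels" using scaled by (simp only: scaleC_scaleC left_inverse[OF nz] scaleC_one)
    then show ?case by (rule Suc.IH)
  qed simp
qed

end

section \<open>Identification of the quotient with the induced module\<close>

lemma uea_induct:
  assumes "P 0" "\<And>u v. P u \<Longrightarrow> P v \<Longrightarrow> P (u + v)" "\<And>c u. P u \<Longrightarrow> P (c *\<^sub>C u)" "P 1"
    and "\<And>x u. P u \<Longrightarrow> P (uea_gen x * u)"
  shows "P u"
proof -
  have abs: "P (abs_uea F)" for F
  proof -
    have word: "P (abs_uea (Poly_Mapping.single (Mon w) 1))" for w
    proof (induction w)
      case Nil
      have "abs_uea (Poly_Mapping.single (Mon []) 1) = (1 :: 'a uea)"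
        by (simp add: one_uea_def single_one zero_free_monoid_def[symmetric])
      then show ?case using assms(4) by simp
    next
      case (Cons x w)
      have "Poly_Mapping.single (Mon (x # w)) 1 = free_gen x * Poly_Mapping.single (Mon w) (1::complex)"
        by (simp add: free_gen_def mult_single)
      then have "abs_uea (Poly_Mapping.single (Mon (x # w)) 1) = uea_gen x * abs_uea (Poly_Mapping.single (Mon w) 1)"
        by (simp add: uea_gen.abs_eq times_uea.abs_eq)
      then show ?case using assms(5)[OF Cons] by simp
    qed
    have single: "P (abs_uea (Poly_Mapping.single k c))" for k c
    proof (cases k)
      case (Mon w)
      have "Poly_Mapping.single k c = c *\<^sub>C Poly_Mapping.single k 1"
        by (simp add: clinear_scale[OF clinear_single, symmetric] scaleC_complex_def)
      then have "abs_uea (Poly_Mapping.single k c) = c *\<^sub>C abs_uea (Poly_Mapping.single k 1)"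
        by (simp add: scaleC_uea.abs_eq)
      then show ?thesis using assms(3)[OF word] Mon by simp
    qed
    have "P (abs_uea (\<Sum>k\<in>A. Poly_Mapping.single k (g k)))" for A and g :: "'a free_monoid \<Rightarrow> complex"
    proof (induction A rule: infinite_finite_induct)
      case (insert k A)
      then show ?case using assms(2)[OF single[of k "g k"]] by (simp add: insert plus_uea.abs_eq[symmetric])
    qed (use assms(1) in \<open>simp_all add: zero_uea_def\<close>)
    then show ?thesis by (subst poly_mapping_eq_sum_single)
  qed
  show ?thesis using abs[of "rep_uea u"] Quotient3_abs_rep[OF Quotient3_uea, of u] by simp
qed

lemma clinear_tensor_eval: "clinear (tensor_eval t)"
proof -
  have "tensor_eval t = linext (\<lambda>(u, m) c. c *\<^sub>C t u m)"
    by (auto simp: tensor_eval_def linext_def fun_eq_iff intro!: sum.cong)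
  then show ?thesis
    by (simp only:) (rule clinear_linext, auto simp: clinear_iff scaleC_add_left scaleC_scaleC scaleC_complex_def)
qed

lemma tensor_eval_single: "tensor_eval t (Poly_Mapping.single (u, m) 1) = t u m"
  by (simp add: tensor_eval_def scaleC_one)

locale induced = split_lie_algebra a p actM
  for a p :: "'g::complex_lie_algebra set" and actM :: "'g \<Rightarrow> 'm::complex_vector \<Rightarrow> 'm" +
  fixes actN :: "'g \<Rightarrow> 'n::complex_vector \<Rightarrow> 'n" and t :: "'g uea \<Rightarrow> 'm \<Rightarrow> 'n"
  assumes N: "induced_module p actM actN t"
begin

lemma kernel: "tensor_eval t F = 0 \<longleftrightarrow> F \<in> cvec.span (tensor_relations p actM)"
  using N by (simp add: induced_module_def)

lemma N_module: "lie_module UNIV actN"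
  using N by (simp add: induced_module_def)

lemma actN_t: "actN x (t u m) = t (uea_gen x * u) m"
  using N by (simp add: induced_module_def)

lemmas N_linear = lie_module_linear[OF N_module]
  and N_clinear = action_clinear[OF lie_module_linear[OF N_module] UNIV_I]

lemma
  shows t_add_left: "t (u + u') m = t u m + t u' m"
    and t_add_right: "t u (m + m') = t u m + t u m'"
    and t_scale_left: "t (c *\<^sub>C u) m = c *\<^sub>C t u m"
    and t_scale_right: "t u (c *\<^sub>C m) = c *\<^sub>C t u m"
    and t_balanced: "x \<in> p \<Longrightarrow> t (u * uea_gen x) m = t u (actM x m)"
proof -
  have rel: "F \<in> tensor_relations p actM \<Longrightarrow> tensor_eval t F = 0" for F
    unfolding kernel by (rule cvec.span_base)
  note lin = clinear_diff[OF clinear_tensor_eval] clinear_add[OF clinear_tensor_eval] clinear_scale[OF clinear_tensor_eval] tensor_eval_single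
  let ?s = "\<lambda>u m. Poly_Mapping.single (u, m) (1::complex)"
  have "tensor_eval t (?s (u + u') m - ?s u m - ?s u' m) = 0"
    by (rule rel) (unfold tensor_relations_def Let_def, blast)
  then show "t (u + u') m = t u m + t u' m" by (simp add: lin algebra_simps)
  have "tensor_eval t (?s u (m + m') - ?s u m - ?s u m') = 0"
    by (rule rel) (unfold tensor_relations_def Let_def, blast)
  then show "t u (m + m') = t u m + t u m'" by (simp add: lin algebra_simps)
  have "tensor_eval t (?s (c *\<^sub>C u) m - c *\<^sub>C ?s u m) = 0"
    by (rule rel) (unfold tensor_relations_def Let_def, blast)
  then show "t (c *\<^sub>C u) m = c *\<^sub>C t u m" by (simp add: lin)
  have "tensor_eval t (?s u (c *\<^sub>C m) - c *\<^sub>C ?s u m) = 0"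
    by (rule rel) (unfold tensor_relations_def Let_def, blast)
  then show "t u (c *\<^sub>C m) = c *\<^sub>C t u m" by (simp add: lin)
  have "tensor_eval t (?s (u * uea_gen x) m - ?s u (actM x m)) = 0" if "x \<in> p"
    using that by (intro rel) (unfold tensor_relations_def Let_def, blast)
  then show "x \<in> p \<Longrightarrow> t (u * uea_gen x) m = t u (actM x m)" by (simp add: lin)
qed

lemma clinear_t: "clinear (t u)"
  by (simp add: clinear_iff t_add_right t_scale_right)

lemma t_1_p: "x \<in> p \<Longrightarrow> actN x (t 1 m) = t 1 (actM x m)"
  using t_balanced[of x 1 m] by (simp add: actN_t)

text \<open>The \<gg>-module N is generated by 1 \<otimes> M.\<close>

lemma N_induct:
  assumes "cvec.subspace W" "\<And>x n. n \<in> W \<Longrightarrow> actN x n \<in> W" "\<And>m. t 1 m \<in> W"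
  shows "n \<in> W"
proof -
  have "t u m \<in> W" for u m
  proof (induction u rule: uea_induct)
    case 1
    have "t 0 m = 0" using t_scale_left[of 0 0 m] by simp
    then show ?case by (simp add: cvec.subspace_0[OF assms(1)])
  qed (simp_all add: t_add_left t_scale_left cvec.subspace_add[OF assms(1)] cvec.subspace_scale[OF assms(1)]
      assms(3) actN_t[symmetric] assms(2))
  moreover obtain F where "n = tensor_eval t F"
    using N unfolding induced_module_def surj_def by blast
  ultimately show ?thesis
    unfolding tensor_eval_def
    by (auto intro!: cvec.subspace_sum[OF assms(1)] cvec.subspace_scale[OF assms(1)])
qed

definition word_uea :: "'g list \<Rightarrow> 'g uea"
  where "word_uea w = foldr (\<lambda>x u. uea_gen x * u) w 1"

text \<open>On \<open>Fa\<close> it is onto with kernel \<open>rels\<close>, which identifies U(a)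
  \<otimes> M with N.\<close>

definition toN :: "('g list \<Rightarrow>\<^sub>0 'm) \<Rightarrow> 'n"
  where "toN = linext (\<lambda>w. t (word_uea w))"

lemma clinear_toN: "clinear toN"
  unfolding toN_def by (rule clinear_linext) (rule clinear_t)

lemma toN_single: "toN (Poly_Mapping.single w m) = t (word_uea w) m"
  unfolding toN_def by (rule clinear_linext_single) (rule clinear_t)

lemma toN_lmul: "toN (lmul y s) = actN y (toN s)"
  by (rule clinear_eq_on_single[of "\<lambda>s. toN (lmul y s)" "\<lambda>s. actN y (toN s)"])
    (auto intro!: clinear_compose[OF clinear_toN] clinear_compose[OF N_clinear] clinear_lmul clinear_toN
      simp: lmul_single toN_single word_uea_def actN_t)

lemma toN_unitF: "toN (unitF m) = t 1 m"
  by (simp add: toN_single word_uea_def)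

lemma toN_rels: "r \<in> rels \<Longrightarrow> toN r = 0"
proof (induction rule: rels.induct)
  case (lmul y r)
  then show ?case by (simp add: toN_lmul clinear_0[OF N_clinear])
next
  case (gen_add y y' s)
  show ?case by (simp add: clinear_diff[OF clinear_toN] toN_lmul action_add[OF N_linear])
next
  case (gen_scale y s c)
  show ?case
    by (simp add: clinear_diff[OF clinear_toN] clinear_scale[OF clinear_toN] toN_lmul action_scale[OF N_linear])
next
  case (gen_lie y y' s)
  show ?case by (simp add: clinear_diff[OF clinear_toN] toN_lmul lie_module_lie[OF N_module])
qed (simp_all add: clinear_0[OF clinear_toN] clinear_add[OF clinear_toN] clinear_scale[OF clinear_toN])

lemma toN_actF: "s \<in> Fa \<Longrightarrow> toN (actF x s) = actN x (toN s)"
proof (induction arbitrary: x rule: Fa_induct)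
  case (unit m)
  have "actN x (t 1 m) = actN (pa x) (t 1 m) + actN (pp x) (t 1 m)"
    using action_add[OF N_linear UNIV_I UNIV_I, of "pa x" "pp x" "t 1 m"] by (simp add: pp_def)
  then show ?case
    by (simp add: actF_unitF clinear_add[OF clinear_toN] toN_lmul toN_unitF t_1_p pp_in)
next
  case (lmul y s)
  then show ?case
    by (simp add: actF_lmul clinear_add[OF clinear_toN] toN_lmul lie_module_lie[OF N_module])
qed (simp_all add: clinear_0[OF clinear_actF] clinear_add[OF clinear_actF] clinear_0[OF clinear_toN]
    clinear_add[OF clinear_toN] clinear_0[OF N_clinear] clinear_add[OF N_clinear])

lemma toN_surj: "\<exists>s\<in>Fa. n = toN s"
proof -
  have "n \<in> toN ` Fa"
  proof (rule N_induct)
    show "cvec.subspace (toN ` Fa)"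
      using subspace_Fa unfolding cvec.subspace_def
      by (auto simp: clinear_0[OF clinear_toN, symmetric] clinear_add[OF clinear_toN, symmetric]
          clinear_scale[OF clinear_toN, symmetric])
    show "actN x n \<in> toN ` Fa" if "n \<in> toN ` Fa" for x n
      using that actF_Fa by (auto simp: toN_actF[symmetric])
    show "t 1 m \<in> toN ` Fa" for m using unitF_Fa toN_unitF[of m] by (metis imageI)
  qed
  then show ?thesis by blast
qed

text \<open>The inverse direction, u \<otimes> m to u (1 \<otimes> m), defined before the tensor
  relations are divided out. The representative of u is chosen arbitrarily, so the tensor relations
  are respected only modulo \<open>rels\<close>.\<close>

definition fromN :: "('g uea \<times> 'm \<Rightarrow>\<^sub>0 complex) \<Rightarrow> ('g list \<Rightarrow>\<^sub>0 'm)"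
  where "fromN = linext (\<lambda>(u, m) c. c *\<^sub>C free_act (rep_uea u) (unitF m))"

lemma clinear_fromN: "clinear fromN"
  unfolding fromN_def
  by (rule clinear_linext) (auto simp: clinear_iff scaleC_add_left scaleC_scaleC scaleC_complex_def)

lemma fromN_single: "fromN (Poly_Mapping.single (u, m) 1) = free_act (rep_uea u) (unitF m)"
  unfolding fromN_def by (subst linext_single) (auto simp: scaleC_one)

lemma free_act_rep_abs: "s \<in> Fa \<Longrightarrow> free_act (rep_uea (abs_uea F)) s \<doteq> free_act F s"
proof -
  assume s: "s \<in> Fa"
  have "uea_rel (rep_uea (abs_uea F)) F"
    using Quotient3_abs_rep[OF Quotient3_uea, of "abs_uea F"] by (metis uea.abs_eq_iff)
  then have "free_act (rep_uea (abs_uea F) - F) s \<in> rels"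
    unfolding uea_rel_def using s by (rule free_act_uea_ideal)
  then show ?thesis by (simp add: eqr_def clinear_diff[OF free_act_clinear_left])
qed

lemma free_act_rep:
  assumes "s \<in> Fa"
  shows "free_act (rep_uea (u + v)) s \<doteq> free_act (rep_uea u) s + free_act (rep_uea v) s"
    and "free_act (rep_uea (c *\<^sub>C u)) s \<doteq> c *\<^sub>C free_act (rep_uea u) s"
    and "free_act (rep_uea (u * v)) s \<doteq> free_act (rep_uea u) (free_act (rep_uea v) s)"
    and "free_act (rep_uea (uea_gen x)) s \<doteq> actF x s"
    and "free_act (rep_uea 1) s \<doteq> s"
proof -
  note abs = Quotient3_abs_rep[OF Quotient3_uea]
  show "free_act (rep_uea (u + v)) s \<doteq> free_act (rep_uea u) s + free_act (rep_uea v) s"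
    using free_act_rep_abs[OF assms, of "rep_uea u + rep_uea v"]
    by (simp add: plus_uea.abs_eq[symmetric] abs clinear_add[OF free_act_clinear_left])
  show "free_act (rep_uea (c *\<^sub>C u)) s \<doteq> c *\<^sub>C free_act (rep_uea u) s"
    using free_act_rep_abs[OF assms, of "c *\<^sub>C rep_uea u"]
    by (simp add: scaleC_uea.abs_eq[symmetric] abs clinear_scale[OF free_act_clinear_left])
  show "free_act (rep_uea (u * v)) s \<doteq> free_act (rep_uea u) (free_act (rep_uea v) s)"
    using free_act_rep_abs[OF assms, of "rep_uea u * rep_uea v"]
    by (simp add: times_uea.abs_eq[symmetric] abs free_act_mult)
  show "free_act (rep_uea (uea_gen x)) s \<doteq> actF x s"
    using free_act_rep_abs[OF assms, of "free_gen x"]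
    by (simp add: uea_gen.abs_eq[symmetric] free_act_gen)
  have "1 = Poly_Mapping.single (Mon ([]::'g list)) (1::complex)"
    by (simp add: single_one[symmetric] zero_free_monoid_def)
  then show "free_act (rep_uea 1) s \<doteq> s"
    using free_act_rep_abs[OF assms, of 1] free_act_single[of "[]" 1 s]
    by (simp add: one_uea_def scaleC_one)
qed

lemma free_act_cong: "s \<doteq> s' \<Longrightarrow> free_act A s \<doteq> free_act A s'"
  unfolding eqr_def by (metis clinear_diff[OF free_act_clinear_right] free_act_rels)

lemma fromN_relations:
  assumes "F \<in> cvec.span (tensor_relations p actM)"
  shows "fromN F \<in> rels"
proof (rule clinear_span_subset[OF clinear_fromN subspace_rels _ assms])
  fix F assume "F \<in> tensor_relations p actM"
  note lin = clinear_diff[OF clinear_fromN] clinear_add[OF clinear_fromN] clinear_scale[OF clinear_fromN] fromN_single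
    clinear_add[OF clinear_single] clinear_scale[OF clinear_single]
    clinear_add[OF free_act_clinear_right] clinear_scale[OF free_act_clinear_right]
  let ?s = "\<lambda>u m. Poly_Mapping.single (u, m) (1::complex)"
  consider u u' m where "F = ?s (u + u') m - ?s u m - ?s u' m"
    | u m m' where "F = ?s u (m + m') - ?s u m - ?s u m'"
    | c u m where "F = ?s (c *\<^sub>C u) m - c *\<^sub>C ?s u m"
    | c u m where "F = ?s u (c *\<^sub>C m) - c *\<^sub>C ?s u m"
    | u x m where "x \<in> p" "F = ?s (u * uea_gen x) m - ?s u (actM x m)"
    using \<open>F \<in> tensor_relations p actM\<close> unfolding tensor_relations_def Let_def by blast
  then show "fromN F \<in> rels"
  proof cases
    case (1 u u' m)
    show ?thesis
      using free_act_rep(1)[OF unitF_Fa, of u u' m] unfolding 1 by (simp add: lin eqr_def diff_diff_eq)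
  next
    case (2 u m m')
    then show ?thesis by (simp add: lin rels.zero)
  next
    case (3 c u m)
    then show ?thesis using free_act_rep(2)[OF unitF_Fa, of c u m] by (simp add: lin eqr_def)
  next
    case (4 c u m)
    then show ?thesis by (simp add: lin rels.zero)
  next
    case (5 u x m)
    have "free_act (rep_uea (uea_gen x)) (unitF m) \<doteq> actF x (unitF m)"
      by (rule free_act_rep(4)[OF unitF_Fa])
    \<comment> \<open>The word with the single letter 0 is not zero in the free space; it vanishes
      only modulo \<open>rels\<close>.\<close>
    also have "actF x (unitF m) = lmul 0 (unitF m) + unitF (actM x m)"
      using 5(1) by (simp add: actF_unitF pa_p pp_def)
    also have "\<dots> \<doteq> 0 + unitF (actM x m)"
      by (intro eqr_add lmul_0_left unitF_Fa eqr_refl)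
    finally have "free_act (rep_uea u) (free_act (rep_uea (uea_gen x)) (unitF m)) \<doteq>
        free_act (rep_uea u) (unitF (actM x m))"
      by (intro free_act_cong) simp
    from eqr_trans[OF free_act_rep(3)[OF unitF_Fa] this] show ?thesis
      by (simp add: 5(2) lin eqr_def)
  qed
qed

text \<open>Letters in a act by prefixing themselves, so a word applied to 1 \<otimes> m reproduces
  itself.\<close>

lemma word_uea_unitF:
  "set w \<subseteq> a \<Longrightarrow> free_act (rep_uea (word_uea w)) (unitF m) \<doteq> Poly_Mapping.single w m"
proof (induction w)
  case Nil
  then show ?case by (simp add: word_uea_def free_act_rep(5)[OF unitF_Fa])
next
  case (Cons y w)
  then have y: "y \<in> a" and IH: "free_act (rep_uea (word_uea w)) (unitF m) \<doteq> Poly_Mapping.single w m"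
    by auto
  have "free_act (rep_uea (uea_gen y * word_uea w)) (unitF m) \<doteq>
      free_act (rep_uea (uea_gen y)) (free_act (rep_uea (word_uea w)) (unitF m))"
    by (rule free_act_rep(3)[OF unitF_Fa])
  also have "\<dots> \<doteq> actF y (free_act (rep_uea (word_uea w)) (unitF m))"
    by (rule free_act_rep(4)[OF free_act_Fa[OF unitF_Fa]])
  also have "\<dots> \<doteq> lmul y (free_act (rep_uea (word_uea w)) (unitF m))"
    by (rule actF_a[OF free_act_Fa[OF unitF_Fa] y])
  also have "\<dots> \<doteq> lmul y (Poly_Mapping.single w m)" by (rule eqr_lmul[OF y IH])
  finally show ?case by (simp add: word_uea_def lmul_single)
qed

lemma keys_Fa:
  assumes "s \<in> Fa" "w \<in> Poly_Mapping.keys s"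
  shows "set w \<subseteq> a"
proof -
  have "Fa \<subseteq> {s. \<forall>w. Poly_Mapping.lookup s w \<noteq> 0 \<longrightarrow> set w \<subseteq> a}"
    unfolding Fa_def
  proof (rule cvec.span_minimal)
    show "cvec.subspace {s. \<forall>w. Poly_Mapping.lookup s w \<noteq> (0::'m) \<longrightarrow> set w \<subseteq> a}"
      unfolding cvec.subspace_def by (auto simp: lookup_add lookup_scaleC) (metis add.right_neutral subsetD)
  qed (auto simp: lookup_single when_def split: if_splits)
  then show ?thesis using assms by (auto simp: in_keys_iff)
qed

text \<open>G is a lift of \<open>toN s\<close> to the free space. If \<open>toN s\<close> is 0,
  then G is a combination of tensor relations and \<open>fromN G\<close> lies in
  \<open>rels\<close>; but \<open>fromN G\<close> is s modulo \<open>rels\<close>.\<close>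

lemma toN_injective:
  assumes s: "s \<in> Fa" and "toN s = 0"
  shows "s \<in> rels"
proof -
  let ?l = "Poly_Mapping.lookup s" and ?K = "Poly_Mapping.keys s"
  define G where "G = (\<Sum>w\<in>?K. Poly_Mapping.single (word_uea w, ?l w) (1::complex))"
  have "tensor_eval t G = toN s"
    by (simp add: G_def clinear_sum[OF clinear_tensor_eval] tensor_eval_single toN_def linext_def)
  then have "fromN G \<in> rels" using assms(2) kernel fromN_relations by simp
  moreover have "s - fromN G \<in> rels"
  proof -
    have "s - fromN G = (\<Sum>w\<in>?K. Poly_Mapping.single w (?l w) - free_act (rep_uea (word_uea w)) (unitF (?l w)))"
      unfolding G_def clinear_sum[OF clinear_fromN] fromN_single sum_subtractf
      by (subst poly_mapping_eq_sum_single[of s]) simp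
    also have "\<dots> \<in> rels"
      by (rule cvec.subspace_sum[OF subspace_rels])
        (metis eqr_def eqr_sym word_uea_unitF keys_Fa[OF s])
    finally show ?thesis .
  qed
  ultimately show ?thesis using rels.add by fastforce
qed

lemma actN_injective:
  fixes \<phi> :: "'g \<Rightarrow> complex"
  assumes "clinear \<phi>" "\<And>y y'. y \<in> a \<Longrightarrow> y' \<in> a \<Longrightarrow> \<phi> (lie y y') = 0"
    and "f \<in> a" "\<phi> f \<noteq> 0" "actN f n = 0"
  shows "n = 0"
proof -
  obtain s where s: "s \<in> Fa" "n = toN s" using toN_surj by blast
  have "toN (lmul f s) = 0" using assms(5) s(2) by (simp add: toN_lmul)
  then have "lmul f s \<in> rels" by (rule toN_injective[OF lmul_Fa[OF assms(3) s(1)]])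
  then have "s \<in> rels" using lmul_injective_mod_rels[of \<phi> f s] assms(1-4) s(1) by blast
  then show ?thesis using toN_rels s(2) by simp
qed

end

section \<open>Weights\<close>

lemma weight_space_eq: "weight_space K act \<mu> = joint_eigenspace (\<lambda>h. act (cartan K h)) \<mu>"
  by (simp add: weight_space_def joint_eigenspace_def)

text \<open>Components are unique since eigenvectors for distinct weights are independent; the
  spanning condition is the form that passes through generators.\<close>

lemma weight_module_iff:
  assumes lin: "\<And>h. clinear (act (cartan K h))"
  shows "weight_module K act \<longleftrightarrow> (\<forall>v. v \<in> eigensum (\<lambda>h. act (cartan K h)) (wt K act))"
proof (intro iffI allI)
  fix v assume "weight_module K act"
  from ex1_implies_ex[OF spec[OF this[unfolded weight_module_def], of v]]
  obtain c where c: "\<And>\<mu>. c \<mu> \<in> weight_space K act \<mu>" "{\<mu>. c \<mu> \<noteq> 0} \<subseteq> wt K act"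
      "v = (\<Sum>\<mu> | c \<mu> \<noteq> 0. c \<mu>)" by auto
  show "v \<in> eigensum (\<lambda>h. act (cartan K h)) (wt K act)"
    unfolding c(3) eigensum_def
    by (intro cvec.span_sum cvec.span_base) (use c(1,2) in \<open>auto simp: weight_space_eq\<close>)
next
  let ?T = "\<lambda>h. act (cartan K h)"
  assume all: "\<forall>v. v \<in> eigensum ?T (wt K act)"
  show "weight_module K act"
    unfolding weight_module_def weight_space_eq
  proof (intro allI ex_ex1I)
    fix v
    have "v \<in> eigensum ?T (wt K act)" using all by blast
    from eigensum_decomp[of ?T, OF lin this] obtain c where
      "finite {\<mu>. c \<mu> \<noteq> 0}" "\<And>\<mu>. c \<mu> \<in> joint_eigenspace ?T \<mu>" "{\<mu>. c \<mu> \<noteq> 0} \<subseteq> wt K act"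
      "v = (\<Sum>\<mu> | c \<mu> \<noteq> 0. c \<mu>)" by blast
    then show "\<exists>c. finite {\<mu>. c \<mu> \<noteq> 0} \<and> (\<forall>\<mu>. c \<mu> \<in> joint_eigenspace ?T \<mu>) \<and>
        {\<mu>. c \<mu> \<noteq> 0} \<subseteq> wt K act \<and> v = (\<Sum>\<mu> | c \<mu> \<noteq> 0. c \<mu>)" by blast
  next
    fix v c d
    assume "finite {\<mu>. c \<mu> \<noteq> 0} \<and> (\<forall>\<mu>. c \<mu> \<in> joint_eigenspace ?T \<mu>) \<and>
        {\<mu>. c \<mu> \<noteq> 0} \<subseteq> wt K act \<and> v = (\<Sum>\<mu> | c \<mu> \<noteq> 0. c \<mu>)"
      "finite {\<mu>. d \<mu> \<noteq> 0} \<and> (\<forall>\<mu>. d \<mu> \<in> joint_eigenspace ?T \<mu>) \<and>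
        {\<mu>. d \<mu> \<noteq> 0} \<subseteq> wt K act \<and> v = (\<Sum>\<mu> | d \<mu> \<noteq> 0. d \<mu>)"
    then have c: "finite {\<mu>. c \<mu> \<noteq> 0}" "\<And>\<mu>. c \<mu> \<in> joint_eigenspace ?T \<mu>" "v = (\<Sum>\<mu> | c \<mu> \<noteq> 0. c \<mu>)"
      and d: "finite {\<mu>. d \<mu> \<noteq> 0}" "\<And>\<mu>. d \<mu> \<in> joint_eigenspace ?T \<mu>" "v = (\<Sum>\<mu> | d \<mu> \<noteq> 0. d \<mu>)"
      by blast+
    let ?U = "{\<mu>. c \<mu> \<noteq> 0} \<union> {\<mu>. d \<mu> \<noteq> 0}"
    have "(\<Sum>\<mu> | c \<mu> \<noteq> 0. c \<mu>) = (\<Sum>\<mu>\<in>?U. c \<mu>)" "(\<Sum>\<mu> | d \<mu> \<noteq> 0. d \<mu>) = (\<Sum>\<mu>\<in>?U. d \<mu>)"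
      by (rule sum.mono_neutral_left; use c(1) d(1) in auto)+
    then have "(\<Sum>\<mu>\<in>?U. c \<mu> - d \<mu>) = 0"
      using c(3) d(3) by (simp add: sum_subtractf)
    then have zero: "\<forall>\<mu>\<in>?U. c \<mu> - d \<mu> = 0"
      by (intro joint_eigenspace_sum_eq_0[of ?T, OF lin])
        (simp add: c(1) d(1), rule cvec.subspace_diff[OF subspace_joint_eigenspace[of ?T, OF lin] c(2) d(2)])
    have "c \<mu> = d \<mu>" for \<mu>
    proof (cases "\<mu> \<in> ?U")
      case True
      then show ?thesis using bspec[OF zero] by simp
    qed simp
    then show "c = d" by blast
  qed
qed

lemma ex_linear_functional:
  fixes W :: "'v::complex_vector set"
  assumes "cvec.subspace W" "x \<notin> W"
  shows "\<exists>\<phi> :: 'v \<Rightarrow> complex. clinear \<phi> \<and> \<phi> x = 1 \<and> (\<forall>w\<in>W. \<phi> w = 0)"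
proof -
  interpret vp: vector_space_pair "scaleC :: complex \<Rightarrow> 'v \<Rightarrow> 'v" "scaleC :: complex \<Rightarrow> complex \<Rightarrow> complex"
    by unfold_locales
  obtain B where B: "B \<subseteq> W" "cvec.independent B" "W \<subseteq> cvec.span B"
    using cvec.maximal_independent_subset[of W] by blast
  have "x \<notin> cvec.span B" using cvec.span_minimal[OF B(1) assms(1)] assms(2) by blast
  then have "cvec.independent (insert x B)" by (rule cvec.independent_insertI[OF _ B(2)])
  from vp.linear_independent_extend[OF this, of "\<lambda>y. if y = x then 1 else 0"]
  obtain \<phi> :: "'v \<Rightarrow> complex" where \<phi>: "clinear \<phi>" "\<forall>y\<in>insert x B. \<phi> y = (if y = x then 1 else 0)" by blast
  have "x \<notin> B" using assms(2) B(1) by blast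
  have "\<phi> w = 0" if "w \<in> W" for w
  proof -
    have "\<phi> w \<in> {0}"
      by (rule clinear_span_subset[OF \<phi>(1), of "{0}" B w])
        (use \<phi>(2) B(3) that \<open>x \<notin> B\<close> in \<open>auto simp: cvec.subspace_def\<close>)
    then show ?thesis by simp
  qed
  with \<phi> show ?thesis by (intro exI[of _ \<phi>]) auto
qed

context km
begin

section \<open>Chains of weights and single steps\<close>

lemma ht_root_comb: "ht K (root_comb K c) = (\<Sum>i\<in>UNIV. c i)"
proof -
  have "(THE d. root_comb K c = root_comb K d) = c"
    by (rule the_equality) (auto dest: root_comb_inj)
  then show ?thesis by (simp add: ht_def)
qed

lemma root_comb_diff_unit_vec:
  "root_comb K (\<lambda>k. c k - unit_vec i k) h = root_comb K c h - simple_root K i h"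
  unfolding root_comb_unit_vec[symmetric] by (simp add: root_comb_def left_diff_distrib sum_subtractf)

text \<open>A step may be available at the upper or only at the lower end, so the induction varies
  both weights: the shorter chain is extended at its end or at its start. The condition c i > 0
  keeps the remaining difference non-negative.\<close>

lemma chain_exists:
  fixes X :: "('h \<Rightarrow> complex) set"
  assumes step: "\<And>\<mu>0 \<mu> c. \<mu>0 \<in> X \<Longrightarrow> \<mu> \<in> X \<Longrightarrow> c \<in> pos_vecs \<Longrightarrow> \<mu> - \<mu>0 = root_comb K c \<Longrightarrow>
      \<exists>i. c i > 0 \<and> ((\<lambda>h. \<mu> h - simple_root K i h) \<in> X \<or> (\<lambda>h. \<mu>0 h + simple_root K i h) \<in> X)"
    and "\<mu>0 \<in> X" "\<mu> \<in> X" "\<forall>i. c i \<ge> 0" "\<mu> - \<mu>0 = root_comb K c" "(\<Sum>i\<in>UNIV. c i) = int n"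
  shows "\<exists>\<nu>. \<nu> 0 = \<mu>0 \<and> \<nu> n = \<mu> \<and>
    (\<forall>i\<in>{1..n}. \<nu> i \<in> X \<and> \<nu> i - \<nu> (i - 1) \<in> range (simple_root K))"
  using assms(2-)
proof (induction n arbitrary: \<mu>0 \<mu> c)
  case 0
  then have "c = (\<lambda>_. 0)" by (simp add: sum_nonneg_eq_0_iff fun_eq_iff)
  then have "\<mu> h - \<mu>0 h = 0" for h
    using fun_cong[OF 0(4), of h] by (simp add: root_comb_def)
  then have "\<mu> = \<mu>0" by (simp add: fun_eq_iff)
  then show ?case by (intro exI[of _ "\<lambda>_. \<mu>"]) simp
next
  case (Suc n)
  have "c \<noteq> (\<lambda>_. 0)" using Suc.prems(5) by auto
  then have "c \<in> pos_vecs" using Suc.prems(3) by (simp add: pos_vecs_def)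
  from step[OF Suc.prems(1,2) this Suc.prems(4)] obtain i where
    i: "c i > 0" "(\<lambda>h. \<mu> h - simple_root K i h) \<in> X \<or> (\<lambda>h. \<mu>0 h + simple_root K i h) \<in> X" by blast
  define c' where "c' k = c k - unit_vec i k" for k
  have "(\<Sum>k\<in>UNIV. unit_vec i k) = 1" unfolding unit_vec_def by simp
  then have sum': "(\<Sum>k\<in>UNIV. c' k) = int n"
    using Suc.prems(5) by (simp add: c'_def sum_subtractf)
  have nonneg: "\<forall>k. c' k \<ge> 0" using Suc.prems(3) i(1) by (auto simp: c'_def unit_vec_def)
  have diff: "\<mu> h - \<mu>0 h = root_comb K c h" for h using fun_cong[OF Suc.prems(4), of h] by simp
  have rc: "root_comb K c' h = root_comb K c h - simple_root K i h" for h
    unfolding c'_def[abs_def] by (rule root_comb_diff_unit_vec)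
  from i(2) show ?case
  proof
    assume in_X: "(\<lambda>h. \<mu> h - simple_root K i h) \<in> X"
    have "(\<lambda>h. \<mu> h - simple_root K i h) - \<mu>0 = root_comb K c'"
      by (simp add: fun_eq_iff rc diff[symmetric])
    from Suc.IH[OF Suc.prems(1) in_X nonneg this sum'] obtain \<nu> where
      \<nu>: "\<nu> 0 = \<mu>0" "\<nu> n = (\<lambda>h. \<mu> h - simple_root K i h)"
        "\<forall>i\<in>{1..n}. \<nu> i \<in> X \<and> \<nu> i - \<nu> (i - 1) \<in> range (simple_root K)" by blast
    define \<nu>' where "\<nu>' = \<nu>(Suc n := \<mu>)"
    have "\<nu>' k \<in> X \<and> \<nu>' k - \<nu>' (k - 1) \<in> range (simple_root K)" if k: "k \<in> {1..Suc n}" for k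
    proof (cases "k = Suc n")
      case True
      have "\<mu> - \<nu> n = simple_root K i" by (simp add: \<nu>(2) fun_eq_iff)
      then show ?thesis using True Suc.prems(2) by (simp add: \<nu>'_def)
    next
      case False
      then have "k \<in> {1..n}" "\<nu>' k = \<nu> k" "\<nu>' (k - 1) = \<nu> (k - 1)" using k by (auto simp: \<nu>'_def)
      then show ?thesis using \<nu>(3) by simp
    qed
    moreover have "\<nu>' 0 = \<mu>0" "\<nu>' (Suc n) = \<mu>" using \<nu>(1) by (simp_all add: \<nu>'_def)
    ultimately show ?thesis by blast
  next
    assume in_X: "(\<lambda>h. \<mu>0 h + simple_root K i h) \<in> X"
    have "\<mu> - (\<lambda>h. \<mu>0 h + simple_root K i h) = root_comb K c'"
      by (simp add: fun_eq_iff rc diff[symmetric])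
    from Suc.IH[OF in_X Suc.prems(2) nonneg this sum'] obtain \<nu> where
      \<nu>: "\<nu> 0 = (\<lambda>h. \<mu>0 h + simple_root K i h)" "\<nu> n = \<mu>"
        "\<forall>i\<in>{1..n}. \<nu> i \<in> X \<and> \<nu> i - \<nu> (i - 1) \<in> range (simple_root K)" by blast
    define \<nu>' where "\<nu>' k = (case k of 0 \<Rightarrow> \<mu>0 | Suc k \<Rightarrow> \<nu> k)" for k
    have "\<nu>' k \<in> X \<and> \<nu>' k - \<nu>' (k - 1) \<in> range (simple_root K)" if k: "k \<in> {1..Suc n}" for k
    proof (cases "k = 1")
      case True
      have "\<nu> 0 - \<mu>0 = simple_root K i" by (simp add: \<nu>(1) fun_eq_iff)
      then show ?thesis using True in_X \<nu>(1) by (simp add: \<nu>'_def)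
    next
      case False
      then obtain l where l: "k = Suc (Suc l)" "Suc l \<in> {1..n}" using k by (cases k; cases "k - 1") auto
      then have "\<nu>' k = \<nu> (Suc l)" "\<nu>' (k - 1) = \<nu> (Suc l - 1)" by (simp_all add: \<nu>'_def)
      then show ?thesis using bspec[OF \<nu>(3) l(2)] by (simp only:)
    qed
    moreover have "\<nu>' 0 = \<mu>0" "\<nu>' (Suc n) = \<mu>" using \<nu>(2) by (simp_all add: \<nu>'_def)
    ultimately show ?thesis by blast
  qed
qed

lemma simple_root_chainsI:
  assumes step: "\<And>\<mu>0 \<mu> c. \<mu>0 \<in> X \<Longrightarrow> \<mu> \<in> X \<Longrightarrow> c \<in> pos_vecs \<Longrightarrow> \<mu> - \<mu>0 = root_comb K c \<Longrightarrow>
      \<exists>i. c i > 0 \<and> ((\<lambda>h. \<mu> h - simple_root K i h) \<in> X \<or> (\<lambda>h. \<mu>0 h + simple_root K i h) \<in> X)"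
  shows "simple_root_chains K X"
  unfolding simple_root_chains_def Let_def
proof (intro ballI impI)
  fix \<mu>0 \<mu> assume *: "\<mu>0 \<in> X" "\<mu> \<in> X" "root_prec K \<mu>0 \<mu> \<and> \<mu>0 \<noteq> \<mu>"
  then obtain c where c: "\<forall>i. c i \<ge> 0" "\<mu> - \<mu>0 = root_comb K c" by (auto simp: root_prec_def)
  have "(\<Sum>i\<in>UNIV. c i) = int (nat (ht K (\<mu> - \<mu>0)))"
    using c(1) by (simp add: c(2) ht_root_comb sum_nonneg)
  from chain_exists[OF step *(1,2) c this]
  show "\<exists>\<nu>. \<nu> 0 = \<mu>0 \<and> \<nu> (nat (ht K (\<mu> - \<mu>0))) = \<mu> \<and>
      (\<forall>i\<in>{1..nat (ht K (\<mu> - \<mu>0))}. \<nu> i \<in> X \<and> \<nu> i - \<nu> (i - 1) \<in> range (simple_root K))" .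
qed

lemma weight_space_shift:
  assumes "lie_module UNIV act" "x \<in> root_space K \<beta>" "v \<in> weight_space K act \<mu>"
  shows "act x v \<in> weight_space K act (\<lambda>h. \<mu> h + \<beta> h)"
proof -
  note lin = lie_module_linear[OF assms(1)]
  have "act (cartan K h) (act x v) = (\<mu> h + \<beta> h) *\<^sub>C act x v" for h
  proof -
    have "act (cartan K h) (act x v) = act (lie (cartan K h) x) v + act x (act (cartan K h) v)"
      by (simp add: lie_module_lie[OF assms(1)])
    then show ?thesis
      using assms(2,3)
      by (simp add: root_space_def weight_space_def action_scale[OF lin] clinear_scale[OF action_clinear[OF lin]]
          scaleC_add_left)
  qed
  then show ?thesis by (simp add: weight_space_def)
qed

text \<open>Linearity of \<mu> is inherited from the action by comparing coefficients of the
  non-zero vector v.\<close>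

lemma wtI:
  assumes "lie_module UNIV act" "v \<in> weight_space K act \<mu>" "v \<noteq> 0"
  shows "\<mu> \<in> wt K act"
proof -
  note lin = lie_module_linear[OF assms(1)]
  have w: "act (cartan K h) v = \<mu> h *\<^sub>C v" for h using assms(2) by (simp add: weight_space_def)
  have "\<mu> (x + y) *\<^sub>C v = (\<mu> x + \<mu> y) *\<^sub>C v" for x y
    unfolding scaleC_add_left w[symmetric]
    by (simp add: clinear_add[OF cartan_linear] action_add[OF lin])
  moreover have "\<mu> (c *\<^sub>C x) *\<^sub>C v = (c *\<^sub>C \<mu> x) *\<^sub>C v" for c x
    unfolding scaleC_complex_def scaleC_scaleC[symmetric] w[symmetric]
    by (simp add: clinear_scale[OF cartan_linear] action_scale[OF lin])
  ultimately have "clinear \<mu>" using assms(3) by (simp add: clinear_iff)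
  then show ?thesis using assms(2,3) by (auto simp: wt_def)
qed

lemma integrable_step:
  assumes V: "lie_module UNIV act"
    and nil: "locally_nilpotent (act (gen_e K j))" "locally_nilpotent (act (gen_f K j))"
    and wt: "\<mu>0 \<in> wt K act" "\<mu> \<in> wt K act" "\<mu> - \<mu>0 = root_comb K c" "pair_coroot j c > 0"
  shows "(\<lambda>h. \<mu> h - simple_root K j h) \<in> wt K act \<or> (\<lambda>h. \<mu>0 h + simple_root K j h) \<in> wt K act"
proof -
  let ?h = "simple_coroot K j"
  interpret sl2_action "act (gen_e K j)" "act (gen_f K j)" "act (cartan K ?h)"
    by (rule sl2_action_module[OF V]) simp_all
  interpret s: sl2_action "act (gen_f K j)" "act (gen_e K j)" "\<lambda>v. - act (cartan K ?h) v"
    by (rule swap)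
  have zero_mem: "0 \<in> weight_space K act \<mu>" for \<mu>
    by (simp add: weight_space_def clinear_0[OF action_clinear[OF lie_module_linear[OF V]]])
  obtain v where v: "v \<in> weight_space K act \<mu>" "v \<noteq> 0" using wt(2) zero_mem[of \<mu>] unfolding wt_def by blast
  obtain v0 where v0: "v0 \<in> weight_space K act \<mu>0" "v0 \<noteq> 0"
    using wt(1) zero_mem[of \<mu>0] unfolding wt_def by blast
  have hv: "act (cartan K ?h) v = \<mu> ?h *\<^sub>C v" "act (cartan K ?h) v0 = \<mu>0 ?h *\<^sub>C v0"
    using v v0 by (auto simp: weight_space_def)
  obtain m m0 where m: "\<mu> ?h = of_int m" "\<mu>0 ?h = of_int m0"
    using weight_in_Ints[OF nil hv(1) v(2)] weight_in_Ints[OF nil hv(2) v0(2)] by (auto elim!: Ints_cases)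
  have "of_int (m - m0) = (of_int (pair_coroot j c) :: complex)"
    using fun_cong[OF wt(3), of ?h] m by (simp add: root_comb_coroot)
  then have "m - m0 = pair_coroot j c" by (simp only: of_int_eq_iff)
  then consider "m > 0" | "m0 < 0" using wt(4) by linarith
  then show ?thesis
  proof cases
    case 1
    obtain k where k: "(act (gen_e K j) ^^ k) v = 0" using nil(1) by (auto simp: locally_nilpotent_def)
    have "act (gen_f K j) v \<noteq> 0"
    proof
      assume "act (gen_f K j) v = 0"
      then have "(act (gen_f K j) ^^ (nat m)) v = 0"
        using 1 by (cases "nat m") (simp_all add: funpow_swap1 clinear_0[OF clinear_funpow[OF lin(2)]])
      moreover have "act (cartan K ?h) v = of_nat (nat m) *\<^sub>C v" using 1 hv m by simp
      ultimately show False using f_funpow_eq_0[of v "nat m" k] k v(2) by blast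
    qed
    moreover have "act (gen_f K j) v \<in> weight_space K act (\<lambda>h. \<mu> h + - simple_root K j h)"
      by (rule weight_space_shift[OF V _ v(1)]) (simp add: root_space_def HF)
    ultimately show ?thesis using wtI[OF V] by fastforce
  next
    case 2
    obtain k where k: "(act (gen_f K j) ^^ k) v0 = 0" using nil(2) by (auto simp: locally_nilpotent_def)
    have "act (gen_e K j) v0 \<noteq> 0"
    proof
      assume "act (gen_e K j) v0 = 0"
      then have "(act (gen_e K j) ^^ (nat (- m0))) v0 = 0"
        using 2 by (cases "nat (- m0)") (simp_all add: funpow_swap1 clinear_0[OF clinear_funpow[OF lin(1)]])
      moreover have "- act (cartan K ?h) v0 = of_nat (nat (- m0)) *\<^sub>C v0" using 2 hv m by simp
      ultimately show False using s.f_funpow_eq_0[of v0 "nat (- m0)" k] k v0(2) by blast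
    qed
    moreover have "act (gen_e K j) v0 \<in> weight_space K act (\<lambda>h. \<mu>0 h + simple_root K j h)"
      by (rule weight_space_shift[OF V _ v0(1)]) (simp add: root_space_def HE)
    ultimately show ?thesis using wtI[OF V] by blast
  qed
qed

section \<open>The parabolic subalgebra\<close>

text \<open>The grading behind the induced module: the parabolic subalgebra is its non-negative
  part, and the Levi part has degree 0.\<close>

definition deg_off :: "'i set \<Rightarrow> ('i \<Rightarrow> int) \<Rightarrow> int"
  where "deg_off J c = (\<Sum>k\<in>- J. c k)"

lemma deg_off_add: "deg_off J (\<lambda>i. c i + d i) = deg_off J c + deg_off J d"
  by (simp add: deg_off_def sum.distrib)

lemma deg_off_eq_0: "\<forall>i. i \<notin> J \<longrightarrow> c i = 0 \<Longrightarrow> deg_off J c = 0"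
  by (simp add: deg_off_def)

lemma deg_off_unit_vec: "deg_off J (unit_vec i) = (if i \<in> J then 0 else 1)"
  "deg_off J (\<lambda>j. - unit_vec i j) = (if i \<in> J then 0 else - 1)"
  by (simp_all add: deg_off_def unit_vec_def sum_negf)

lemma deg_off_nonneg: "c \<in> pos_vecs \<Longrightarrow> deg_off J c \<ge> 0"
  by (simp add: deg_off_def pos_vecs_def sum_nonneg)

lemma root_sum_UNIV_Int:
  assumes "\<And>c. c \<in> S \<Longrightarrow> c \<in> neg_vecs \<union> {\<lambda>_. 0} \<union> pos_vecs \<Longrightarrow> c \<in> T"
  shows "root_sum S \<subseteq> root_sum T"
proof
  fix x assume "x \<in> root_sum S"
  then have "x \<in> root_sum (S \<inter> (neg_vecs \<union> {\<lambda>_. 0} \<union> pos_vecs))"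
    using root_sum_UNIV by (rule root_sum_Int)
  then show "x \<in> root_sum T" using root_sum_mono[of "S \<inter> (neg_vecs \<union> {\<lambda>_. 0} \<union> pos_vecs)" T] assms by blast
qed

lemma lie_subalgebra_g_sub: "lie_subalgebra (g_sub K J HJ)"
  unfolding g_sub_def by (rule lie_subalgebra_hull)

lemma gen_g_sub: "j \<in> J \<Longrightarrow> gen_e K j \<in> g_sub K J HJ" "j \<in> J \<Longrightarrow> gen_f K j \<in> g_sub K J HJ"
  unfolding g_sub_def by (auto intro!: hull_inc)

lemma g_sub_subset: "g_sub K J HJ \<subseteq> root_sum {c. \<forall>i. i \<notin> J \<longrightarrow> c i = 0}"
  unfolding g_sub_def
proof (intro hull_minimal lie_subalgebra_root_sum)
  have unit: "unit_vec j i = 0" if "j \<in> J" "i \<notin> J" for i j using that by (auto simp: unit_vec_def)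
  show "gen_e K ` J \<union> gen_f K ` J \<union> cartan K ` HJ \<subseteq> root_sum {c. \<forall>i. i \<notin> J \<longrightarrow> c i = 0}"
    using RV_subset_root_sum[OF _ gen_e_RV] RV_subset_root_sum[OF _ gen_f_RV]
      RV_subset_root_sum[OF _ cartan_RV] unit by auto
qed auto

text \<open>Stated for a family g so that it covers n_+ with positive and n_- with negative degrees.
  As g_J has degree 0 outside J, it normalizes \<open>root_sum S\<close>, and the sum of the two is
  a subalgebra.\<close>

lemma hull_subset_g_sub_plus:
  assumes g: "\<And>j. j \<in> J \<Longrightarrow> g j \<in> g_sub K J HJ" "\<And>j. j \<notin> J \<Longrightarrow> g j \<in> root_sum S"
    and S: "\<And>c d. c \<in> S \<Longrightarrow> d \<in> S \<Longrightarrow> (\<lambda>i. c i + d i) \<in> S"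
      "\<And>c d. deg_off J c = 0 \<Longrightarrow> d \<in> S \<Longrightarrow> (\<lambda>i. c i + d i) \<in> S"
    and x: "x \<in> lie_subalgebra hull (range g)"
  obtains s r where "s \<in> g_sub K J HJ" "r \<in> root_sum S" "x = s + r"
proof -
  let ?W = "{s + r |s r. s \<in> g_sub K J HJ \<and> r \<in> root_sum S}"
  note gs = lie_subalgebraD[OF lie_subalgebra_g_sub[of J HJ]]
  have deg0: "g_sub K J HJ \<subseteq> root_sum {c. deg_off J c = 0}"
    using g_sub_subset[of J HJ] root_sum_mono[of "{c. \<forall>i. i \<notin> J \<longrightarrow> c i = 0}" "{c. deg_off J c = 0}"]
      deg_off_eq_0 by blast
  have lie1: "lie s r \<in> root_sum S" if "s \<in> g_sub K J HJ" "r \<in> root_sum S" for s r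
    using that deg0 S(2) by (intro lie_root_sum[of s "{c. deg_off J c = 0}" r S]) auto
  have "lie_subalgebra ?W"
    unfolding lie_subalgebra_def
  proof (intro conjI ballI)
    show "cvec.subspace ?W" using cvec.subspace_sums[OF gs(1) subspace_root_sum] .
    fix x y assume "x \<in> ?W" "y \<in> ?W"
    then obtain s r s' r' where *: "x = s + r" "y = s' + r'" "s \<in> g_sub K J HJ" "r \<in> root_sum S"
      "s' \<in> g_sub K J HJ" "r' \<in> root_sum S" by blast
    have "lie r s' \<in> root_sum S"
      by (subst lie_swap) (rule cvec.subspace_neg[OF subspace_root_sum lie1[OF *(5,4)]])
    then have "lie s r' + lie r s' + lie r r' \<in> root_sum S"
      by (intro cvec.subspace_add[OF subspace_root_sum] lie1[OF *(3,6)] lie_root_sum[OF *(4,6)] S(1))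
    moreover have "lie x y = lie s s' + (lie s r' + lie r s' + lie r r')"
      unfolding * lie_add_left lie_add_right by (simp add: add_ac)
    ultimately show "lie x y \<in> ?W" using gs(2)[OF *(3,5)] by blast
  qed
  moreover have "range g \<subseteq> ?W"
  proof safe
    fix j
    show "\<exists>s r. g j = s + r \<and> s \<in> g_sub K J HJ \<and> r \<in> root_sum S"
    proof (cases "j \<in> J")
      case True
      then show ?thesis using g(1)[OF True] cvec.subspace_0[OF subspace_root_sum]
        by (intro exI[of _ "g j"] exI[of _ 0]) simp
    next
      case False
      then show ?thesis using g(2)[OF False] cvec.subspace_0[OF gs(1)]
        by (intro exI[of _ 0] exI[of _ "g j"]) simp
    qed
  qed
  ultimately have "x \<in> ?W" using x by (rule lie_hull_least)
  then show thesis using that by blast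
qed

lemma n_plus_decomp:
  assumes "x \<in> n_plus K"
  obtains s r where "s \<in> g_sub K J HJ" "r \<in> root_sum {c. deg_off J c > 0}" "x = s + r"
proof (rule hull_subset_g_sub_plus[of J "gen_e K" HJ "{c. deg_off J c > 0}" x])
  show "gen_e K j \<in> root_sum {c. deg_off J c > 0}" if "j \<notin> J" for j
    by (rule RV_subset_root_sum[OF _ gen_e_RV]) (simp add: deg_off_unit_vec that)
qed (use assms that in \<open>auto simp: gen_g_sub deg_off_add n_plus_def\<close>)

lemma n_minus_decomp:
  assumes "x \<in> n_minus"
  obtains s r where "s \<in> g_sub K J HJ" "r \<in> root_sum {c. deg_off J c < 0}" "x = s + r"
proof (rule hull_subset_g_sub_plus[of J "gen_f K" HJ "{c. deg_off J c < 0}" x])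
  show "gen_f K j \<in> root_sum {c. deg_off J c < 0}" if "j \<notin> J" for j
    by (rule RV_subset_root_sum[OF _ gen_f_RV]) (simp add: deg_off_unit_vec that)
qed (use assms that in \<open>auto simp: gen_g_sub deg_off_add n_minus_def\<close>)

lemma levi_subset: "levi K J HJ \<subseteq> root_sum {c. deg_off J c = 0}"
proof
  fix x assume "x \<in> levi K J HJ"
  then obtain s h where *: "s \<in> g_sub K J HJ" "x = s + cartan K h" by (auto simp: levi_def)
  have "s \<in> root_sum {c. deg_off J c = 0}"
    using * g_sub_subset[of J HJ] root_sum_mono[of "{c. \<forall>i. i \<notin> J \<longrightarrow> c i = 0}" "{c. deg_off J c = 0}"]
      deg_off_eq_0 by blast
  then show "x \<in> root_sum {c. deg_off J c = 0}"
    unfolding *(2) by (intro cvec.subspace_add[OF subspace_root_sum])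
      (auto intro: RV_subset_root_sum[OF _ cartan_RV] simp: deg_off_eq_0)
qed

lemma root_sum_deg_0: "root_sum {c. deg_off J c = 0} \<subseteq> root_sum {c. deg_off J c \<ge> 0}"
  by (rule root_sum_mono) auto

lemma levi_subset_parabolic: "levi K J HJ \<subseteq> parabolic K J HJ"
  unfolding levi_def parabolic_def using cvec.subspace_0[OF subspace_n_plus] by force

text \<open>Makes visible that this sum of three pieces is a subalgebra. For the reverse inclusion
  split the n_- component of x into an element of g_J and a part of negative degree; the latter is
  zero because x and all other terms have non-negative degree.\<close>

lemma parabolic_eq: "parabolic K J HJ = root_sum {c. deg_off J c \<ge> 0}"
proof (intro subset_antisym subsetI)
  fix x assume "x \<in> parabolic K J HJ"
  then obtain s h y where *: "s \<in> g_sub K J HJ" "y \<in> n_plus K" "x = s + cartan K h + y"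
    by (auto simp: parabolic_def)
  have "s + cartan K h \<in> levi K J HJ" using * by (auto simp: levi_def)
  then have "s + cartan K h \<in> root_sum {c. deg_off J c \<ge> 0}" using levi_subset root_sum_deg_0 by blast
  moreover have "y \<in> root_sum {c. deg_off J c \<ge> 0}"
    using * n_plus_subset root_sum_mono[of pos_vecs "{c. deg_off J c \<ge> 0}"] deg_off_nonneg by blast
  ultimately show "x \<in> root_sum {c. deg_off J c \<ge> 0}"
    unfolding * by (rule cvec.subspace_add[OF subspace_root_sum])
next
  fix x assume x: "x \<in> root_sum {c. deg_off J c \<ge> 0}"
  obtain y h z where *: "y \<in> n_minus" "z \<in> n_plus K" "x = y + cartan K h + z"
    by (rule triangular_decomposition)
  obtain s r where sr: "s \<in> g_sub K J HJ" "r \<in> root_sum {c. deg_off J c < 0}" "y = s + r"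
    using n_minus_decomp[OF *(1)] .
  have "s + cartan K h \<in> levi K J HJ" using sr by (auto simp: levi_def)
  then have "s + cartan K h \<in> root_sum {c. deg_off J c \<ge> 0}" using levi_subset root_sum_deg_0 by blast
  moreover have "z \<in> root_sum {c. deg_off J c \<ge> 0}"
    using * n_plus_subset root_sum_mono[of pos_vecs "{c. deg_off J c \<ge> 0}"] deg_off_nonneg by blast
  ultimately have "x - (s + cartan K h + z) \<in> root_sum {c. deg_off J c \<ge> 0}"
    using cvec.subspace_diff[OF subspace_root_sum x cvec.subspace_add[OF subspace_root_sum]] by blast
  moreover have "x - (s + cartan K h + z) = r" by (simp add: * sr)
  ultimately have "r = 0" using sr(2) by (intro root_sum_disjoint[of r "{c. deg_off J c < 0}"]) auto
  then have "x = s + cartan K h + z" by (simp add: * sr)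
  then show "x \<in> parabolic K J HJ" using sr(1) *(2) by (auto simp: parabolic_def)
qed

lemma parabolic_decomp:
  assumes "x \<in> parabolic K J HJ"
  obtains l r where "l \<in> levi K J HJ" "r \<in> root_sum {c. deg_off J c > 0}" "x = l + r"
proof -
  from assms obtain s h y where *: "s \<in> g_sub K J HJ" "y \<in> n_plus K" "x = s + cartan K h + y"
    by (auto simp: parabolic_def)
  obtain s' r where sr: "s' \<in> g_sub K J HJ" "r \<in> root_sum {c. deg_off J c > 0}" "y = s' + r"
    using n_plus_decomp[OF *(2)] .
  have "s + s' \<in> g_sub K J HJ"
    by (rule cvec.subspace_add[OF lie_subalgebraD(1)[OF lie_subalgebra_g_sub] *(1) sr(1)])
  then have "s + s' + cartan K h \<in> levi K J HJ" by (auto simp: levi_def)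
  moreover have "x = (s + s' + cartan K h) + r" by (simp add: * sr add_ac)
  ultimately show thesis using that sr(2) by blast
qed

text \<open>The part of positive degree outside J acts by zero and is preserved by bracketing with
  the Levi part, so the module law reduces to the Levi components.\<close>

lemma lie_module_inflated:
  assumes "inflated_module K J HJ act"
  shows "lie_module (parabolic K J HJ) act"
proof -
  let ?p = "parabolic K J HJ" and ?u = "root_sum {c. deg_off J c > 0}"
  have levi: "lie_module (levi K J HJ) act" and lin: "linear_action ?p act"
    and zero: "\<And>\<beta> x m. \<beta> \<in> pos_roots K - pos_roots_on K J \<Longrightarrow> x \<in> root_space K \<beta> \<Longrightarrow> act x m = 0"
    using assms by (auto simp: inflated_module_def)
  have sub: "cvec.subspace ?p" unfolding parabolic_eq by (rule subspace_root_sum)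
  have u_p: "?u \<subseteq> ?p" unfolding parabolic_eq by (rule root_sum_mono) auto
  \<comment> \<open>A non-zero x makes c a root, and its positive degree keeps it out of the roots
    of J, so the inflation hypothesis applies.\<close>
  have root_zero: "act x m = 0" if c: "c \<in> pos_vecs" "deg_off J c > 0" and x: "x \<in> RV c" for c x m
  proof (cases "x = 0")
    case True
    then show ?thesis using action_scale[OF lin cvec.subspace_0[OF sub], of 0 m] by simp
  next
    case False
    have "root_comb K c \<noteq> (\<lambda>_. 0)"
    proof
      assume "root_comb K c = (\<lambda>_. 0)"
      then have "root_comb K c = root_comb K (\<lambda>_. 0)" by (simp add: root_comb_def)
      then have "c = (\<lambda>_. 0)" by (rule root_comb_inj)
      with c(1) show False by (simp add: pos_vecs_def)
    qed
    then have "root_comb K c \<in> pos_roots K"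
      using c(1) x False by (auto simp: pos_roots_def roots_def pos_vecs_def)
    moreover have "root_comb K c \<notin> pos_roots_on K J"
      using c(2) deg_off_eq_0[of J c] by (auto simp: pos_roots_on_def dest!: root_comb_inj)
    ultimately show ?thesis using zero x by blast
  qed
  have u_zero: "act x m = 0" if "x \<in> ?u" for x m
  proof -
    have "x \<in> root_sum (pos_vecs \<inter> {c. deg_off J c > 0})"
    proof (rule subsetD[OF root_sum_UNIV_Int that])
      fix c assume c: "c \<in> {c. deg_off J c > 0}" "c \<in> neg_vecs \<union> {\<lambda>_. 0} \<union> pos_vecs"
      have "deg_off J c \<le> 0" if "c \<in> neg_vecs \<union> {\<lambda>_. 0}"
        using that by (auto simp: deg_off_def neg_vecs_def intro: sum_nonpos)
      with c show "c \<in> pos_vecs \<inter> {c. deg_off J c > 0}" by auto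
    qed
    then have "x \<in> ?p \<and> (\<forall>m. act x m = 0)"
      unfolding root_sum_def
    proof (induction rule: cvec.span_induct_alt)
      case base
      show ?case using cvec.subspace_0[OF sub] action_scale[OF lin cvec.subspace_0[OF sub], of 0] by simp
    next
      case (step k x y)
      then obtain c where c: "c \<in> pos_vecs" "deg_off J c > 0" "x \<in> RV c" by blast
      then have x: "x \<in> ?p" unfolding parabolic_eq by (intro RV_subset_root_sum[of c]) auto
      then have "k *\<^sub>C x \<in> ?p" by (rule cvec.subspace_scale[OF sub])
      then show ?case
        using step x root_zero[OF c]
        by (simp add: action_add[OF lin] action_scale[OF lin] cvec.subspace_add[OF sub])
    qed
    then show ?thesis by blast
  qed
  show ?thesis
    unfolding lie_module_def
  proof (intro conjI lin ballI allI)
    fix x y v assume "x \<in> ?p" "y \<in> ?p"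
    obtain l r where x: "l \<in> levi K J HJ" "r \<in> ?u" "x = l + r" using parabolic_decomp[OF \<open>x \<in> ?p\<close>] .
    obtain l' r' where y: "l' \<in> levi K J HJ" "r' \<in> ?u" "y = l' + r'" using parabolic_decomp[OF \<open>y \<in> ?p\<close>] .
    have p: "l \<in> ?p" "l' \<in> ?p" "r \<in> ?p" "r' \<in> ?p" using x y levi_subset_parabolic u_p by blast+
    note l0 = subsetD[OF levi_subset x(1)] subsetD[OF levi_subset y(1)]
    have "lie l r' \<in> ?u" "lie r l' \<in> ?u" "lie r r' \<in> ?u"
      using lie_root_sum[OF l0(1) y(2)] lie_root_sum[OF x(2) l0(2)] lie_root_sum[OF x(2) y(2)]
      by (simp_all add: deg_off_add)
    then have ru: "lie l r' + lie r l' + lie r r' \<in> ?u" by (intro cvec.subspace_add[OF subspace_root_sum])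
    have eq: "lie x y = lie l l' + (lie l r' + lie r l' + lie r r')"
      unfolding x(3) y(3) lie_add_left lie_add_right by (simp add: add_ac)
    have "lie l l' \<in> root_sum {c. deg_off J c = 0}"
      by (rule lie_root_sum[OF l0]) (simp add: deg_off_add)
    then have "lie l l' \<in> ?p"
      unfolding parabolic_eq using root_sum_deg_0 by blast
    then have "act (lie x y) v = act (lie l l') v"
      unfolding eq using ru u_p by (subst action_add[OF lin]) (auto simp: u_zero)
    moreover have "act x w = act l w" "act y w = act l' w" for w
      unfolding x(3) y(3) using p by (simp_all add: action_add[OF lin] u_zero x(2) y(2))
    ultimately show "act (lie x y) v = act x (act y v) - act y (act x v)"
      using lie_module_lie[OF levi x(1) y(1)] by simp
  qed
qed

lemma split_parabolic:
  assumes "lie_module (parabolic K J HJ) actM"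
  shows "split_lie_algebra (root_sum {c. deg_off J c < 0}) (parabolic K J HJ) actM"
proof
  show "lie_subalgebra (root_sum {c. deg_off J c < 0})"
    by (rule lie_subalgebra_root_sum) (simp add: deg_off_add)
  show "lie_subalgebra (parabolic K J HJ)"
    unfolding parabolic_eq by (rule lie_subalgebra_root_sum) (simp add: deg_off_add)
  show "\<exists>y\<in>root_sum {c. deg_off J c < 0}. x - y \<in> parabolic K J HJ" for x
  proof -
    have "x \<in> root_sum ({c. deg_off J c < 0} \<union> {c. deg_off J c \<ge> 0})"
      using root_sum_UNIV[of x] root_sum_mono[of "neg_vecs \<union> {\<lambda>_. 0} \<union> pos_vecs"
          "{c. deg_off J c < 0} \<union> {c. deg_off J c \<ge> 0}"] by force
    then obtain y z where "y \<in> root_sum {c. deg_off J c < 0}" "z \<in> root_sum {c. deg_off J c \<ge> 0}" "x = y + z"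
      by (rule root_sum_Un)
    then show ?thesis unfolding parabolic_eq by (intro bexI[of _ y]) simp_all
  qed
  show "x = 0" if "x \<in> root_sum {c. deg_off J c < 0}" "x \<in> parabolic K J HJ" for x
    using that unfolding parabolic_eq by (rule root_sum_disjoint) auto
qed (rule assms)

lemma
  shows cartan_parabolic: "cartan K h \<in> parabolic K J HJ"
    and gen_e_parabolic: "gen_e K i \<in> parabolic K J HJ"
    and gen_f_parabolic: "i \<in> J \<Longrightarrow> gen_f K i \<in> parabolic K J HJ"
  unfolding parabolic_eq
  using RV_subset_root_sum[OF _ gen_e_RV] RV_subset_root_sum[OF _ gen_f_RV] RV_subset_root_sum[OF _ cartan_RV]
  by (auto simp: deg_off_unit_vec deg_off_eq_0)

section \<open>Modules induced from the parabolic subalgebra\<close>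

context
  fixes J :: "'i set" and HJ :: "'h set"
    and actM :: "'g \<Rightarrow> 'm::complex_vector \<Rightarrow> 'm" and actN :: "'g \<Rightarrow> 'n::complex_vector \<Rightarrow> 'n"
    and t :: "'g uea \<Rightarrow> 'm \<Rightarrow> 'n"
  assumes M: "lie_module (parabolic K J HJ) actM"
    and N: "induced_module (parabolic K J HJ) actM actN t"
begin

interpretation induced "root_sum {c. deg_off J c < 0}" "parabolic K J HJ" actM actN t
  by (intro induced.intro split_parabolic[OF M] induced_axioms.intro N)

text \<open>The functional \<phi> is 1 on f_i and 0 in degrees at most -2; the latter contain all
  brackets of two elements of negative degree.\<close>

lemma gen_f_injective:
  assumes "i \<notin> J" "actN (gen_f K i) n = 0"
  shows "n = 0"
proof -
  have f: "gen_f K i \<in> root_sum {c. deg_off J c = - 1}"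
    by (rule RV_subset_root_sum[OF _ gen_f_RV]) (simp add: deg_off_unit_vec assms(1))
  have "{c. deg_off J c = - 1} \<inter> {c. deg_off J c \<le> - 2} = {}" by auto
  then have "gen_f K i \<notin> root_sum {c. deg_off J c \<le> - 2}"
    using root_sum_disjoint[OF f, of "{c. deg_off J c \<le> - 2}"] gen_nonzero(2) by blast
  from ex_linear_functional[OF subspace_root_sum this]
  obtain \<phi> :: "'g \<Rightarrow> complex" where \<phi>: "clinear \<phi>" "\<phi> (gen_f K i) = 1"
    "\<forall>w\<in>root_sum {c. deg_off J c \<le> - 2}. \<phi> w = 0" by blast
  show ?thesis
  proof (rule actN_injective[OF \<phi>(1)])
    show "\<phi> (lie y y') = 0"
      if "y \<in> root_sum {c. deg_off J c < 0}" "y' \<in> root_sum {c. deg_off J c < 0}" for y y'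
      by (intro bspec[OF \<phi>(3)] lie_root_sum[OF that]) (simp add: deg_off_add)
    show "gen_f K i \<in> root_sum {c. deg_off J c < 0}"
      by (rule subsetD[OF root_sum_mono f]) auto
  qed (use \<phi>(2) assms(2) in simp_all)
qed

lemma wt_induced_minus_root:
  assumes "i \<notin> J" "\<mu> \<in> wt K actN"
  shows "(\<lambda>h. \<mu> h - simple_root K i h) \<in> wt K actN"
proof -
  have "0 \<in> weight_space K actN \<mu>" by (simp add: weight_space_def clinear_0[OF N_clinear])
  then obtain v where v: "v \<in> weight_space K actN \<mu>" "v \<noteq> 0" using assms(2) unfolding wt_def by blast
  have "actN (gen_f K i) v \<in> weight_space K actN (\<lambda>h. \<mu> h + - simple_root K i h)"
    by (rule weight_space_shift[OF N_module _ v(1)]) (simp add: root_space_def HF)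
  moreover have "actN (gen_f K i) v \<noteq> 0" using gen_f_injective[OF assms(1)] v(2) by blast
  ultimately show ?thesis using wtI[OF N_module] by fastforce
qed

text \<open>The vectors killed by a power of x contain 1 \<otimes> M and are stable under \<gg> by
  the Leibniz rule, since ad x is locally nilpotent.\<close>

lemma locally_nilpotent_induced:
  assumes x: "x \<in> parabolic K J HJ" and "locally_nilpotent (lie x)" "locally_nilpotent (actM x)"
  shows "locally_nilpotent (actN x)"
proof -
  let ?x = "actN x"
  let ?W = "{n. \<exists>k. (?x ^^ k) n = 0}"
  note lin = clinear_funpow[OF N_clinear]
  have later: "(?x ^^ (k + l)) n = 0" if "(?x ^^ l) n = 0" for k l n
    by (simp add: funpow_add that clinear_0[OF lin])
  have "n \<in> ?W" for n
  proof (rule N_induct)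
    show "cvec.subspace ?W"
      unfolding cvec.subspace_def
    proof (safe, goal_cases)
      case 1
      show ?case by (rule exI[of _ 0]) simp
    next
      case (2 m n k l)
      then show ?case
        using later[of k m l] later[of l n k]
        by (intro exI[of _ "k + l"]) (simp add: clinear_add[OF lin] add.commute[of l k])
    next
      case (3 c n k)
      then show ?case by (intro exI[of _ k]) (simp add: clinear_scale[OF lin])
    qed
    show "actN y n \<in> ?W" if n: "n \<in> ?W" for y n
    proof -
      obtain l where l: "(?x ^^ l) n = 0" using n by blast
      obtain k where k: "(lie x ^^ k) y = 0" using assms(2) by (auto simp: locally_nilpotent_def)
      have "(?x ^^ (k + l)) (actN y n) = 0"
      proof (rule bilinear_funpow_derivation[where B = actN and ?D1.0 = "lie x" and ?D2.0 = ?x])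
        show "actN 0 v = 0" for v using action_scale[OF N_linear UNIV_I, of 0 0 v] by simp
      qed (simp_all add: clinear_0[OF N_clinear] N_clinear lie_module_lie[OF N_module] k l)
      then show ?thesis by blast
    qed
    show "t 1 m \<in> ?W" for m
    proof -
      obtain k where "(actM x ^^ k) m = 0" using assms(3) by (auto simp: locally_nilpotent_def)
      moreover have "(?x ^^ k) (t 1 m) = t 1 ((actM x ^^ k) m)" for k
        by (induction k) (simp_all add: t_1_p[OF x])
      ultimately have "(?x ^^ k) (t 1 m) = 0" by (simp add: clinear_0[OF clinear_t])
      then show ?thesis by blast
    qed
  qed
  then show ?thesis unfolding locally_nilpotent_def by blast
qed

lemma locally_nilpotent_on_induced:
  assumes "fin_dim (UNIV :: 'm set)"
  shows "locally_nilpotent_on K J actN"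
  unfolding locally_nilpotent_on_def
proof (intro ballI conjI)
  fix j assume j: "j \<in> J"
  let ?h = "cartan K (simple_coroot K j)"
  note p = gen_e_parabolic[of j J HJ] gen_f_parabolic[OF j, of HJ] cartan_parabolic[of "simple_coroot K j" J HJ]
  interpret sl2_action "actM (gen_e K j)" "actM (gen_f K j)" "actM ?h"
    by (rule sl2_action_module[OF M p])
  \<comment> \<open>On the finite-dimensional M nilpotency is forced by [h, e] = 2 e; for f the
    constant is -2.\<close>
  show "locally_nilpotent (actN (gen_e K j))"
    by (intro locally_nilpotent_induced p ad_gen_e_locally_nilpotent
        locally_nilpotent_fin_dim[OF assms lin(1) lin(3), of 2] he) simp
  show "locally_nilpotent (actN (gen_f K j))"
    by (intro locally_nilpotent_induced p ad_gen_f_locally_nilpotent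
        locally_nilpotent_fin_dim[OF assms lin(2) lin(3), of "- 2"]) (simp_all add: hf)
qed

text \<open>Weight vectors of M give weight vectors 1 \<otimes> m, and \<gg> is spanned by vectors
  that shift weights.\<close>

lemma weight_module_induced:
  assumes "weight_module K actM"
  shows "weight_module K actN"
proof -
  let ?W = "eigensum (\<lambda>h. actN (cartan K h)) (wt K actN)"
  have sub: "cvec.subspace ?W" by (simp add: eigensum_def)
  have weight: "v \<in> ?W" if "v \<in> weight_space K actN \<mu>" for v \<mu>
  proof (cases "v = 0")
    case True
    then show ?thesis by (simp add: cvec.subspace_0[OF sub])
  next
    case False
    then show ?thesis
      using wtI[OF N_module that] that unfolding eigensum_def weight_space_eq by (blast intro: cvec.span_base)
  qed
  have "n \<in> ?W" for n
  proof (rule N_induct[OF sub])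
    show "actN x n \<in> ?W" if "n \<in> ?W" for x n
    proof (rule clinear_span_subset[OF N_clinear sub _ that[unfolded eigensum_def]])
      fix v assume "v \<in> (\<Union>\<mu>\<in>wt K actN. joint_eigenspace (\<lambda>h. actN (cartan K h)) \<mu>)"
      then obtain \<mu> where v: "v \<in> weight_space K actN \<mu>" by (auto simp: weight_space_eq)
      have "clinear (\<lambda>x. actN x v)"
        by (simp add: clinear_iff action_add[OF N_linear] action_scale[OF N_linear])
      then show "actN x v \<in> ?W"
        by (rule clinear_span_subset[OF _ sub _ root_sum_UNIV[of x, unfolded root_sum_def]])
          (use weight weight_space_shift[OF N_module _ v] in blast)
    qed
    show "t 1 m \<in> ?W" for m
    proof (rule clinear_span_subset[OF clinear_t sub])
      have "m \<in> eigensum (\<lambda>h. actM (cartan K h)) (wt K actM)"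
        using weight_module_iff[of actM K] M_clinear[OF cartan_parabolic] assms by blast
      then show "m \<in> cvec.span (\<Union>\<mu>\<in>wt K actM. joint_eigenspace (\<lambda>h. actM (cartan K h)) \<mu>)"
        by (simp add: eigensum_def)
      fix v assume "v \<in> (\<Union>\<mu>\<in>wt K actM. joint_eigenspace (\<lambda>h. actM (cartan K h)) \<mu>)"
      then obtain \<mu> where "\<And>h. actM (cartan K h) v = \<mu> h *\<^sub>C v" by (auto simp: joint_eigenspace_def)
      then have "t 1 v \<in> weight_space K actN \<mu>"
        by (simp add: weight_space_def t_1_p cartan_parabolic t_scale_right)
      then show "t 1 v \<in> ?W" by (rule weight)
    qed
  qed
  then show ?thesis using weight_module_iff[of actN K] N_clinear by blast
qed

lemma simple_root_chains_induced:
  assumes "fin_dim (UNIV :: 'm set)" "fin_dim (g_sub K J HJ)"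
  shows "simple_root_chains K (wt K actN)"
proof (rule simple_root_chainsI)
  fix \<mu>0 \<mu> c
  assume *: "\<mu>0 \<in> wt K actN" "\<mu> \<in> wt K actN" "c \<in> pos_vecs" "\<mu> - \<mu>0 = root_comb K c"
  note nil = locally_nilpotent_on_induced[OF assms(1), unfolded locally_nilpotent_on_def]
  show "\<exists>i. c i > 0 \<and> ((\<lambda>h. \<mu> h - simple_root K i h) \<in> wt K actN \<or>
      (\<lambda>h. \<mu>0 h + simple_root K i h) \<in> wt K actN)"
  proof (cases "\<exists>i. i \<notin> J \<and> c i \<noteq> 0")
    case True
    then obtain i where i: "i \<notin> J" "c i \<noteq> 0" by blast
    moreover have "c i \<ge> 0" using *(3) by (simp add: pos_vecs_def)
    ultimately show ?thesis using wt_induced_minus_root[OF i(1) *(2)] by (intro exI[of _ i]) simp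
  next
    case False
    note gs = lie_subalgebraD[OF lie_subalgebra_g_sub[of J HJ]]
    obtain j where "j \<in> J" "c j > 0" "pair_coroot j c > 0"
      using finite_type[OF gs(1) assms(2) g_sub_subset gen_g_sub(1) gs(2)[OF gen_g_sub(1)]
          gs(2)[OF gen_g_sub(2)] *(3)] False by blast
    then show ?thesis using integrable_step[OF N_module _ _ *(1,2,4), of j] nil by blast
  qed
qed

end

text \<open>Here \<open>finite_type\<close> is applied with L the whole algebra and J the full index
  set.\<close>

lemma simple_root_chains_integrable:
  assumes "fin_dim (UNIV :: 'g set)" "lie_module UNIV act" "locally_nilpotent_on K UNIV act"
  shows "simple_root_chains K (wt K act)"
proof (rule simple_root_chainsI)
  fix \<mu>0 \<mu> c
  assume *: "\<mu>0 \<in> wt K act" "\<mu> \<in> wt K act" "c \<in> pos_vecs" "\<mu> - \<mu>0 = root_comb K c"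
  have "UNIV \<subseteq> root_sum UNIV"
    using root_sum_UNIV root_sum_mono[of "neg_vecs \<union> {\<lambda>_. 0} \<union> pos_vecs" UNIV] by blast
  then obtain j where "c j > 0" "pair_coroot j c > 0"
    using finite_type[of UNIV UNIV c] assms(1) *(3) by auto
  then show "\<exists>i. c i > 0 \<and> ((\<lambda>h. \<mu> h - simple_root K i h) \<in> wt K act \<or>
      (\<lambda>h. \<mu>0 h + simple_root K i h) \<in> wt K act)"
    using integrable_step[OF assms(2) _ _ *(1,2,4), of j] assms(3)
    unfolding locally_nilpotent_on_def by blast
qed

end

theorem corollary5p5:
  fixes K :: "('i::finite, 'h::complex_vector, 'g::complex_lie_algebra) km_data"
  assumes "kac_moody_algebra K"
  shows
   "(\<forall>actV :: 'g \<Rightarrow> 'v::complex_vector \<Rightarrow> 'v.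
       semisimple_lie (UNIV :: 'g set) \<and> lie_module UNIV actV \<and> km_integrable K UNIV actV
       \<longrightarrow> simple_root_chains K (wt K actV)) \<and>
    (\<forall>J HJ (actM :: 'g \<Rightarrow> 'm::complex_vector \<Rightarrow> 'm) (actN :: 'g \<Rightarrow> 'n::complex_vector \<Rightarrow> 'n) t.
       realization K J HJ \<and> semisimple_lie (g_sub K J HJ) \<and>
       fin_dim (UNIV :: 'm set) \<and>
       (lie_module (parabolic K J HJ) actM \<or> inflated_module K J HJ actM) \<and>
       induced_module (parabolic K J HJ) actM actN t
       \<longrightarrow> (weight_module K actM \<longrightarrow> km_integrable K J actN) \<and>
           locally_nilpotent_on K J actN \<and>
           simple_root_chains K (wt K actN))"
proof -
  interpret km K by (rule kac_moody_algebra_imp_km[OF assms])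
  show ?thesis
  proof (intro conjI allI impI; elim conjE)
    fix actV :: "'g \<Rightarrow> 'v \<Rightarrow> 'v"
    assume "semisimple_lie (UNIV :: 'g set)" "lie_module UNIV actV" "km_integrable K UNIV actV"
    then show "simple_root_chains K (wt K actV)"
      by (intro simple_root_chains_integrable) (simp_all add: semisimple_lie_def km_integrable_def)
  next
    fix J HJ and actM :: "'g \<Rightarrow> 'm \<Rightarrow> 'm" and actN :: "'g \<Rightarrow> 'n \<Rightarrow> 'n" and t
    assume fd: "semisimple_lie (g_sub K J HJ)" "fin_dim (UNIV :: 'm set)"
      and "lie_module (parabolic K J HJ) actM \<or> inflated_module K J HJ actM"
      and N: "induced_module (parabolic K J HJ) actM actN t"
    then have M: "lie_module (parabolic K J HJ) actM" using lie_module_inflated by blast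
    show nil: "locally_nilpotent_on K J actN" by (rule locally_nilpotent_on_induced[OF M N fd(2)])
    show "km_integrable K J actN" if "weight_module K actM"
      unfolding km_integrable_def using weight_module_induced[OF M N that] nil by blast
    show "simple_root_chains K (wt K actN)"
      by (rule simple_root_chains_induced[OF M N fd(2)]) (use fd(1) in \<open>simp add: semisimple_lie_def\<close>)
  qed
qed

end
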